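(* Let $c_j^\pm>0$ ($1\le j\le n$), $\alpha_\pm>0$, $\beta>0$ be constants, and let $m_\pm$, $\varphi_\pm$ and $\mathcal{L}_\tau$ be as defined in the context. Assume that $$\exists\,\xi_0'\in\mathbb{R}^{n-1}\setminus\{0\},\qquad \frac{\alpha_+}{\alpha_-}<\frac{m_+(\xi_0')}{m_-(\xi_0')}.$$ Then, for any neighborhood $V$ of the origin in $\mathbb{R}^n$, any $C>0$ and any $\tau_0>0$, there exist $\tau\ge\tau_0$ and a function $v=H_+v_++H_-v_-$, with $v_\pm\in C_c^\infty(\mathbb{R}^n)$, $v\neq0$, satisfying at $x_n=0$ the transmission conditions $$v_+=v_-,\qquad c_n^+(D_nv_++i\tau\alpha_+v_+)=c_n^-(D_nv_-+i\tau\alpha_-v_-),$$ such that $$\operatorname{supp}(v)\subset V\quad\text{and}\quad C\|\mathcal{L}_\tau v\|_{L^2(\mathbb{R}^{n-1}\times\mathbb{R})}\le\|v\|_{L^2(\mathbb{R}^{n-1}\times\mathbb{R})}.$$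
   Context: Write $x=(x',x_n)\in\mathbb{R}^{n-1}\times\mathbb{R}$, $D_j=\frac1i\partial_{x_j}$, and $H_\pm=\mathbf{1}_{\{\pm x_n>0\}}$. The piecewise constant operator is $\mathcal{L}_0=\sum_{1\le j\le n}D_jc_jD_j$ with $c_j=H_+c_j^++H_-c_j^-$. The weight is $\varphi=H_+\varphi_++H_-\varphi_-$ with $\varphi_\pm(x_n)=\alpha_\pm x_n+\beta x_n^2/2$. Set $$m_\pm(\xi')=(c_n^\pm)^{-1/2}\Big(\sum_{1\le j\le n-1}c_j^\pm\xi_j^2\Big)^{1/2},\qquad \xi'\in\mathbb{R}^{n-1},$$ and let $m_\pm(D')$ be the corresponding Fourier multipliers in $x'$. The conjugated operator $\mathcal{L}_\tau=e^{\tau\varphi}\mathcal{L}_0e^{-\tau\varphi}$ acts on functions $v=H_+v_++H_-v_-$, $v_\pm\in C_c^\infty(\mathbb{R}^n)$, satisfying at $x_n=0$ the transmission conditions $v_+=v_-$ and $c_n^+(D_nv_++i\tau\alpha_+v_+)=c_n^-(D_nv_-+i\tau\alpha_-v_-)$, by $$\mathcal{L}_\tau v=H_+c_n^+\big((D_n+i\tau\varphi_+')^2+m_+(D')^2\big)v_++H_-c_n^-\big((D_n+i\tau\varphi_-')^2+m_-(D')^2\big)v_-,$$ where $\varphi_\pm'=\partial_{x_n}\varphi_\pm=\alpha_\pm+\beta x_n$. *)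

theory Defs
  imports "HOL-Analysis.Analysis"
begin

(* A point of R^n = R^(n-1) x R is a pair (x', x_n) :: (real^'d) * real with CARD('d) = n - 1. *)

section \<open>Test functions and the \<open>L\<^sup>2\<close> norm\<close>

primrec Ck :: "nat \<Rightarrow> ('a::euclidean_space \<Rightarrow> 'b::real_normed_vector) \<Rightarrow> bool" where
  "Ck 0 f \<longleftrightarrow> continuous_on UNIV f"
| "Ck (Suc k) f \<longleftrightarrow> (\<forall>x. f differentiable (at x)) \<and>
     (\<forall>b\<in>Basis. Ck k (\<lambda>x. frechet_derivative f (at x) b))"

definition supp :: "('a::topological_space \<Rightarrow> 'b::zero) \<Rightarrow> 'a set" where
  "supp f = closure {x. f x \<noteq> 0}"

definition Cc_infinity :: "('a::euclidean_space \<Rightarrow> complex) set" where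
  "Cc_infinity = {f. (\<forall>k. Ck k f) \<and> compact (supp f)}"

text \<open>The norm takes the value \<open>\<infinity>\<close> off \<open>L\<^sup>2\<close>, so that the convention that
  the Bochner integral of a non-integrable function is \<open>0\<close> plays no role.\<close>

definition L2_norm :: "('a::euclidean_space \<Rightarrow> complex) \<Rightarrow> ennreal" where
  "L2_norm f =
     (if f \<in> borel_measurable lborel \<and> integrable lborel (\<lambda>x. (cmod (f x))\<^sup>2)
      then ennreal (sqrt (LINT x|lborel. (cmod (f x))\<^sup>2)) else \<infinity>)"

section \<open>Fourier multipliers in the tangential variables\<close>

definition fourier :: "(real^'d::finite \<Rightarrow> complex) \<Rightarrow> real^'d \<Rightarrow> complex" where
  "fourier u \<xi> = (LINT x|lborel. cis (- (x \<bullet> \<xi>)) * u x)"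

definition fourier_inv :: "(real^'d::finite \<Rightarrow> complex) \<Rightarrow> real^'d \<Rightarrow> complex" where
  "fourier_inv g x =
     complex_of_real (1 / (2 * pi) ^ CARD('d)) * (LINT \<xi>|lborel. cis (x \<bullet> \<xi>) * g \<xi>)"

definition tangential_multiplier ::
    "(real^'d::finite \<Rightarrow> real) \<Rightarrow> ((real^'d) \<times> real \<Rightarrow> complex) \<Rightarrow> (real^'d) \<times> real \<Rightarrow> complex"
  where
  "tangential_multiplier a w =
     (\<lambda>(x, t). fourier_inv (\<lambda>\<xi>. complex_of_real (a \<xi>) * fourier (\<lambda>y. w (y, t)) \<xi>) x)"

section \<open>The conjugated operator\<close>

text \<open>The data of one side of the interface are \<open>c\<close> (the constants \<open>c\<^sub>j\<close> with \<open>j < n\<close>),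
  \<open>cn\<close> (the constant \<open>c\<^sub>n\<close>) and \<open>\<alpha>\<close>.\<close>

definition m_symbol :: "('d::finite \<Rightarrow> real) \<Rightarrow> real \<Rightarrow> real^'d \<Rightarrow> real" where
  "m_symbol c cn \<xi> = cn powr (- 1 / 2) * (\<Sum>j\<in>UNIV. c j * (\<xi> $ j)\<^sup>2) powr (1 / 2)"

definition weight :: "real \<Rightarrow> real \<Rightarrow> real \<Rightarrow> real" where
  "weight \<alpha> \<beta> t = \<alpha> * t + \<beta> * t\<^sup>2 / 2"

definition D_n :: "((real^'d::finite) \<times> real \<Rightarrow> complex) \<Rightarrow> (real^'d) \<times> real \<Rightarrow> complex" where
  "D_n w = (\<lambda>(x, t). (1 / \<i>) * vector_derivative (\<lambda>s. w (x, s)) (at t))"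

definition D_n_conj :: "real \<Rightarrow> real \<Rightarrow> real \<Rightarrow>
    ((real^'d::finite) \<times> real \<Rightarrow> complex) \<Rightarrow> (real^'d) \<times> real \<Rightarrow> complex" where
  "D_n_conj \<tau> \<alpha> \<beta> w =
     (\<lambda>(x, t). D_n w (x, t) + \<i> * complex_of_real (\<tau> * deriv (weight \<alpha> \<beta>) t) * w (x, t))"

text \<open>As usual for Fourier multipliers, \<open>m(D')\<^sup>2\<close> is the multiplier with symbol \<open>m(\<xi>')\<^sup>2\<close>.\<close>

definition L_tau_side :: "('d::finite \<Rightarrow> real) \<Rightarrow> real \<Rightarrow> real \<Rightarrow> real \<Rightarrow> real \<Rightarrow>
    ((real^'d) \<times> real \<Rightarrow> complex) \<Rightarrow> (real^'d) \<times> real \<Rightarrow> complex" where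
  "L_tau_side c cn \<alpha> \<beta> \<tau> w =
     (\<lambda>x. complex_of_real cn *
       (D_n_conj \<tau> \<alpha> \<beta> (D_n_conj \<tau> \<alpha> \<beta> w) x
        + tangential_multiplier (\<lambda>\<xi>. (m_symbol c cn \<xi>)\<^sup>2) w x))"

definition glue :: "('a \<times> real \<Rightarrow> complex) \<Rightarrow> ('a \<times> real \<Rightarrow> complex) \<Rightarrow> 'a \<times> real \<Rightarrow> complex"
  where
  "glue wp wm =
     (\<lambda>x. indicator {x. snd x > 0} x * wp x + indicator {x. snd x < 0} x * wm x)"

definition L_tau :: "('d::finite \<Rightarrow> real) \<Rightarrow> ('d \<Rightarrow> real) \<Rightarrow> real \<Rightarrow> real \<Rightarrow> real \<Rightarrow> real \<Rightarrow> real \<Rightarrow> real \<Rightarrow>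
    ((real^'d) \<times> real \<Rightarrow> complex) \<Rightarrow> ((real^'d) \<times> real \<Rightarrow> complex) \<Rightarrow> (real^'d) \<times> real \<Rightarrow> complex" where
  "L_tau cp cm cnp cnm \<alpha>p \<alpha>m \<beta> \<tau> vp vm =
     glue (L_tau_side cp cnp \<alpha>p \<beta> \<tau> vp) (L_tau_side cm cnm \<alpha>m \<beta> \<tau> vm)"

definition transmission :: "real \<Rightarrow> real \<Rightarrow> real \<Rightarrow> real \<Rightarrow> real \<Rightarrow>
    ((real^'d::finite) \<times> real \<Rightarrow> complex) \<Rightarrow> ((real^'d) \<times> real \<Rightarrow> complex) \<Rightarrow> bool" where
  "transmission cnp cnm \<alpha>p \<alpha>m \<tau> vp vm \<longleftrightarrow>
     (\<forall>x. vp (x, 0) = vm (x, 0) \<and>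
        complex_of_real cnp * (D_n vp (x, 0) + \<i> * complex_of_real (\<tau> * \<alpha>p) * vp (x, 0)) =
        complex_of_real cnm * (D_n vm (x, 0) + \<i> * complex_of_real (\<tau> * \<alpha>m) * vm (x, 0)))"

end

theory Submission
  imports Defs "HOL-Probability.Probability" "HOL-Library.Landau_Symbols"
begin

text \<open>Why quasimodes exist. The squares \<open>m\<^sub>\<plusminus>\<^sup>2\<close> are diagonal quadratic forms, so the hypothesis already holds for
\<open>\<xi>\<^sub>0'\<close> on some coordinate axis \<open>e\<^sub>j\<close> (\<open>exists_favourable_axis\<close>). Put \<open>\<gamma>\<^sub>\<plusminus> = m\<^sub>\<plusminus>(e\<^sub>j)\<close>; by homogeneity there is \<open>s > 0\<close>
with \<open>\<alpha>\<^sub>+ < s \<gamma>\<^sub>+\<close> and \<open>s \<gamma>\<^sub>- < \<alpha>\<^sub>-\<close>. At tangential frequency \<open>\<tau> s e\<^sub>j\<close> the operator factors into first order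
operators in the normal variable \<open>t\<close>, with exact solutions \<open>exp (\<i> \<tau> s x\<^sub>j + \<tau> (\<phi>\<^sub>\<plusminus>(t) + \<nu> t))\<close> for \<open>\<nu>\<close> equal to plus or
minus \<open>s \<gamma>\<^sub>\<plusminus>\<close>. Above the interface the one with \<open>\<nu> = - s \<gamma>\<^sub>+\<close> decays. Below the interface both decay, because
\<open>s \<gamma>\<^sub>- < \<alpha>\<^sub>-\<close>. Their two coefficients can therefore be chosen so that both transmission conditions hold, and the
result concentrates in the layer \<open>\<bar>t\<bar> \<lesssim> 1 / \<tau>\<close>.

Localizing in \<open>x'\<close> by a mere cutoff would cost a commutator of size \<open>\<tau>\<close>. Instead the amplitude is a polynomial
in \<open>t\<close> whose coefficients are derivatives of the cutoff, chosen so that the operator leaves a residual bounded by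
\<open>1 / \<tau> + \<bar>t\<bar> + \<tau> t\<^sup>2\<close> times the profile (\<open>corrected_mode_residual\<close>); in the layer this is of size \<open>1 / \<tau>\<close>. Since
the frequency points along an axis, the fluxes of the corrected modes agree at orders \<open>\<tau>\<close> and \<open>1\<close>, and the
mismatch of order \<open>1 / \<tau>\<close> is removed by an amplitude of size \<open>\<tau>\<^sup>-\<^sup>2\<close> (\<open>transmission_identity\<close>). Hence
\<open>\<parallel>L v\<parallel>\<^sup>2 \<le> K \<tau>\<^sup>-\<^sup>3\<close> while \<open>\<parallel>v\<parallel>\<^sup>2 \<ge> k \<tau>\<^sup>-\<^sup>1\<close>, and the quotient beats any constant for large \<open>\<tau>\<close>.

The operator is given by a Fourier multiplier in \<open>x'\<close>. To see it act as a differential operator, all functions of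
\<open>x'\<close> are taken to be finite sums of products of one-variable test functions (\<open>tensors\<close>), for which Fourier inversion
reduces to the line and is proved by Gaussian regularization (\<open>FT_inversion\<close>).\<close>

section \<open>Smooth functions and cutoffs\<close>

lemma Ck_SucI:
  assumes "\<And>x. (f has_derivative f' x) (at x)" "\<And>b. b \<in> Basis \<Longrightarrow> Ck k (\<lambda>x. f' x b)"
  shows "Ck (Suc k) f"
proof -
  have "frechet_derivative f (at x) = f' x" for x
    using assms(1) frechet_derivative_at by metis
  then show ?thesis
    using assms by (auto simp: differentiable_def)
qed

lemma Ck_SucD:
  assumes "Ck (Suc k) f"
  shows "(f has_derivative frechet_derivative f (at x)) (at x)"
    "b \<in> Basis \<Longrightarrow> Ck k (\<lambda>x. frechet_derivative f (at x) b)"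
  using assms frechet_derivative_works by auto

lemma Ck_Suc_imp_Ck: "Ck (Suc k) f \<Longrightarrow> Ck k f"
proof (induction k arbitrary: f)
  case 0
  then show ?case
    by (auto intro!: differentiable_imp_continuous_on simp: differentiable_on_def differentiable_at_withinI)
next
  case (Suc k)
  show ?case
  proof (rule Ck_SucI)
    show "(f has_derivative frechet_derivative f (at x)) (at x)" for x
      using Ck_SucD(1)[OF Suc.prems] .
    show "Ck k (\<lambda>x. frechet_derivative f (at x) b)" if "b \<in> Basis" for b
      using Suc.IH Ck_SucD(2)[OF Suc.prems that] .
  qed
qed

declare Ck.simps(2) [simp del]

lemma Ck_const: "Ck k (\<lambda>x. c)"
proof (induction k arbitrary: c)
  case (Suc k)
  show ?case
    by (rule Ck_SucI[where f'="\<lambda>x y. 0"]) (use Suc in auto)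
qed simp

lemma Ck_add: "Ck k f \<Longrightarrow> Ck k g \<Longrightarrow> Ck k (\<lambda>x. f x + g x)"
proof (induction k arbitrary: f g)
  case 0
  then show ?case by (auto intro: continuous_intros)
next
  case (Suc k)
  show ?case
    by (rule Ck_SucI[OF has_derivative_add])
       (use Suc Ck_SucD in blast)+
qed

text \<open>One argument serves products, scalar multiplication and coefficient functions: the Leibniz rule
expresses a partial derivative of order one through functions that are one degree less regular.\<close>

lemma Ck_bilinear:
  assumes "bounded_bilinear pr"
  shows "Ck k f \<Longrightarrow> Ck k g \<Longrightarrow> Ck k (\<lambda>x. pr (f x) (g x))"
proof (induction k arbitrary: f g)
  case 0
  then show ?case using bounded_bilinear.continuous_on[OF assms] by auto
next
  case (Suc k)
  show ?case
  proof (rule Ck_SucI[OF bounded_bilinear.FDERIV[OF assms]])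
    show "Ck k (\<lambda>x. pr (f x) (frechet_derivative g (at x) b) + pr (frechet_derivative f (at x) b) (g x))"
      if "b \<in> Basis" for b
      by (intro Ck_add Suc.IH Ck_Suc_imp_Ck[OF Suc.prems(1)] Ck_Suc_imp_Ck[OF Suc.prems(2)]
        Ck_SucD(2)[OF Suc.prems(1) that] Ck_SucD(2)[OF Suc.prems(2) that])
  qed (use Suc.prems Ck_SucD(1) in blast)+
qed

lemma Ck_bounded_linear_comp:
  assumes "bounded_linear h"
  shows "Ck k f \<Longrightarrow> Ck k (\<lambda>x. h (f x))"
proof (induction k arbitrary: f)
  case 0
  then show ?case using bounded_linear.continuous_on[OF assms] by auto
next
  case (Suc k)
  show ?case
    by (rule Ck_SucI[OF bounded_linear.has_derivative[OF assms]])
       (use Suc Ck_SucD in blast)+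
qed

definition smooth :: "('a::euclidean_space \<Rightarrow> 'b::real_normed_vector) \<Rightarrow> bool" where
  "smooth f \<longleftrightarrow> (\<forall>k. Ck k f)"

lemma smooth_has_derivative:
  "smooth f \<Longrightarrow> (f has_derivative frechet_derivative f (at x)) (at x)"
  unfolding smooth_def using Ck_SucD(1) by blast

lemma smooth_partial:
  "smooth f \<Longrightarrow> b \<in> Basis \<Longrightarrow> smooth (\<lambda>x. frechet_derivative f (at x) b)"
  unfolding smooth_def using Ck_SucD(2) by blast

lemma smooth_continuous_on: "smooth f \<Longrightarrow> continuous_on S f"
  unfolding smooth_def using Ck.simps(1) continuous_on_subset by blast

lemma smooth_const: "smooth (\<lambda>x. c)"
  by (simp add: smooth_def Ck_const)

lemma smooth_add: "smooth f \<Longrightarrow> smooth g \<Longrightarrow> smooth (\<lambda>x. f x + g x)"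
  by (simp add: smooth_def Ck_add)

lemma smooth_mult:
  fixes f g :: "'a::euclidean_space \<Rightarrow> 'b::real_normed_algebra"
  shows "smooth f \<Longrightarrow> smooth g \<Longrightarrow> smooth (\<lambda>x. f x * g x)"
  by (simp add: smooth_def Ck_bilinear[OF bounded_bilinear_mult])

lemma smooth_power:
  fixes f :: "'a::euclidean_space \<Rightarrow> 'b::real_normed_algebra_1"
  shows "smooth f \<Longrightarrow> smooth (\<lambda>x. f x ^ n)"
  by (induction n) (auto intro: smooth_mult smooth_const)

lemma smooth_prod:
  fixes f :: "'i \<Rightarrow> 'a::euclidean_space \<Rightarrow> 'b::real_normed_field"
  assumes "\<And>i. i \<in> I \<Longrightarrow> smooth (f i)"
  shows "smooth (\<lambda>x. \<Prod>i\<in>I. f i x)"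
  using assms
  by (induction I rule: infinite_finite_induct) (auto intro: smooth_mult smooth_const)

lemma smooth_bounded_linear_comp:
  "bounded_linear h \<Longrightarrow> smooth f \<Longrightarrow> smooth (\<lambda>x. h (f x))"
  by (simp add: smooth_def Ck_bounded_linear_comp)

lemma smooth_of_real:
  "smooth f \<Longrightarrow> smooth (\<lambda>x. of_real (f x) :: 'b::{real_normed_algebra_1})"
  by (rule smooth_bounded_linear_comp[OF bounded_linear_of_real])

lemma smooth_bounded_linear:
  assumes "bounded_linear h"
  shows "smooth h"
  unfolding smooth_def
proof
  fix k
  show "Ck k h"
  proof (cases k)
    case 0
    then show ?thesis using assms by (auto intro: linear_continuous_on)
  next
    case (Suc l)
    then show ?thesis
      using Ck_SucI[OF bounded_linear.has_derivative[OF assms has_derivative_ident] Ck_const] by simp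
  qed
qed

lemma smooth_ident: "smooth (\<lambda>x. x)"
  by (rule smooth_bounded_linear[OF bounded_linear_ident])

text \<open>Induction on the order of differentiability: the derivative of \<open>g \<circ> f\<close> is the product of a
derivative of \<open>f\<close> and \<open>g' \<circ> f\<close>, and the latter is covered by the induction hypothesis for \<open>g'\<close>
in place of \<open>g\<close>.\<close>

lemma smooth_compose:
  fixes g :: "real \<Rightarrow> 'b::real_normed_vector"
  assumes "smooth g" "smooth f"
  shows "smooth (\<lambda>x. g (f x))"
proof -
  have "Ck k (\<lambda>x. g (f x))" for k
    using assms(1)
  proof (induction k arbitrary: g)
    case 0
    have "continuous_on UNIV g" "continuous_on UNIV f"
      using 0 assms(2) by (auto intro: smooth_continuous_on)
    then show ?case
      by (auto intro: continuous_on_compose2)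
  next
    case (Suc k)
    have eq: "frechet_derivative g (at y) z = z *\<^sub>R frechet_derivative g (at y) 1" for y z
      using linear_scale[OF has_derivative_linear[OF smooth_has_derivative[OF Suc.prems, of y]], of z 1]
      by simp
    show ?case
    proof (rule Ck_SucI)
      show "((\<lambda>x. g (f x)) has_derivative
          (\<lambda>z. frechet_derivative g (at (f x)) (frechet_derivative f (at x) z))) (at x)" for x
        by (rule has_derivative_compose[OF smooth_has_derivative[OF assms(2)] smooth_has_derivative[OF Suc.prems]])
      fix b :: 'a assume b: "b \<in> Basis"
      have "Ck k (\<lambda>x. frechet_derivative f (at x) b *\<^sub>R frechet_derivative g (at (f x)) 1)"
        using Suc.IH[OF smooth_partial[OF Suc.prems]] smooth_partial[OF assms(2) b]
        by (intro Ck_bilinear[OF bounded_bilinear_scaleR]) (auto simp: smooth_def)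
      then show "Ck k (\<lambda>x. frechet_derivative g (at (f x)) (frechet_derivative f (at x) b))"
        by (subst eq)
    qed
  qed
  then show ?thesis by (simp add: smooth_def)
qed

lemma smooth_real_derivative:
  fixes f :: "real \<Rightarrow> 'b::real_normed_vector"
  assumes "smooth f"
  obtains f' where "smooth f'" "\<And>x. (f has_vector_derivative f' x) (at x)"
proof -
  have "frechet_derivative f (at y) z = z *\<^sub>R frechet_derivative f (at y) 1" for y z
    using linear_scale[OF has_derivative_linear[OF smooth_has_derivative[OF assms, of y]], of z 1]
    by simp
  then have "(f has_vector_derivative frechet_derivative f (at x) 1) (at x)" for x
    unfolding has_vector_derivative_def using smooth_has_derivative[OF assms, of x]
    by (metis (no_types, lifting) ext)
  then show thesis
    using smooth_partial[OF assms, of 1] that by auto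
qed

text \<open>On the line smoothness amounts to a sequence of successive derivatives, which for exponential functions
can be written down in closed form.\<close>

lemma smooth_of_derivative_chain:
  fixes f :: "real \<Rightarrow> 'b::real_normed_vector"
  assumes "\<And>k. (\<forall>x. (F k has_vector_derivative F (Suc k) x) (at x))"
  shows "smooth (F 0)"
proof -
  have "Ck n (F k)" for n k
  proof (induction n arbitrary: k)
    case 0
    show ?case
      using assms by (auto intro!: continuous_at_imp_continuous_on has_vector_derivative_continuous)
  next
    case (Suc n)
    show ?case
      by (rule Ck_SucI[OF assms[of k, rule_format, unfolded has_vector_derivative_def]])
         (use Suc in simp)
  qed
  then show ?thesis by (simp add: smooth_def)
qed

lemma smooth_exp_scaled: "smooth (\<lambda>x::real. exp (of_real x * c) :: complex)"
proof -
  have "smooth ((\<lambda>k x. c ^ k * exp (of_real x * c)) 0 :: real \<Rightarrow> complex)"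
    by (rule smooth_of_derivative_chain)
       (auto intro!: derivative_eq_intros has_vector_derivative_real_field simp: algebra_simps)
  then show ?thesis by simp
qed

text \<open>These are the functions \<open>x\<^sup>-\<^sup>m exp (- 1/x)\<close> continued by \<open>0\<close>. The whole family is considered because it
is closed under differentiation up to linear combinations, whereas \<open>flat 0\<close> alone is not.\<close>

definition flat :: "nat \<Rightarrow> real \<Rightarrow> real" where
  "flat m x = (if x > 0 then (1 / x) ^ m * exp (- (1 / x)) else 0)"

lemma flat_has_derivative_zero: "(flat m has_real_derivative 0) (at 0)"
proof -
  have "((\<lambda>y::real. y ^ Suc m / exp y) \<longlongrightarrow> 0) at_top"
    by (rule tendsto_power_div_exp_0)
  then have "((\<lambda>h::real. (inverse h) ^ Suc m / exp (inverse h)) \<longlongrightarrow> 0) (at_right 0)"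
    by (rule filterlim_compose[OF _ filterlim_inverse_at_top_right])
  moreover have "\<forall>\<^sub>F h in at_right 0. (inverse h) ^ Suc m / exp (inverse h) = (flat m (0 + h) - flat m 0) / h"
    by (rule eventually_at_right_less[THEN eventually_mono])
       (auto simp: flat_def exp_minus field_simps)
  ultimately have r: "((\<lambda>h. (flat m (0 + h) - flat m 0) / h) \<longlongrightarrow> 0) (at_right 0)"
    by (rule Lim_transform_eventually)
  have "\<forall>\<^sub>F h in at_left 0. (flat m (0 + h) - flat m 0) / h = 0"
    by (auto simp: eventually_at_filter flat_def)
  then have l: "((\<lambda>h. (flat m (0 + h) - flat m 0) / h) \<longlongrightarrow> 0) (at_left 0)"
    by (rule tendsto_eventually)
  show ?thesis
    unfolding DERIV_def using r l filterlim_split_at by blast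
qed

lemma flat_has_derivative:
  "(flat m has_real_derivative flat (m + 2) x - m * flat (m + 1) x) (at x)"
proof (cases x "0::real" rule: linorder_cases)
  case less
  have "eventually (\<lambda>y. y < 0) (nhds x)"
    using less eventually_nhds_in_open[of "{..<0}" x] by auto
  then have ev: "\<forall>\<^sub>F y in nhds x. 0 = flat m y"
    by (rule eventually_mono) (auto simp: flat_def)
  have "(flat m has_real_derivative 0) (at x)"
    using DERIV_cong_ev[OF refl ev refl, of 0] by simp
  then show ?thesis using less by (simp add: flat_def)
next
  case equal
  then show ?thesis using flat_has_derivative_zero by (simp add: flat_def)
next
  case greater
  have d: "((\<lambda>x. (1 / x) ^ m * exp (- (1 / x))) has_real_derivative
     flat (m + 2) x - m * flat (m + 1) x) (at x)"
  proof -
    have u: "((\<lambda>x. 1 / x) has_real_derivative - ((1 / x)\<^sup>2)) (at x)"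
      using greater by (auto intro!: derivative_eq_intros simp: power2_eq_square)
    have p: "((\<lambda>u. u ^ m * exp (- u)) has_real_derivative
        (m * u ^ (m - 1) * exp (- u) - u ^ m * exp (- u))) (at u)" for u :: real
      by (auto intro!: derivative_eq_intros)
    have "((\<lambda>x. (1 / x) ^ m * exp (- (1 / x))) has_real_derivative
        (m * (1 / x) ^ (m - 1) * exp (- (1 / x)) - (1 / x) ^ m * exp (- (1 / x))) * - ((1 / x)\<^sup>2)) (at x)"
      by (rule DERIV_chain2[OF p u])
    moreover have "(m * u ^ (m - 1) * e - u ^ m * e) * - (u\<^sup>2) = u ^ (m + 2) * e - m * (u ^ (m + 1) * e)"
      for u e :: real
      by (cases m) (simp_all add: algebra_simps power2_eq_square)
    ultimately show ?thesis using greater by (simp add: flat_def)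
  qed
  have "eventually (\<lambda>y. y > 0) (nhds x)"
    using greater eventually_nhds_in_open[of "{0<..}" x] by auto
  then have ev: "\<forall>\<^sub>F y in nhds x. (1 / y) ^ m * exp (- (1 / y)) = flat m y"
    by (rule eventually_mono) (auto simp: flat_def)
  show ?thesis
    using DERIV_cong_ev[OF refl ev refl] d by blast
qed

lemma smooth_flat: "smooth (flat m)"
proof -
  have "Ck k (flat m)" for k
  proof (induction k arbitrary: m)
    case 0
    show ?case
      by (auto intro!: continuous_at_imp_continuous_on DERIV_isCont[OF flat_has_derivative])
  next
    case (Suc k)
    have "Ck k (\<lambda>x. flat (m + 2) x + (- real m * flat (m + 1) x))"
      by (intro Ck_add Suc Ck_bilinear[OF bounded_bilinear_mult] Ck_const)
    then show ?case
      by (intro Ck_SucI[OF flat_has_derivative[unfolded has_field_derivative_def]]) simp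
  qed
  then show ?thesis by (simp add: smooth_def)
qed

lemma flat_mono: "x \<le> y \<Longrightarrow> flat 0 x \<le> flat 0 y"
  by (auto simp: flat_def intro!: divide_left_mono)

text \<open>With \<open>c = flat 0 (\<delta>\<^sup>2 - \<eta>\<^sup>2)\<close> the function \<open>flat 0 (c - flat 0 (t\<^sup>2 - \<eta>\<^sup>2))\<close> is a cutoff: the inner
\<open>flat\<close> vanishes for \<open>\<bar>t\<bar> \<le> \<eta>\<close>, which makes the outer one constant there, and it is at least \<open>c\<close> for
\<open>\<bar>t\<bar> \<ge> \<delta>\<close>, which makes the outer one vanish there.\<close>

lemma plateau_exists:
  assumes "0 < \<eta>" "\<eta> < \<delta>"
  obtains \<theta> :: "real \<Rightarrow> real" where "smooth \<theta>"
    "\<And>t. \<bar>t\<bar> \<le> \<eta> \<Longrightarrow> \<theta> t = 1" "\<And>t. \<delta> \<le> \<bar>t\<bar> \<Longrightarrow> \<theta> t = 0"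
proof
  define c where "c = flat 0 (\<delta>\<^sup>2 - \<eta>\<^sup>2)"
  have "\<delta>\<^sup>2 > \<eta>\<^sup>2" using assms by (simp add: power_strict_mono)
  then have c: "c > 0" by (simp add: c_def flat_def)
  let ?\<theta> = "\<lambda>t. inverse (flat 0 c) * flat 0 (c + - 1 * flat 0 (t\<^sup>2 + - \<eta>\<^sup>2))"
  have "smooth (\<lambda>t::real. t\<^sup>2 + - \<eta>\<^sup>2)"
    using smooth_add[OF smooth_power[OF smooth_ident] smooth_const] .
  from smooth_compose[OF smooth_flat this]
  have "smooth (\<lambda>t. - 1 * flat 0 (t\<^sup>2 + - \<eta>\<^sup>2))"
    using smooth_mult[OF smooth_const] by blast
  from smooth_add[OF smooth_const this]
  show "smooth ?\<theta>"
    using smooth_mult[OF smooth_const smooth_compose[OF smooth_flat]] by blast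
  show "?\<theta> t = 1" if "\<bar>t\<bar> \<le> \<eta>" for t
  proof -
    have "t\<^sup>2 \<le> \<eta>\<^sup>2" using power_mono[OF that, of 2] by simp
    then show ?thesis using c by (simp add: flat_def)
  qed
  show "?\<theta> t = 0" if "\<delta> \<le> \<bar>t\<bar>" for t
  proof -
    have "\<delta>\<^sup>2 \<le> t\<^sup>2" using power_mono[OF that, of 2] assms by simp
    then have "c \<le> flat 0 (t\<^sup>2 + - \<eta>\<^sup>2)"
      unfolding c_def by (intro flat_mono) simp
    then have "flat 0 (c + - 1 * flat 0 (t\<^sup>2 + - \<eta>\<^sup>2)) = 0"
      by (subst flat_def) simp
    then show ?thesis by simp
  qed
qed

section \<open>Fourier inversion on the line\<close>

lemma integrable_continuous_compact_support:
  fixes f :: "'a::euclidean_space \<Rightarrow> 'b::{banach,second_countable_topology}"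
  assumes "continuous_on UNIV f" "compact S" "\<And>x. x \<notin> S \<Longrightarrow> f x = 0"
  shows "integrable lborel f"
proof -
  have "integrable lborel (\<lambda>x. indicator S x *\<^sub>R f x)"
    using borel_integrable_compact[OF assms(2)] continuous_on_subset[OF assms(1)] by blast
  also have "(\<lambda>x. indicator S x *\<^sub>R f x) = f"
    using assms(3) by (auto simp: indicator_def fun_eq_iff)
  finally show ?thesis .
qed

lemma integrable_cis_mult:
  fixes f :: "'a::euclidean_space \<Rightarrow> complex"
  assumes "integrable lborel f" "continuous_on UNIV h"
  shows "integrable lborel (\<lambda>x. cis (h x) * f x)"
proof -
  have "continuous_on UNIV (\<lambda>x. cis (h x))"
    unfolding cis_conv_exp using assms(2) by (intro continuous_intros)
  then have [measurable]: "(\<lambda>x. cis (h x)) \<in> borel_measurable borel"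
    by (rule borel_measurable_continuous_onI)
  show ?thesis
    by (rule Bochner_Integration.integrable_bound[OF assms(1)])
       (use assms(1) in \<open>auto simp: norm_mult\<close>)
qed

definition test_function :: "real \<Rightarrow> (real \<Rightarrow> complex) \<Rightarrow> bool" where
  "test_function \<delta> f \<longleftrightarrow> smooth f \<and> (\<forall>x. \<delta> < \<bar>x\<bar> \<longrightarrow> f x = 0)"

lemma test_function_derivative:
  assumes "test_function \<delta> f"
  obtains f' where "test_function \<delta> f'" "\<And>x. (f has_vector_derivative f' x) (at x)"
proof -
  obtain f' where f': "smooth f'" "\<And>x. (f has_vector_derivative f' x) (at x)"
    using smooth_real_derivative assms unfolding test_function_def by blast
  have "f' x = 0" if "\<delta> < \<bar>x\<bar>" for x
  proof -
    have "open {y::real. \<delta> < \<bar>y\<bar>}"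
      by (intro open_Collect_less continuous_intros)
    then have "((\<lambda>y. 0) has_vector_derivative f' x) (at x)"
      by (rule has_vector_derivative_transform_within_open[OF f'(2)])
         (use that assms in \<open>auto simp: test_function_def\<close>)
    then show ?thesis
      using vector_derivative_unique_at has_vector_derivative_const by blast
  qed
  with f' that show thesis by (auto simp: test_function_def)
qed

lemma test_function_integrable: "test_function \<delta> f \<Longrightarrow> integrable lborel f"
  unfolding test_function_def
  by (rule integrable_continuous_compact_support[where S="{-\<delta>..\<delta>}"])
     (auto intro: smooth_continuous_on)

lemma continuous_on_compact_support_bounded:
  fixes f :: "'a::topological_space \<Rightarrow> 'b::real_normed_vector"
  assumes "continuous_on UNIV f" "compact S" "\<And>x. x \<notin> S \<Longrightarrow> f x = 0"
  obtains K where "K > 0" "\<And>x. norm (f x) \<le> K"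
proof -
  have "continuous_on S f" using assms(1) continuous_on_subset by blast
  then have "bounded (f ` S)"
    using assms(2) by (intro compact_imp_bounded compact_continuous_image)
  then obtain K where "K > 0" "\<And>x. x \<in> S \<Longrightarrow> norm (f x) \<le> K"
    by (auto simp: bounded_pos)
  then have "norm (f x) \<le> K" for x
    using assms(3)[of x] by (cases "x \<in> S") auto
  then show thesis using that \<open>K > 0\<close> by blast
qed

definition FT :: "(real \<Rightarrow> complex) \<Rightarrow> real \<Rightarrow> complex" where
  "FT f \<xi> = (LINT x|lborel. cis (- (x * \<xi>)) * f x)"

lemma integral_derivative_eq_0:
  fixes g :: "real \<Rightarrow> complex"
  assumes "\<And>x. (g has_vector_derivative g' x) (at x)" "continuous_on UNIV g'"
    and supp: "\<And>x. \<delta> < \<bar>x\<bar> \<Longrightarrow> g x = 0" "\<And>x. \<delta> < \<bar>x\<bar> \<Longrightarrow> g' x = 0"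
  shows "(LINT x|lborel. g' x) = 0"
proof -
  let ?a = "- (\<bar>\<delta>\<bar> + 1)" and ?b = "\<bar>\<delta>\<bar> + 1"
  have "has_bochner_integral lborel (\<lambda>x. indicator {?a..?b} x *\<^sub>R g' x) (g ?b - g ?a)"
    by (rule has_bochner_integral_FTC_Icc)
       (use assms in \<open>auto intro: has_vector_derivative_at_within continuous_on_subset\<close>)
  moreover have "(\<lambda>x. indicator {?a..?b} x *\<^sub>R g' x) = g'"
    using supp(2) by (auto simp: fun_eq_iff indicator_def)
  moreover have "g ?b = 0" "g ?a = 0"
    using supp(1) by auto
  ultimately show ?thesis
    using has_bochner_integral_integral_eq by fastforce
qed

text \<open>Integration by parts, in the form that the derivative of the compactly supported function
\<open>x \<mapsto> cis (- x \<xi>) f x\<close> has integral zero.\<close>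

lemma FT_derivative:
  assumes f: "test_function \<delta> f" and f': "test_function \<delta> f'" "\<And>x. (f has_vector_derivative f' x) (at x)"
  shows "FT f' \<xi> = \<i> * \<xi> * FT f \<xi>"
proof -
  have e: "((\<lambda>x. cis (- (x * \<xi>))) has_vector_derivative (- \<i> * \<xi> * cis (- (x * \<xi>)))) (at x)" for x :: real
  proof -
    have "((\<lambda>x. exp (of_real x * (- \<i> * \<xi>))) has_vector_derivative
        (- \<i> * \<xi> * exp (of_real x * (- \<i> * \<xi>)))) (at x)"
      by (auto intro!: derivative_eq_intros has_vector_derivative_real_field)
    then show ?thesis by (simp add: cis_conv_exp mult_ac)
  qed
  let ?g' = "\<lambda>x. cis (- (x * \<xi>)) * f' x + (- \<i> * \<xi> * cis (- (x * \<xi>))) * f x"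
  have "(LINT x|lborel. ?g' x) = 0"
  proof (rule integral_derivative_eq_0)
    show "((\<lambda>x. cis (- (x * \<xi>)) * f x) has_vector_derivative ?g' x) (at x)" for x
      by (rule has_vector_derivative_mult[OF e f'(2)])
    show "continuous_on UNIV ?g'"
      using f f' unfolding test_function_def cis_conv_exp
      by (intro continuous_intros) (auto intro: smooth_continuous_on)
  qed (use f f' in \<open>auto simp: test_function_def\<close>)
  moreover have "?g' = (\<lambda>x. cis (- (x * \<xi>)) * f' x - (\<i> * \<xi>) * (cis (- (x * \<xi>)) * f x))"
    by (auto simp: fun_eq_iff algebra_simps)
  moreover have "integrable lborel (\<lambda>x. cis (- (x * \<xi>)) * f x)" "integrable lborel (\<lambda>x. cis (- (x * \<xi>)) * f' x)"
    by (intro integrable_cis_mult continuous_intros test_function_integrable[OF f] test_function_integrable[OF f'(1)])+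
  ultimately show ?thesis
    unfolding FT_def by simp
qed

lemma norm_FT_le: "norm (FT f \<xi>) \<le> (LINT x|lborel. norm (f x))"
  unfolding FT_def by (rule order_trans[OF integral_norm_bound]) (simp add: norm_mult)

lemma FT_second_derivative:
  assumes "test_function \<delta> f"
  obtains f' f'' where "test_function \<delta> f'" "test_function \<delta> f''"
    "\<And>x. (f has_vector_derivative f' x) (at x)" "\<And>x. (f' has_vector_derivative f'' x) (at x)"
    "\<And>\<xi>. FT f'' \<xi> = - (\<xi>\<^sup>2 * FT f \<xi>)"
proof -
  obtain f' where f': "test_function \<delta> f'" "\<And>x. (f has_vector_derivative f' x) (at x)"
    using test_function_derivative[OF assms] by blast
  obtain f'' where f'': "test_function \<delta> f''" "\<And>x. (f' has_vector_derivative f'' x) (at x)"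
    using test_function_derivative[OF f'(1)] by blast
  have "FT f'' \<xi> = - (\<xi>\<^sup>2 * FT f \<xi>)" for \<xi>
    unfolding FT_derivative[OF f'(1) f''] FT_derivative[OF assms f']
    by (simp add: power2_eq_square algebra_simps flip: of_real_mult)
  then show thesis using that f' f'' by blast
qed

lemma FT_measurable:
  assumes "integrable lborel f"
  shows "FT f \<in> borel_measurable borel"
proof -
  have [measurable]: "f \<in> borel_measurable borel" using assms by simp
  have "(\<lambda>p. cis (- (snd p * fst p))) \<in> borel_measurable (borel :: (real \<times> real) measure)"
    unfolding cis_conv_exp by (intro borel_measurable_continuous_onI continuous_intros)
  then have [measurable]: "(\<lambda>p. cis (- (snd p * fst p))) \<in> borel_measurable (borel \<Otimes>\<^sub>M (borel :: real measure))"
    by (simp add: borel_prod)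
  have "(\<lambda>p. cis (- (snd p * fst p)) * f (snd p)) \<in> borel_measurable (borel \<Otimes>\<^sub>M lborel)"
    by measurable
  then have "(\<lambda>\<xi>. LINT x|lborel. cis (- (x * \<xi>)) * f x) \<in> borel_measurable borel"
    by (intro lborel.borel_measurable_lebesgue_integral) (simp add: case_prod_beta')
  then show ?thesis by (simp add: FT_def[abs_def])
qed

text \<open>Since \<open>(1 + \<xi>\<^sup>2) FT f \<xi>\<close> is the transform of \<open>f - f''\<close>, it is bounded.\<close>

lemma FT_integrable:
  assumes "test_function \<delta> f"
  shows "integrable lborel (FT f)"
proof -
  obtain f' f'' where f'': "test_function \<delta> f''" "\<And>\<xi>. FT f'' \<xi> = - (\<xi>\<^sup>2 * FT f \<xi>)"
    using FT_second_derivative[OF assms] by metis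
  define K where "K = (LINT x|lborel. norm (f x)) + (LINT x|lborel. norm (f'' x))"
  have le: "norm (FT f \<xi>) \<le> K * inverse (1 + \<xi>\<^sup>2)" for \<xi>
  proof -
    have "norm (FT f \<xi>) * (1 + \<xi>\<^sup>2) = norm (FT f \<xi>) + norm (FT f'' \<xi>)"
      by (simp add: f'' norm_mult norm_power algebra_simps)
    also have "\<dots> \<le> K"
      unfolding K_def by (intro add_mono norm_FT_le)
    finally have "norm (FT f \<xi>) * (1 + \<xi>\<^sup>2) \<le> K" .
    moreover have "1 + \<xi>\<^sup>2 > 0" by (simp add: add_pos_nonneg)
    ultimately show ?thesis by (simp add: field_simps)
  qed
  have "integrable lborel (\<lambda>x::real. inverse (1 + x\<^sup>2))"
    using integrable_inverse_1_plus_square by (simp add: set_integrable_def)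
  then have "integrable lborel (\<lambda>x::real. K * inverse (1 + x\<^sup>2))"
    by (rule integrable_mult_right)
  then show ?thesis
    by (rule Bochner_Integration.integrable_bound)
       (use FT_measurable[OF test_function_integrable[OF assms]] le in
        \<open>auto intro!: AE_I2 intro: order_trans[OF _ abs_ge_self]\<close>)
qed

lemma gaussian_FT:
  assumes "\<epsilon> > 0"
  shows "(LINT \<xi>|lborel. cis (y * \<xi>) * exp (- (\<epsilon> * \<xi>)\<^sup>2 / 2))
    = complex_of_real (sqrt (2 * pi) / \<epsilon> * exp (- (y / \<epsilon>)\<^sup>2 / 2))"
proof -
  have "(LINT \<xi>|lborel. cis (y * \<xi>) * exp (- (\<epsilon> * \<xi>)\<^sup>2 / 2)) =
      \<bar>1 / \<epsilon>\<bar> *\<^sub>R (LINT z|lborel. cis (y * (0 + (1 / \<epsilon>) * z)) * exp (- (\<epsilon> * (0 + (1 / \<epsilon>) * z))\<^sup>2 / 2))"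
    using assms by (intro lborel_integral_real_affine) simp
  also have "\<dots> = (1 / \<epsilon>) *\<^sub>R (LINT z|lborel. sqrt (2 * pi) * (std_normal_density z *\<^sub>R cis (y / \<epsilon> * z)))"
    using assms
    by (auto intro!: Bochner_Integration.integral_cong arg_cong2[where f="(*\<^sub>R)"]
        simp: std_normal_density_def scaleR_conv_of_real field_simps real_sqrt_mult)
  also have "\<dots> = (1 / \<epsilon>) *\<^sub>R (sqrt (2 * pi) * (LINT z|std_normal_distribution. cis (y / \<epsilon> * z)))"
  proof -
    have "(\<lambda>z. cis (y / \<epsilon> * z)) \<in> borel_measurable borel"
      unfolding cis_conv_exp by (intro borel_measurable_continuous_onI continuous_intros)
    then show ?thesis
      by (subst integral_density, simp, simp, simp, subst integral_mult_right_zero) (rule refl)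
  qed
  also have "(LINT z|std_normal_distribution. cis (y / \<epsilon> * z)) = char std_normal_distribution (y / \<epsilon>)"
    by (simp add: char_def cis_conv_exp)
  also have "\<dots> = complex_of_real (exp (- ((y / \<epsilon>)^2) / 2))"
    by (simp add: char_std_normal_distribution)
  finally show ?thesis by (simp add: scaleR_conv_of_real)
qed

lemma gaussian_integrable: 
  assumes "\<epsilon> \<noteq> 0" shows "integrable lborel (\<lambda>\<xi>::real. exp (- (\<epsilon> * \<xi>)\<^sup>2 / 2))"
proof -
  have "integrable lborel (\<lambda>x. sqrt (2 * pi) * std_normal_density (0 + \<epsilon> * x))"
    by (intro integrable_mult_right lborel_integrable_real_affine assms) simp
  then show ?thesis by (simp add: std_normal_density_def)
qed

text \<open>Damping the inversion integral by a Gaussian makes the double integral absolutely convergent; after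
exchanging the integrals, the known transform of the Gaussian turns the damped inversion integral
into a Gaussian average of \<open>f\<close> around \<open>x\<close> at scale \<open>\<epsilon>\<close>.\<close>

lemma fourier_gaussian_mean:
  fixes f :: "real \<Rightarrow> complex"
  assumes f: "integrable lborel f" "continuous_on UNIV f" and "\<epsilon> > 0"
  shows "(LINT \<xi>|lborel. cis (x * \<xi>) * FT f \<xi> * complex_of_real (exp (- (\<epsilon> * \<xi>)\<^sup>2 / 2)))
    = sqrt (2 * pi) * (LINT z|lborel. f (x + \<epsilon> * z) * complex_of_real (exp (- z\<^sup>2 / 2)))"
proof -
  let ?g = "\<lambda>\<xi>. complex_of_real (exp (- (\<epsilon> * \<xi>)\<^sup>2 / 2))"
  let ?h = "\<lambda>\<xi> y. cis ((x - y) * \<xi>) * (f y * ?g \<xi>)"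
  have int_g: "integrable lborel (\<lambda>\<xi>. exp (- (\<epsilon> * \<xi>)\<^sup>2 / 2))"
    using gaussian_integrable assms(3) by simp
  have "continuous_on UNIV (\<lambda>p. ?h (fst p) (snd p))"
    unfolding cis_conv_exp
    by (intro continuous_intros continuous_on_compose2[OF f(2)]) auto
  then have meas: "(\<lambda>p. ?h (fst p) (snd p)) \<in> borel_measurable (lborel \<Otimes>\<^sub>M lborel)"
    by (simp add: lborel_prod borel_measurable_continuous_onI)
  have int: "integrable (lborel \<Otimes>\<^sub>M lborel) (\<lambda>(\<xi>, y). ?h \<xi> y)"
  proof (rule lborel_pair.Fubini_integrable)
    show "(\<lambda>(\<xi>, y). ?h \<xi> y) \<in> borel_measurable (lborel \<Otimes>\<^sub>M lborel)"
      using meas by (simp add: case_prod_beta')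
    have "integrable lborel (\<lambda>\<xi>. (LINT y|lborel. norm (f y)) * exp (- (\<epsilon> * \<xi>)\<^sup>2 / 2))"
      by (intro integrable_mult_right int_g)
    then show "integrable lborel (\<lambda>\<xi>. LINT y|lborel. norm (case (\<xi>, y) of (\<xi>, y) \<Rightarrow> ?h \<xi> y))"
      by (simp add: norm_mult)
    show "AE \<xi> in lborel. integrable lborel (\<lambda>y. case (\<xi>, y) of (\<xi>, y) \<Rightarrow> ?h \<xi> y)"
      by (auto intro!: AE_I2 integrable_cis_mult integrable_mult_left f continuous_intros)
  qed
  have "(LINT \<xi>|lborel. cis (x * \<xi>) * FT f \<xi> * ?g \<xi>) = (LINT \<xi>|lborel. LINT y|lborel. ?h \<xi> y)"
  proof (rule Bochner_Integration.integral_cong[OF refl])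
    fix \<xi>
    have cis: "cis (x * \<xi>) * cis (- (y * \<xi>)) = cis ((x - y) * \<xi>)" for y
      by (simp add: cis_mult algebra_simps)
    have "cis (x * \<xi>) * FT f \<xi> * ?g \<xi> = (cis (x * \<xi>) * ?g \<xi>) * (LINT y|lborel. cis (- (y * \<xi>)) * f y)"
      by (simp add: FT_def)
    also have "\<dots> = (LINT y|lborel. (cis (x * \<xi>) * ?g \<xi>) * (cis (- (y * \<xi>)) * f y))"
      by simp
    also have "\<dots> = (LINT y|lborel. ?h \<xi> y)"
      by (intro Bochner_Integration.integral_cong refl)
         (simp only: cis[symmetric], simp only: mult_ac)
    finally show "cis (x * \<xi>) * FT f \<xi> * ?g \<xi> = (LINT y|lborel. ?h \<xi> y)" .
  qed
  also have "\<dots> = (LINT y|lborel. LINT \<xi>|lborel. ?h \<xi> y)"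
    by (rule lborel_pair.Fubini_integral[symmetric, OF int])
  also have "\<dots> = (LINT y|lborel. f y * (LINT \<xi>|lborel. cis ((x - y) * \<xi>) * ?g \<xi>))"
    by (simp add: mult.left_commute flip: integral_mult_right_zero)
  also have "\<dots> = (LINT y|lborel. f y * complex_of_real (sqrt (2 * pi) / \<epsilon> * exp (- ((x - y) / \<epsilon>)\<^sup>2 / 2)))"
    by (subst gaussian_FT[OF assms(3)]) simp
  also have "\<dots> = \<bar>\<epsilon>\<bar> *\<^sub>R (LINT z|lborel. f (x + \<epsilon> * z) * complex_of_real (sqrt (2 * pi) / \<epsilon> * exp (- ((x - (x + \<epsilon> * z)) / \<epsilon>)\<^sup>2 / 2)))"
    using assms(3) by (intro lborel_integral_real_affine) simp
  also have "\<dots> = sqrt (2 * pi) * (LINT z|lborel. f (x + \<epsilon> * z) * complex_of_real (exp (- z\<^sup>2 / 2)))"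
  proof -
    have "f (x + \<epsilon> * z) * complex_of_real (sqrt (2 * pi) / \<epsilon> * exp (- ((x - (x + \<epsilon> * z)) / \<epsilon>)\<^sup>2 / 2))
        = (sqrt (2 * pi) / \<epsilon>) * (f (x + \<epsilon> * z) * complex_of_real (exp (- z\<^sup>2 / 2)))" for z
      using assms(3) by simp
    then show ?thesis
      using assms(3) by (simp only: integral_mult_right_zero) (simp add: scaleR_conv_of_real)
  qed
  finally show ?thesis .
qed

text \<open>Let \<open>\<epsilon> \<rightarrow> 0\<close> in \<open>fourier_gaussian_mean\<close>; both sides converge by dominated convergence.\<close>

theorem FT_inversion:
  fixes f :: "real \<Rightarrow> complex"
  assumes f: "integrable lborel f" "continuous_on UNIV f" "\<And>x. norm (f x) \<le> K"
    and FT: "integrable lborel (FT f)"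
  shows "(LINT \<xi>|lborel. cis (x * \<xi>) * FT f \<xi>) = 2 * pi * f x"
proof -
  \<comment> \<open>Dominated convergence is a statement about sequences of functions.\<close>
  define \<epsilon> where "\<epsilon> n = inverse (real (Suc n))" for n
  have \<epsilon>: "\<epsilon> \<longlonglongrightarrow> 0" "\<And>n. \<epsilon> n > 0"
    using LIMSEQ_inverse_real_of_nat by (auto simp: \<epsilon>_def[abs_def])
  have [measurable]: "f \<in> borel_measurable borel" "FT f \<in> borel_measurable borel"
    "(\<lambda>\<xi>. cis (x * \<xi>)) \<in> borel_measurable borel"
    using f FT unfolding cis_conv_exp
    by (auto intro!: borel_measurable_continuous_onI continuous_intros)
  have lhs: "(\<lambda>n. LINT \<xi>|lborel. cis (x * \<xi>) * FT f \<xi> * complex_of_real (exp (- (\<epsilon> n * \<xi>)\<^sup>2 / 2))) \<longlonglongrightarrow>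
      (LINT \<xi>|lborel. cis (x * \<xi>) * FT f \<xi>)"
  proof (rule integral_dominated_convergence[where w="\<lambda>\<xi>. norm (FT f \<xi>)"])
    show "integrable lborel (\<lambda>\<xi>. norm (FT f \<xi>))" using FT by simp
    show "AE \<xi> in lborel. (\<lambda>n. cis (x * \<xi>) * FT f \<xi> * complex_of_real (exp (- (\<epsilon> n * \<xi>)\<^sup>2 / 2))) \<longlonglongrightarrow> cis (x * \<xi>) * FT f \<xi>"
    proof (rule AE_I2)
      fix \<xi>
      have "(\<lambda>n. cis (x * \<xi>) * FT f \<xi> * complex_of_real (exp (- (\<epsilon> n * \<xi>)\<^sup>2 / 2))) \<longlonglongrightarrow>
        cis (x * \<xi>) * FT f \<xi> * complex_of_real (exp (- (0 * \<xi>)\<^sup>2 / 2))"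
        by (intro tendsto_intros \<epsilon>) simp_all
      then show "(\<lambda>n. cis (x * \<xi>) * FT f \<xi> * complex_of_real (exp (- (\<epsilon> n * \<xi>)\<^sup>2 / 2))) \<longlonglongrightarrow> cis (x * \<xi>) * FT f \<xi>"
        by simp
    qed
    show "AE \<xi> in lborel. norm (cis (x * \<xi>) * FT f \<xi> * complex_of_real (exp (- (\<epsilon> n * \<xi>)\<^sup>2 / 2))) \<le> norm (FT f \<xi>)" for n
      by (auto intro!: AE_I2 mult_left_le simp: norm_mult)
  qed measurable
  have int_g: "integrable lborel (\<lambda>z::real. exp (- z\<^sup>2 / 2))"
    using gaussian_integrable[of 1] by simp
  have rhs: "(\<lambda>n. LINT z|lborel. f (x + \<epsilon> n * z) * complex_of_real (exp (- z\<^sup>2 / 2))) \<longlonglongrightarrow>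
      (LINT z|lborel. f x * complex_of_real (exp (- z\<^sup>2 / 2)))"
  proof (rule integral_dominated_convergence[where w="\<lambda>z. K * exp (- z\<^sup>2 / 2)"])
    show "integrable lborel (\<lambda>z. K * exp (- z\<^sup>2 / 2))"
      using int_g by (rule integrable_mult_right)
    show "AE z in lborel. (\<lambda>n. f (x + \<epsilon> n * z) * complex_of_real (exp (- z\<^sup>2 / 2))) \<longlonglongrightarrow> f x * complex_of_real (exp (- z\<^sup>2 / 2))"
    proof (rule AE_I2)
      fix z
      have "(\<lambda>n. x + \<epsilon> n * z) \<longlonglongrightarrow> x + 0 * z"
        by (intro tendsto_intros \<epsilon>)
      moreover have "isCont f x" using f(2) continuous_on_eq_continuous_at by blast
      ultimately have "(\<lambda>n. f (x + \<epsilon> n * z)) \<longlonglongrightarrow> f x"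
        using isCont_tendsto_compose by fastforce
      then show "(\<lambda>n. f (x + \<epsilon> n * z) * complex_of_real (exp (- z\<^sup>2 / 2))) \<longlonglongrightarrow> f x * complex_of_real (exp (- z\<^sup>2 / 2))"
        by (intro tendsto_intros)
    qed
    show "AE z in lborel. norm (f (x + \<epsilon> n * z) * complex_of_real (exp (- z\<^sup>2 / 2))) \<le> K * exp (- z\<^sup>2 / 2)" for n
      using f(3) by (auto intro!: AE_I2 mult_right_mono simp: norm_mult)
  qed measurable
  have total: "(LINT z|lborel. complex_of_real (exp (- z\<^sup>2 / 2))) = sqrt (2 * pi)"
    using gaussian_FT[of 1 0] by simp
  have "(LINT \<xi>|lborel. cis (x * \<xi>) * FT f \<xi>) = sqrt (2 * pi) * (LINT z|lborel. f x * complex_of_real (exp (- z\<^sup>2 / 2)))"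
    using LIMSEQ_unique[OF lhs[unfolded fourier_gaussian_mean[OF f(1,2) \<epsilon>(2)]]
      tendsto_mult[OF tendsto_const rhs]] .
  also have "\<dots> = complex_of_real (sqrt (2 * pi)) * complex_of_real (sqrt (2 * pi)) * f x"
    by (simp only: integral_mult_right_zero total mult_ac)
  also have "complex_of_real (sqrt (2 * pi)) * complex_of_real (sqrt (2 * pi)) = complex_of_real (2 * pi)"
    by (simp only: of_real_mult[symmetric]) simp
  finally show ?thesis .
qed

corollary test_function_FT_inversion:
  fixes f :: "real \<Rightarrow> complex"
  assumes "test_function \<delta> f"
  shows "(LINT \<xi>|lborel. cis (x * \<xi>) * FT f \<xi>) = 2 * pi * f x"
proof -
  have f: "continuous_on UNIV f" "\<And>x. x \<notin> {-\<delta>..\<delta>} \<Longrightarrow> f x = 0"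
    using assms unfolding test_function_def by (auto intro: smooth_continuous_on)
  obtain K where "\<And>x. norm (f x) \<le> K"
    using continuous_on_compact_support_bounded[OF f(1) compact_Icc f(2)] by metis
  from FT_inversion[OF test_function_integrable[OF assms] f(1) this FT_integrable[OF assms]]
  show ?thesis .
qed

section \<open>Tensors and the tangential multiplier\<close>

lemma Basis_vec_eq_range_axis: "(Basis :: (real^'d::finite) set) = range (\<lambda>k. axis k 1)"
  by (auto simp: Basis_vec_def)

text \<open>Lebesgue measure on \<open>real^'d\<close> is the image of the product measure indexed by the standard basis, so
integrals of separated functions factor.\<close>

lemma
  fixes f :: "'d::finite \<Rightarrow> real \<Rightarrow> complex"
  assumes f: "\<And>k. integrable lborel (f k)"
  shows integrable_prod_coordinates: "integrable lborel (\<lambda>x::real^'d. \<Prod>k\<in>UNIV. f k (x $ k))"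
    and integral_prod_coordinates: "(LINT x|lborel. (\<Prod>k\<in>UNIV. f k ((x::real^'d) $ k))) = (\<Prod>k\<in>UNIV. LINT s|lborel. f k s)"
proof -
  interpret product_sigma_finite "\<lambda>_::real^'d. lborel :: real measure" ..
  have inj: "inj (\<lambda>k::'d. axis k (1::real))"
    by (auto simp: inj_on_def axis_eq_axis)
  let ?i = "inv (\<lambda>k::'d. axis k (1::real))"
  let ?T = "\<lambda>w. \<Sum>b\<in>Basis. w b *\<^sub>R (b::real^'d)"
  have T: "?T w $ k = w (axis k 1)" for w k
  proof -
    have "axis k 1 \<in> (Basis :: (real^'d) set)" by (simp add: Basis_vec_eq_range_axis)
    then show ?thesis by (simp add: cart_eq_inner_axis)
  qed
  have prod: "(\<Prod>b\<in>Basis. g (?i b) b) = (\<Prod>k\<in>UNIV. g k (axis k 1))" for g :: "'d \<Rightarrow> real^'d \<Rightarrow> complex"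
    unfolding Basis_vec_eq_range_axis by (subst prod.reindex[OF inj]) (simp add: inv_f_f[OF inj])
  have [measurable]: "f k \<in> borel_measurable borel" for k
    using f[of k] by simp
  have [measurable]: "(\<lambda>x::real^'d. x $ k) \<in> borel_measurable borel" for k
    by (intro borel_measurable_continuous_onI continuous_intros)
  have T_meas: "?T \<in> measurable (\<Pi>\<^sub>M b\<in>Basis. lborel) borel"
    by measurable
  have meas: "(\<lambda>x::real^'d. \<Prod>k\<in>UNIV. f k (x $ k)) \<in> borel_measurable borel"
    by measurable
  have eq: "(\<lambda>w. \<Prod>k\<in>UNIV. f k (?T w $ k)) = (\<lambda>w. \<Prod>b\<in>Basis. f (?i b) (w b))"
  proof
    fix w
    show "(\<Prod>k\<in>UNIV. f k (?T w $ k)) = (\<Prod>b\<in>Basis. f (?i b) (w b))"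
      using prod[of "\<lambda>k b. f k (w b)"] by (simp only: T)
  qed
  have "integrable (\<Pi>\<^sub>M b\<in>Basis. lborel) (\<lambda>w. \<Prod>b\<in>Basis. f (?i b) (w b))"
    by (intro product_integrable_prod f) simp
  then show "integrable lborel (\<lambda>x::real^'d. \<Prod>k\<in>UNIV. f k (x $ k))"
    unfolding lborel_eq[where 'a="real^'d"] by (subst integrable_distr_eq[OF T_meas meas]) (simp only: eq)
  have "(LINT x|lborel. (\<Prod>k\<in>UNIV. f k ((x::real^'d) $ k))) =
      (LINT w|(\<Pi>\<^sub>M b\<in>Basis. lborel). (\<Prod>b\<in>Basis. f (?i b) (w b)))"
    unfolding lborel_eq[where 'a="real^'d"] by (subst integral_distr[OF T_meas meas]) (simp only: eq)
  also have "\<dots> = (\<Prod>b\<in>Basis. LINT s|lborel. f (?i b) s)"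
    by (intro product_integral_prod f) simp
  also have "\<dots> = (\<Prod>k\<in>UNIV. LINT s|lborel. f k s)"
    using prod[of "\<lambda>k b. LINT s|lborel. f k s"] by simp
  finally show "(LINT x|lborel. (\<Prod>k\<in>UNIV. f k ((x::real^'d) $ k))) = (\<Prod>k\<in>UNIV. LINT s|lborel. f k s)" .
qed

lemma cis_inner: "cis (x \<bullet> \<xi>) = (\<Prod>k\<in>UNIV. cis (x $ k * \<xi> $ k))" for x \<xi> :: "real^'d::finite"
  by (simp add: inner_vec_def cis_conv_exp sum_distrib_left exp_sum)

lemma cis_uminus_inner: "cis (- (x \<bullet> \<xi>)) = (\<Prod>k\<in>UNIV. cis (- (x $ k * \<xi> $ k)))" for x \<xi> :: "real^'d::finite"
  using cis_inner[of "- x" \<xi>] by simp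

lemma fourier_prod:
  fixes f :: "'d::finite \<Rightarrow> real \<Rightarrow> complex"
  assumes "\<And>k. integrable lborel (f k)"
  shows "fourier (\<lambda>x. \<Prod>k\<in>UNIV. f k (x $ k)) \<xi> = (\<Prod>k\<in>UNIV. FT (f k) (\<xi> $ k))"
proof -
  have "fourier (\<lambda>x. \<Prod>k\<in>UNIV. f k (x $ k)) \<xi> = (LINT x|lborel. (\<Prod>k\<in>UNIV. cis (- (x $ k * \<xi> $ k)) * f k (x $ k)))"
    by (simp add: fourier_def cis_uminus_inner prod.distrib)
  also have "\<dots> = (\<Prod>k\<in>UNIV. FT (f k) (\<xi> $ k))"
    unfolding FT_def
    by (rule integral_prod_coordinates) (intro integrable_cis_mult assms continuous_intros)
  finally show ?thesis .
qed

lemma fourier_inv_prod: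
  fixes f :: "'d::finite \<Rightarrow> real \<Rightarrow> complex"
  assumes "\<And>k. test_function \<delta> (f k)"
  shows "fourier_inv (\<lambda>\<xi>. \<Prod>k\<in>UNIV. FT (f k) (\<xi> $ k)) x = (\<Prod>k\<in>UNIV. f k (x $ k))"
proof -
  have "(LINT \<xi>|lborel. cis (x \<bullet> \<xi>) * (\<Prod>k\<in>UNIV. FT (f k) (\<xi> $ k)))
      = (LINT \<xi>|lborel. (\<Prod>k\<in>UNIV. cis (x $ k * \<xi> $ k) * FT (f k) (\<xi> $ k)))"
    by (simp add: cis_inner prod.distrib)
  also have "\<dots> = (\<Prod>k\<in>UNIV. LINT s|lborel. cis (x $ k * s) * FT (f k) s)"
    by (rule integral_prod_coordinates)
       (intro integrable_cis_mult FT_integrable[OF assms] continuous_intros)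
  also have "\<dots> = (2 * pi) ^ CARD('d) * (\<Prod>k\<in>UNIV. f k (x $ k))"
    by (simp add: test_function_FT_inversion[OF assms] prod.distrib)
  finally show ?thesis by (simp add: fourier_inv_def)
qed

text \<open>Finite sums of separated test functions, supported in the cube of half-width \<open>\<delta>\<close>. On this class
multi-dimensional Fourier inversion is a product of one-dimensional inversions, and the class is
large enough for the construction: it is stable under partial derivatives and under multiplication
by plane waves along a coordinate axis.\<close>

inductive_set tensors :: "real \<Rightarrow> (real^'d::finite \<Rightarrow> complex) set" for \<delta> where
  product: "(\<And>k. test_function \<delta> (f k)) \<Longrightarrow> (\<lambda>x. \<Prod>k\<in>UNIV. f k (x $ k)) \<in> tensors \<delta>"
| add: "u \<in> tensors \<delta> \<Longrightarrow> v \<in> tensors \<delta> \<Longrightarrow> (\<lambda>x. u x + v x) \<in> tensors \<delta>"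
| scale: "u \<in> tensors \<delta> \<Longrightarrow> (\<lambda>x. c * u x) \<in> tensors \<delta>"

definition pd :: "'d \<Rightarrow> (real^'d::finite \<Rightarrow> complex) \<Rightarrow> real^'d \<Rightarrow> complex" where
  "pd k u x = frechet_derivative u (at x) (axis k 1)"

lemma pd_eqI: "(u has_derivative u') (at x) \<Longrightarrow> pd k u x = u' (axis k 1)"
  unfolding pd_def using frechet_derivative_at by metis

lemma tensors_smooth_comp:
  fixes L :: "'e::euclidean_space \<Rightarrow> real^'d::finite"
  assumes "u \<in> tensors \<delta>" "bounded_linear L"
  shows "smooth (\<lambda>z. u (L z))"
  using assms(1)
proof induction
  case (product f)
  have "smooth (\<lambda>z. L z $ k)" for k
    by (intro smooth_bounded_linear bounded_linear_compose[OF bounded_linear_vec_nth] assms(2))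
  moreover have "smooth (f k)" for k
    using product[of k] by (simp add: test_function_def)
  ultimately have "smooth (\<lambda>z. f k (L z $ k))" for k
    by (rule smooth_compose[rotated])
  then show ?case by (rule smooth_prod)
next
  case (add u v)
  then show ?case by (intro smooth_add)
next
  case (scale u c)
  then show ?case by (intro smooth_mult smooth_const)
qed

lemma tensors_smooth: "u \<in> tensors \<delta> \<Longrightarrow> smooth u"
  by (rule tensors_smooth_comp[OF _ bounded_linear_ident])

lemma tensors_has_derivative:
  "u \<in> tensors \<delta> \<Longrightarrow> (u has_derivative frechet_derivative u (at x)) (at x)"
  by (rule smooth_has_derivative[OF tensors_smooth])

lemma tensors_eq_0: "u \<in> tensors \<delta> \<Longrightarrow> \<delta> < \<bar>x $ k\<bar> \<Longrightarrow> u x = 0"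
  by (induction rule: tensors.induct) (auto simp: test_function_def)

text \<open>The tensor \<open>u0\<close> serves the empty sum, which is its zero multiple.\<close>

lemma tensors_sum:
  fixes u :: "'i \<Rightarrow> real^'d::finite \<Rightarrow> complex"
  assumes "finite I" "\<And>i. i \<in> I \<Longrightarrow> u i \<in> tensors \<delta>" "u0 \<in> (tensors \<delta> :: (real^'d \<Rightarrow> complex) set)"
  shows "(\<lambda>x. \<Sum>i\<in>I. u i x) \<in> tensors \<delta>"
  using assms
proof (induction I rule: finite_induct)
  case empty
  then show ?case using tensors.scale[of u0 \<delta> 0] by simp
next
  case (insert i I)
  then show ?case using tensors.add[of "u i" \<delta> "\<lambda>x. \<Sum>i\<in>I. u i x"] by simp
qed

lemma tensors_cis_mult:
  assumes "u \<in> tensors \<delta>"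
  shows "(\<lambda>x. cis (\<omega> * x $ j) * u x) \<in> tensors \<delta>"
  using assms
proof induction
  case (product f)
  have "smooth (\<lambda>s. cis (\<omega> * s))"
    using smooth_exp_scaled[of "\<i> * \<omega>"] by (simp add: cis_conv_exp mult_ac)
  then have "test_function \<delta> (\<lambda>s. (if k = j then cis (\<omega> * s) else 1) * f k s)" for k
    using product[of k] smooth_mult[of "\<lambda>s. cis (\<omega> * s)" "f k"] unfolding test_function_def
    by (cases "k = j") auto
  from tensors.product[of _ "\<lambda>k s. (if k = j then cis (\<omega> * s) else 1) * f k s", OF this]
  show ?case by (simp add: prod.distrib)
next
  case (add u v)
  then show ?case using tensors.add[OF add.IH] by (simp add: distrib_left)
next
  case (scale u c)
  then show ?case using tensors.scale[OF scale.IH, of c] by (simp add: mult.left_commute)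
qed

lemma pd_add: "u \<in> tensors \<delta> \<Longrightarrow> v \<in> tensors \<delta> \<Longrightarrow> pd k (\<lambda>x. u x + v x) x = pd k u x + pd k v x"
  using pd_eqI[OF has_derivative_add[OF tensors_has_derivative tensors_has_derivative]]
  by (simp add: pd_def)

lemma pd_scale: "u \<in> tensors \<delta> \<Longrightarrow> pd k (\<lambda>x. c * u x) x = c * pd k u x"
  using pd_eqI[OF has_derivative_mult_right[OF tensors_has_derivative]]
  by (simp add: pd_def)

lemma pd_prod:
  assumes "\<And>k. test_function \<delta> (f k)" "\<And>s. (f j has_vector_derivative f' s) (at s)"
  shows "pd j (\<lambda>x. \<Prod>k\<in>UNIV. f k (x $ k)) x = (\<Prod>k\<in>UNIV. (f (j := f')) k (x $ k))"
proof -
  have d: "((\<lambda>x. f k (x $ k)) has_derivative (\<lambda>h. frechet_derivative (f k) (at (x $ k)) (h $ k))) (at x)" for k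
    using assms(1)[of k] unfolding test_function_def
    by (intro has_derivative_compose[OF bounded_linear.has_derivative[OF bounded_linear_vec_nth has_derivative_ident]
        smooth_has_derivative]) simp
  have "frechet_derivative (f j) (at (x $ j)) = (\<lambda>h. h *\<^sub>R f' (x $ j))"
    using assms(2)[of "x $ j"] unfolding has_vector_derivative_def using frechet_derivative_at by metis
  moreover have "frechet_derivative (f k) (at (x $ k)) 0 = 0" for k
    using assms(1)[of k] unfolding test_function_def
    by (intro linear_0 has_derivative_linear[OF smooth_has_derivative]) simp
  moreover have "pd j (\<lambda>x. \<Prod>k\<in>UNIV. f k (x $ k)) x =
      (\<Sum>k\<in>UNIV. frechet_derivative (f k) (at (x $ k)) (axis j 1 $ k) * (\<Prod>i\<in>UNIV - {k}. f i (x $ i)))"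
    by (rule pd_eqI[OF has_derivative_prod[OF d]])
  moreover have "axis j (1::real) $ k = (if k = j then 1 else 0)" for k
    by (simp add: axis_def)
  ultimately have "pd j (\<lambda>x. \<Prod>k\<in>UNIV. f k (x $ k)) x =
      (\<Sum>k\<in>UNIV. (if k = j then f' (x $ j) else 0) * (\<Prod>i\<in>UNIV - {k}. f i (x $ i)))"
    by (auto intro!: sum.cong)
  also have "\<dots> = f' (x $ j) * (\<Prod>i\<in>UNIV - {j}. f i (x $ i))"
    by (subst sum.remove[of UNIV j]) (auto intro!: sum.neutral)
  also have "\<dots> = (\<Prod>k\<in>UNIV. (f (j := f')) k (x $ k))"
    by (subst prod.remove[of UNIV j]) (auto intro!: prod.cong)
  finally show ?thesis .
qed

lemma tensors_pd:
  assumes "u \<in> tensors \<delta>"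
  shows "pd k u \<in> tensors \<delta>"
  using assms
proof induction
  case (product f)
  obtain f' where f': "test_function \<delta> f'" "\<And>s. (f k has_vector_derivative f' s) (at s)"
    using test_function_derivative[OF product] by blast
  have "(\<lambda>x. \<Prod>i\<in>UNIV. (f (k := f')) i (x $ i)) \<in> tensors \<delta>"
    using product f' by (intro tensors.product) auto
  also have "(\<lambda>x. \<Prod>i\<in>UNIV. (f (k := f')) i (x $ i)) = pd k (\<lambda>x. \<Prod>i\<in>UNIV. f i (x $ i))"
    using pd_prod[where f=f and f'=f' and j=k, OF product f'(2)] by auto
  finally show ?case .
next
  case (add u v)
  have "pd k (\<lambda>x. u x + v x) = (\<lambda>x. pd k u x + pd k v x)"
    using pd_add add by blast
  then show ?case using add tensors.add by metis
next
  case (scale u c)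
  have "pd k (\<lambda>x. c * u x) = (\<lambda>x. c * pd k u x)"
    using pd_scale scale by blast
  then show ?case using scale tensors.scale by metis
qed

lemma pd_cis_mult:
  assumes "u \<in> tensors \<delta>"
  shows "pd k (\<lambda>x. cis (\<omega> * x $ j) * u x) x =
    cis (\<omega> * x $ j) * (pd k u x + (if k = j then \<i> * \<omega> * u x else 0))"
proof -
  have v: "((\<lambda>x::real^'a. \<omega> * x $ j) has_derivative (\<lambda>h. \<omega> * h $ j)) (at x)"
    by (intro has_derivative_mult_right bounded_linear.has_derivative[OF bounded_linear_vec_nth has_derivative_ident])
  have e: "(cis has_derivative (\<lambda>h. h *\<^sub>R (\<i> * cis y))) (at y)" for y :: real
  proof -
    have "((\<lambda>x. exp (of_real x * \<i>)) has_vector_derivative (\<i> * exp (of_real y * \<i>))) (at y)"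
      by (auto intro!: derivative_eq_intros has_vector_derivative_real_field)
    then show ?thesis
      by (simp add: has_vector_derivative_def mult.commute flip: cis_conv_exp)
  qed
  have "((\<lambda>x. cis (\<omega> * x $ j)) has_derivative (\<lambda>h. (\<omega> * h $ j) *\<^sub>R (\<i> * cis (\<omega> * x $ j)))) (at x)"
    by (rule has_derivative_compose[OF v e])
  from pd_eqI[OF has_derivative_mult[OF this tensors_has_derivative[OF assms]], of k]
  show ?thesis
    by (auto simp: pd_def axis_def scaleR_conv_of_real algebra_simps)
qed

text \<open>For a separated function the multiplier \<open>\<xi>\<^sub>j\<^sup>2\<close> acts on the \<open>j\<close>-th factor only, where it produces the
transform of \<open>- f\<^sub>j''\<close>. The integrability statements are carried along because the integral operators are
additive only on integrable functions.\<close>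

lemma tensors_fourier:
  assumes "u \<in> tensors \<delta>"
  shows "integrable lborel u \<and> integrable lborel (\<lambda>\<xi>. complex_of_real ((\<xi> $ j)\<^sup>2) * fourier u \<xi>)
    \<and> (\<forall>x. fourier_inv (\<lambda>\<xi>. complex_of_real ((\<xi> $ j)\<^sup>2) * fourier u \<xi>) x = - pd j (pd j u) x)"
  using assms
proof induction
  case (product f)
  obtain f' f'' where t: "test_function \<delta> f'" "test_function \<delta> f''"
    and d: "\<And>x. (f j has_vector_derivative f' x) (at x)" "\<And>x. (f' has_vector_derivative f'' x) (at x)"
    and FT: "\<And>\<xi>. FT f'' \<xi> = - (\<xi>\<^sup>2 * FT (f j) \<xi>)"
    using FT_second_derivative[OF product[of j]] by metis
  \<comment> \<open>The separated function whose transform is the given transform times \<open>\<xi>\<^sub>j\<^sup>2\<close>.\<close>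
  let ?g = "f (j := \<lambda>s. - f'' s)"
  have g: "test_function \<delta> (?g k)" for k
    using product[of k] t smooth_mult[OF smooth_const[of "- 1"], of f''] unfolding test_function_def by simp
  have "pd j (\<lambda>x. \<Prod>k\<in>UNIV. f k (x $ k)) = (\<lambda>x. \<Prod>k\<in>UNIV. (f (j := f')) k (x $ k))"
    using pd_prod[where f=f and f'=f' and j=j, OF product d(1)] by auto
  moreover have "pd j (\<lambda>x. \<Prod>k\<in>UNIV. (f (j := f')) k (x $ k)) x = (\<Prod>k\<in>UNIV. (f (j := f'')) k (x $ k))" for x
    using pd_prod[of \<delta> "f (j := f')" j f''] product t d by simp
  moreover have "(\<Prod>k\<in>UNIV. ?g k (x $ k)) = - (\<Prod>k\<in>UNIV. (f (j := f'')) k (x $ k))" for x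
    by (subst (1 2) prod.remove[of UNIV j]) (auto intro!: prod.cong)
  ultimately have pd: "(\<Prod>k\<in>UNIV. ?g k (x $ k)) = - pd j (pd j (\<lambda>x. \<Prod>k\<in>UNIV. f k (x $ k))) x" for x
    by simp
  have "FT (\<lambda>s. - f'' s) = (\<lambda>\<xi>. \<xi>\<^sup>2 * FT (f j) \<xi>)"
    using FT by (simp add: FT_def fun_eq_iff)
  then have "(\<lambda>\<xi>. \<Prod>k\<in>UNIV. FT (?g k) (\<xi> $ k)) = (\<lambda>\<xi>. complex_of_real ((\<xi> $ j)\<^sup>2) * (\<Prod>k\<in>UNIV. FT (f k) (\<xi> $ k)))"
    by (intro ext, subst (1 2) prod.remove[of UNIV j]) (auto intro!: prod.cong)
  also have "\<dots> = (\<lambda>\<xi>. complex_of_real ((\<xi> $ j)\<^sup>2) * fourier (\<lambda>x. \<Prod>k\<in>UNIV. f k (x $ k)) \<xi>)"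
    by (simp add: fourier_prod test_function_integrable[OF product])
  finally have F: "(\<lambda>\<xi>. complex_of_real ((\<xi> $ j)\<^sup>2) * fourier (\<lambda>x. \<Prod>k\<in>UNIV. f k (x $ k)) \<xi>)
    = (\<lambda>\<xi>. \<Prod>k\<in>UNIV. FT (?g k) (\<xi> $ k))" by simp
  show ?case
    unfolding F fourier_inv_prod[OF g] pd
    by (intro conjI integrable_prod_coordinates test_function_integrable[OF product] FT_integrable[OF g]) simp
next
  case (add u v)
  have i: "integrable lborel (\<lambda>x. cis (- (x \<bullet> \<xi>)) * u x)" "integrable lborel (\<lambda>x. cis (- (x \<bullet> \<xi>)) * v x)" for \<xi>
    using add by (auto intro!: integrable_cis_mult continuous_intros)
  have F: "(\<lambda>\<xi>. complex_of_real ((\<xi> $ j)\<^sup>2) * fourier (\<lambda>x. u x + v x) \<xi>) =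
    (\<lambda>\<xi>. complex_of_real ((\<xi> $ j)\<^sup>2) * fourier u \<xi> + complex_of_real ((\<xi> $ j)\<^sup>2) * fourier v \<xi>)"
    unfolding fourier_def by (simp add: distrib_left i Bochner_Integration.integral_add)
  have I: "integrable lborel (\<lambda>\<xi>. cis (x \<bullet> \<xi>) * (complex_of_real ((\<xi> $ j)\<^sup>2) * fourier u \<xi>))"
     "integrable lborel (\<lambda>\<xi>. cis (x \<bullet> \<xi>) * (complex_of_real ((\<xi> $ j)\<^sup>2) * fourier v \<xi>))" for x
    using add by (auto intro!: integrable_cis_mult continuous_intros)
  have inv: "fourier_inv (\<lambda>\<xi>. complex_of_real ((\<xi> $ j)\<^sup>2) * fourier u \<xi> + complex_of_real ((\<xi> $ j)\<^sup>2) * fourier v \<xi>) x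
    = fourier_inv (\<lambda>\<xi>. complex_of_real ((\<xi> $ j)\<^sup>2) * fourier u \<xi>) x + fourier_inv (\<lambda>\<xi>. complex_of_real ((\<xi> $ j)\<^sup>2) * fourier v \<xi>) x" for x
    unfolding fourier_inv_def distrib_left[of "cis _"] Bochner_Integration.integral_add[OF I]
    by (simp add: distrib_left)
  have "pd j (\<lambda>x. u x + v x) = (\<lambda>x. pd j u x + pd j v x)"
    using pd_add add by blast
  moreover have "pd j (\<lambda>x. pd j u x + pd j v x) x = pd j (pd j u) x + pd j (pd j v) x" for x
    using pd_add tensors_pd add by blast
  ultimately show ?case
    unfolding F inv using add by simp
next
  case (scale u c)
  have F: "(\<lambda>\<xi>. complex_of_real ((\<xi> $ j)\<^sup>2) * fourier (\<lambda>x. c * u x) \<xi>) =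
    (\<lambda>\<xi>. c * (complex_of_real ((\<xi> $ j)\<^sup>2) * fourier u \<xi>))"
    unfolding fourier_def by (simp add: mult.left_commute[of _ c])
  have inv: "fourier_inv (\<lambda>\<xi>. c * (complex_of_real ((\<xi> $ j)\<^sup>2) * fourier u \<xi>)) x
    = c * fourier_inv (\<lambda>\<xi>. complex_of_real ((\<xi> $ j)\<^sup>2) * fourier u \<xi>) x" for x
    unfolding fourier_inv_def by (simp add: mult.left_commute[of _ c])
  have "pd j (\<lambda>x. c * u x) = (\<lambda>x. c * pd j u x)"
    using pd_scale scale by blast
  moreover have "pd j (\<lambda>x. c * pd j u x) x = c * pd j (pd j u) x" for x
    using pd_scale tensors_pd scale by blast
  ultimately show ?case
    unfolding F inv using scale by simp
qed

lemma m_symbol_squared: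
  fixes c :: "'d::finite \<Rightarrow> real"
  assumes "\<And>k. c k > 0" "cn > 0"
  shows "(m_symbol c cn \<xi>)\<^sup>2 = (\<Sum>k\<in>UNIV. c k / cn * (\<xi> $ k)\<^sup>2)"
proof -
  have "0 \<le> (\<Sum>k\<in>UNIV. c k * (\<xi> $ k)\<^sup>2)"
    using assms by (intro sum_nonneg mult_nonneg_nonneg) (auto intro: less_imp_le)
  then have "((\<Sum>k\<in>UNIV. c k * (\<xi> $ k)\<^sup>2) powr (1 / 2))\<^sup>2 = (\<Sum>k\<in>UNIV. c k * (\<xi> $ k)\<^sup>2)"
    by (simp add: powr_half_sqrt)
  moreover have "(cn powr (- 1 / 2))\<^sup>2 = 1 / cn"
    using assms by (simp add: powr_minus_divide powr_half_sqrt power_divide)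
  ultimately show ?thesis
    by (simp add: m_symbol_def power_mult_distrib sum_divide_distrib)
qed

text \<open>The symbol \<open>m\<^sup>2\<close> is a quadratic form, so on tensors the multiplier is the second order differential
operator that it stands for.\<close>

lemma tangential_multiplier_m_symbol:
  assumes c: "\<And>k. c k > 0" "cn > 0" and w: "\<And>t. (\<lambda>x. w (x, t)) \<in> tensors \<delta>"
  shows "tangential_multiplier (\<lambda>\<xi>. (m_symbol c cn \<xi>)\<^sup>2) w (x, t) =
    - (\<Sum>k\<in>UNIV. c k / cn * pd k (pd k (\<lambda>y. w (y, t))) x)"
proof -
  let ?u = "\<lambda>y. w (y, t)"
  note F = tensors_fourier[OF w[of t]]
  have I: "integrable lborel (\<lambda>\<xi>. cis (x \<bullet> \<xi>) * (complex_of_real ((\<xi> $ k)\<^sup>2) * fourier ?u \<xi>))" for k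
    using F by (auto intro!: integrable_cis_mult continuous_intros)
  have "(LINT \<xi>|lborel. cis (x \<bullet> \<xi>) * (complex_of_real ((m_symbol c cn \<xi>)\<^sup>2) * fourier ?u \<xi>)) =
      (LINT \<xi>|lborel. (\<Sum>k\<in>UNIV. complex_of_real (c k / cn) * (cis (x \<bullet> \<xi>) * (complex_of_real ((\<xi> $ k)\<^sup>2) * fourier ?u \<xi>))))"
    unfolding m_symbol_squared[OF c]
    by (intro Bochner_Integration.integral_cong refl)
       (simp add: sum_distrib_left sum_distrib_right mult_ac)
  also have "\<dots> = (\<Sum>k\<in>UNIV. complex_of_real (c k / cn) * (LINT \<xi>|lborel. cis (x \<bullet> \<xi>) * (complex_of_real ((\<xi> $ k)\<^sup>2) * fourier ?u \<xi>)))"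
    by (subst Bochner_Integration.integral_sum)
       (intro integrable_mult_right I, simp only: integral_mult_right_zero)
  finally have "fourier_inv (\<lambda>\<xi>. complex_of_real ((m_symbol c cn \<xi>)\<^sup>2) * fourier ?u \<xi>) x =
      (\<Sum>k\<in>UNIV. complex_of_real (c k / cn) * fourier_inv (\<lambda>\<xi>. complex_of_real ((\<xi> $ k)\<^sup>2) * fourier ?u \<xi>) x)"
    by (simp only: fourier_inv_def sum_distrib_left mult.left_commute)
  then show ?thesis
    using F by (simp add: tangential_multiplier_def sum_negf)
qed

section \<open>Modes of the conjugated operator\<close>

lemma smooth_exp: "smooth (exp :: real \<Rightarrow> real)"
  using smooth_of_derivative_chain[of "\<lambda>k. exp :: real \<Rightarrow> real"]
  by (simp add: DERIV_exp has_real_derivative_iff_has_vector_derivative[symmetric])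

lemma deriv_weight: "deriv (weight \<alpha> \<beta>) t = \<alpha> + \<beta> * t"
  unfolding weight_def
  by (rule DERIV_imp_deriv) (auto intro!: derivative_eq_intros)

lemma smooth_partial_t:
  fixes w :: "(real^'d::finite) \<times> real \<Rightarrow> complex"
  assumes "smooth w"
  shows "((\<lambda>s. w (x, s)) has_vector_derivative frechet_derivative w (at (x, t)) (0, 1)) (at t)"
proof -
  have "((\<lambda>s. (x, s)) has_derivative (\<lambda>h. (0, h))) (at t)"
    by (intro has_derivative_Pair has_derivative_const has_derivative_ident)
  then have "((\<lambda>s. w (x, s)) has_derivative (\<lambda>h. frechet_derivative w (at (x, t)) (0, h))) (at t)"
    by (rule has_derivative_compose[OF _ smooth_has_derivative[OF assms]])
  moreover have "(\<lambda>h. frechet_derivative w (at (x, t)) (0, h)) = (\<lambda>h. h *\<^sub>R frechet_derivative w (at (x, t)) (0, 1))"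
  proof
    fix h
    show "frechet_derivative w (at (x, t)) (0, h) = h *\<^sub>R frechet_derivative w (at (x, t)) (0, 1)"
      using linear_scale[OF has_derivative_linear[OF smooth_has_derivative[OF assms, of "(x, t)"]], of h "(0, 1)"]
      by simp
  qed
  ultimately show ?thesis by (simp only: has_vector_derivative_def)
qed

lemma D_n_smooth_eq:
  assumes "smooth w"
  shows "D_n w = (\<lambda>z. (1 / \<i>) * frechet_derivative w (at z) (0, 1))"
  by (simp add: D_n_def fun_eq_iff vector_derivative_at[OF smooth_partial_t[OF assms]])

lemma smooth_D_n_conj:
  fixes w :: "(real^'d::finite) \<times> real \<Rightarrow> complex"
  assumes "smooth w"
  shows "smooth (D_n_conj \<tau> \<alpha> \<beta> w)"
proof -
  have "smooth (\<lambda>z. frechet_derivative w (at z) (0, 1))"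
    by (rule smooth_partial[OF assms]) (simp add: Basis_prod_def)
  then have 1: "smooth (\<lambda>z. (1 / \<i>) * frechet_derivative w (at z) (0, 1))"
    by (rule smooth_mult[OF smooth_const])
  have "smooth (\<lambda>z::(real^'d) \<times> real. \<beta> * snd z)"
    by (rule smooth_mult[OF smooth_const smooth_bounded_linear[OF bounded_linear_snd]])
  then have "smooth (\<lambda>z::(real^'d) \<times> real. \<tau> * (\<alpha> + \<beta> * snd z))"
    using smooth_mult[OF smooth_const smooth_add[OF smooth_const]] by blast
  from smooth_mult[OF smooth_const smooth_of_real[OF this]]
  have "smooth (\<lambda>z::(real^'d) \<times> real. \<i> * complex_of_real (\<tau> * (\<alpha> + \<beta> * snd z)))" .
  from smooth_add[OF 1 smooth_mult[OF this assms]] show ?thesis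
    by (simp add: D_n_conj_def D_n_smooth_eq[OF assms] deriv_weight case_prod_beta')
qed

lemma D_n_conj_add:
  assumes "smooth v" "smooth w"
  shows "D_n_conj \<tau> \<alpha> \<beta> (\<lambda>z. v z + w z) = (\<lambda>z. D_n_conj \<tau> \<alpha> \<beta> v z + D_n_conj \<tau> \<alpha> \<beta> w z)"
proof -
  have "vector_derivative (\<lambda>s. v (x, s) + w (x, s)) (at t) =
     vector_derivative (\<lambda>s. v (x, s)) (at t) + vector_derivative (\<lambda>s. w (x, s)) (at t)" for x t
    unfolding vector_derivative_at[OF smooth_partial_t[OF assms(1)]]
      vector_derivative_at[OF smooth_partial_t[OF assms(2)]]
    by (intro vector_derivative_at has_vector_derivative_add smooth_partial_t assms)
  then show ?thesis
    by (simp add: D_n_conj_def D_n_def fun_eq_iff algebra_simps add_divide_distrib)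
qed

text \<open>This is \<open>- m(D')\<^sup>2\<close>.\<close>

definition tangential_op :: "('d::finite \<Rightarrow> real) \<Rightarrow> real \<Rightarrow> (real^'d \<Rightarrow> complex) \<Rightarrow> real^'d \<Rightarrow> complex" where
  "tangential_op c cn u x = (\<Sum>k\<in>UNIV. complex_of_real (c k / cn) * pd k (pd k u) x)"

lemma pd_add_fun: "u \<in> tensors \<delta> \<Longrightarrow> v \<in> tensors \<delta> \<Longrightarrow> pd k (\<lambda>x. u x + v x) = (\<lambda>x. pd k u x + pd k v x)"
  using pd_add by blast

lemma pd_scale_fun: "u \<in> tensors \<delta> \<Longrightarrow> pd k (\<lambda>x. c * u x) = (\<lambda>x. c * pd k u x)"
  using pd_scale by blast

lemma tangential_op_add: "u \<in> tensors \<delta> \<Longrightarrow> v \<in> tensors \<delta> \<Longrightarrow> tangential_op c cn (\<lambda>x. u x + v x) x = tangential_op c cn u x + tangential_op c cn v x"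
  by (simp add: tangential_op_def pd_add_fun[of _ \<delta>] tensors_pd distrib_left sum.distrib)

lemma tangential_op_scale: "u \<in> tensors \<delta> \<Longrightarrow> tangential_op c cn (\<lambda>x. d * u x) x = d * tangential_op c cn u x"
  by (simp add: tangential_op_def pd_scale_fun[of _ \<delta>] tensors_pd sum_distrib_left mult.left_commute)

lemma tensors_tangential_op:
  assumes "u \<in> tensors \<delta>"
  shows "tangential_op c cn u \<in> tensors \<delta>"
  unfolding tangential_op_def[abs_def]
  by (rule tensors_sum[OF _ tensors.scale[OF tensors_pd[OF tensors_pd[OF assms]]] assms]) simp

lemma pd_pd_cis_mult:
  assumes u: "u \<in> tensors \<delta>"
  shows "pd k (pd k (\<lambda>x. cis (\<omega> * x $ j) * u x)) x = cis (\<omega> * x $ j) *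
    (pd k (pd k u) x + (if k = j then 2 * \<i> * \<omega> * pd j u x - \<omega>\<^sup>2 * u x else 0))"
proof -
  define d :: complex where "d = (if k = j then \<i> * \<omega> else 0)"
  have v: "(\<lambda>x. pd k u x + d * u x) \<in> tensors \<delta>"
    by (intro tensors.add tensors_pd tensors.scale u)
  have p: "pd k (\<lambda>x. cis (\<omega> * x $ j) * v x) = (\<lambda>x. cis (\<omega> * x $ j) * (pd k v x + d * v x))"
    if "v \<in> tensors \<delta>" for v
    by (auto simp: pd_cis_mult[OF that] d_def)
  have "pd k (pd k (\<lambda>x. cis (\<omega> * x $ j) * u x)) x =
      cis (\<omega> * x $ j) * (pd k (\<lambda>x. pd k u x + d * u x) x + d * (pd k u x + d * u x))"
    unfolding p[OF u] p[OF v] ..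
  also have "pd k (\<lambda>x. pd k u x + d * u x) x = pd k (pd k u) x + d * pd k u x"
    using u by (simp add: pd_add[of _ \<delta>] pd_scale[of _ \<delta>] tensors_pd tensors.scale)
  finally show ?thesis
    by (auto simp: d_def algebra_simps power2_eq_square)
qed

lemma tangential_multiplier_cis_mult:
  fixes c :: "'d::finite \<Rightarrow> real" and u :: "real \<Rightarrow> real^'d \<Rightarrow> complex"
  assumes c: "\<And>k. c k > 0" "cn > 0" and u: "\<And>t. u t \<in> tensors \<delta>"
  shows "tangential_multiplier (\<lambda>\<xi>. (m_symbol c cn \<xi>)\<^sup>2) (\<lambda>(x, t). cis (\<omega> * x $ j) * u t x) (x, t) =
    - cis (\<omega> * x $ j) * (tangential_op c cn (u t) x + (c j / cn) * (2 * \<i> * \<omega> * pd j (u t) x - \<omega>\<^sup>2 * u t x))"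
proof -
  have sum: "(\<Sum>k\<in>UNIV. C k * (e * (p k + (if k = j then z else 0)))) = e * ((\<Sum>k\<in>UNIV. C k * p k) + C j * z)"
    for C p :: "'d \<Rightarrow> complex" and e z
  proof -
    have "(\<Sum>k\<in>UNIV. C k * (e * (p k + d k))) = e * ((\<Sum>k\<in>UNIV. C k * p k) + (\<Sum>k\<in>UNIV. C k * d k))"
      for d :: "'d \<Rightarrow> complex"
      by (simp add: distrib_left sum.distrib sum_distrib_left mult.left_commute)
    moreover have "(\<Sum>k\<in>UNIV. C k * (if k = j then z else 0)) = C j * z"
      by (subst sum.remove[of _ j]) auto
    ultimately show ?thesis by simp
  qed
  have "tangential_multiplier (\<lambda>\<xi>. (m_symbol c cn \<xi>)\<^sup>2) (\<lambda>(x, t). cis (\<omega> * x $ j) * u t x) (x, t) =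
      - (\<Sum>k\<in>UNIV. complex_of_real (c k / cn) * pd k (pd k (\<lambda>x. cis (\<omega> * x $ j) * u t x)) x)"
    using tangential_multiplier_m_symbol[where c=c and cn=cn and w="\<lambda>(x, t). cis (\<omega> * x $ j) * u t x" and \<delta>=\<delta> and x=x and t=t]
    by (simp add: c tensors_cis_mult[OF u])
  then show ?thesis
    by (simp only: pd_pd_cis_mult[OF u] sum tangential_op_def mult_minus_left)
qed

lemma L_tau_side_add:
  fixes v w :: "(real^'d::finite) \<times> real \<Rightarrow> complex"
  assumes c: "\<And>k. c k > 0" "cn > 0"
    and v: "smooth v" "\<And>t. (\<lambda>x. v (x, t)) \<in> tensors \<delta>"
    and w: "smooth w" "\<And>t. (\<lambda>x. w (x, t)) \<in> tensors \<delta>"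
  shows "L_tau_side c cn \<alpha> \<beta> \<tau> (\<lambda>z. v z + w z) z =
    L_tau_side c cn \<alpha> \<beta> \<tau> v z + L_tau_side c cn \<alpha> \<beta> \<tau> w z"
proof -
  obtain x t where z: "z = (x, t)" by (cases z)
  have "D_n_conj \<tau> \<alpha> \<beta> (D_n_conj \<tau> \<alpha> \<beta> (\<lambda>z. v z + w z)) =
    (\<lambda>z. D_n_conj \<tau> \<alpha> \<beta> (D_n_conj \<tau> \<alpha> \<beta> v) z + D_n_conj \<tau> \<alpha> \<beta> (D_n_conj \<tau> \<alpha> \<beta> w) z)"
    using v w by (simp add: D_n_conj_add smooth_D_n_conj)
  moreover have "(\<lambda>y. v (y, t) + w (y, t)) \<in> tensors \<delta>" for t
    using v w by (intro tensors.add)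
  then have "tangential_multiplier (\<lambda>\<xi>. (m_symbol c cn \<xi>)\<^sup>2) (\<lambda>z. v z + w z) (x, t) =
      tangential_multiplier (\<lambda>\<xi>. (m_symbol c cn \<xi>)\<^sup>2) v (x, t) +
      tangential_multiplier (\<lambda>\<xi>. (m_symbol c cn \<xi>)\<^sup>2) w (x, t)"
    using v(2) w(2)
    by (simp add: tangential_multiplier_m_symbol[OF c, where \<delta>=\<delta>] pd_add_fun[of _ \<delta>] tensors_pd
        distrib_left sum.distrib)
  ultimately show ?thesis
    by (simp add: L_tau_side_def z distrib_left)
qed

definition profile :: "real \<Rightarrow> real \<Rightarrow> real \<Rightarrow> real \<Rightarrow> real \<Rightarrow> real" where
  "profile \<tau> \<alpha> \<beta> \<nu> t = exp (\<tau> * (weight \<alpha> \<beta> t + \<nu> * t))"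

lemma profile_derivative:
  "(profile \<tau> \<alpha> \<beta> \<nu> has_real_derivative \<tau> * (\<alpha> + \<beta> * t + \<nu>) * profile \<tau> \<alpha> \<beta> \<nu> t) (at t)"
  unfolding profile_def[abs_def] weight_def
  by (auto intro!: derivative_eq_intros)

lemma smooth_profile: "smooth (\<lambda>t. complex_of_real (profile \<tau> \<alpha> \<beta> \<nu> t))"
proof -
  have "smooth (\<lambda>t::real. \<tau> * ((\<alpha> * t + \<beta> / 2 * t ^ 2) + \<nu> * t))"
    using smooth_mult[OF smooth_const[of \<tau>] smooth_add[OF smooth_add[OF smooth_mult[OF smooth_const[of \<alpha>] smooth_ident]
      smooth_mult[OF smooth_const[of "\<beta> / 2"] smooth_power[OF smooth_ident]]] smooth_mult[OF smooth_const[of \<nu>] smooth_ident]]] .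
  from smooth_of_real[OF smooth_compose[OF smooth_exp this]]
  show ?thesis by (simp add: profile_def[abs_def] weight_def)
qed

text \<open>The factor \<open>exp (\<tau> \<phi>)\<close> contained in the profile absorbs the weight, so that conjugation leaves
\<open>\<partial>\<^sub>t + \<tau> \<nu>\<close> acting on the amplitude \<open>a\<close>.\<close>

lemma D_n_conj_profile:
  fixes a a' :: "real^'d::finite \<Rightarrow> real \<Rightarrow> complex" and \<kappa> :: "real^'d \<Rightarrow> complex"
  assumes "\<And>x t. (a x has_vector_derivative a' x t) (at t)"
  shows "D_n_conj \<tau> \<alpha> \<beta> (\<lambda>(x, t). \<kappa> x * (profile \<tau> \<alpha> \<beta> \<nu> t * a x t)) =
    (\<lambda>(x, t). (- \<i> * \<kappa> x) * (profile \<tau> \<alpha> \<beta> \<nu> t * (a' x t + complex_of_real \<tau> * complex_of_real \<nu> * a x t)))"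
proof -
  have e: "((\<lambda>s. complex_of_real (profile \<tau> \<alpha> \<beta> \<nu> s)) has_vector_derivative
      complex_of_real (\<tau> * (\<alpha> + \<beta> * t + \<nu>) * profile \<tau> \<alpha> \<beta> \<nu> t)) (at t)" for t
    by (rule has_vector_derivative_of_real)
       (use profile_derivative in \<open>simp add: has_real_derivative_iff_has_vector_derivative\<close>)
  have "vector_derivative (\<lambda>s. \<kappa> x * (profile \<tau> \<alpha> \<beta> \<nu> s * a x s)) (at t) =
    \<kappa> x * (profile \<tau> \<alpha> \<beta> \<nu> t * a' x t + complex_of_real (\<tau> * (\<alpha> + \<beta> * t + \<nu>) * profile \<tau> \<alpha> \<beta> \<nu> t) * a x t)"
    for x t
    by (intro vector_derivative_at has_vector_derivative_mult_right has_vector_derivative_mult e assms)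
  then show ?thesis
    by (simp add: D_n_conj_def D_n_def fun_eq_iff deriv_weight algebra_simps)
qed

text \<open>A plane wave of frequency \<open>\<tau> s\<close> along the axis \<open>j\<close>, times the profile in the normal variable \<open>t\<close>, times an
amplitude that is quadratic in \<open>t\<close> and cut off by \<open>\<theta>\<close>. The exponent \<open>\<nu>\<close> will be one of \<open>\<plusminus> s \<gamma>\<close> with
\<open>\<gamma> = (c\<^sub>j / c\<^sub>n)\<^sup>1\<^sup>/\<^sup>2\<close>, the value of \<open>m\<close> at the \<open>j\<close>-th unit vector.\<close>

definition mode :: "real \<Rightarrow> real \<Rightarrow> real \<Rightarrow> real \<Rightarrow> real \<Rightarrow> 'd::finite \<Rightarrow> (real \<Rightarrow> complex) \<Rightarrow>
    (real^'d \<Rightarrow> complex) \<Rightarrow> (real^'d \<Rightarrow> complex) \<Rightarrow> (real^'d \<Rightarrow> complex) \<Rightarrow> (real^'d) \<times> real \<Rightarrow> complex" where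
  "mode \<tau> \<alpha> \<beta> \<nu> s j \<theta> g0 g1 g2 = (\<lambda>(x, t). cis (\<tau> * s * x $ j) *
     (profile \<tau> \<alpha> \<beta> \<nu> t * (\<theta> t * (g0 x + t * g1 x + (complex_of_real t)\<^sup>2 * g2 x))))"

lemma tensors_mode:
  assumes "g0 \<in> tensors \<delta>" "g1 \<in> tensors \<delta>" "g2 \<in> tensors \<delta>"
  shows "(\<lambda>x. mode \<tau> \<alpha> \<beta> \<nu> s j \<theta> g0 g1 g2 (x, t)) \<in> tensors \<delta>"
  unfolding mode_def prod.case
  by (intro tensors_cis_mult tensors.scale tensors.add assms)

lemma smooth_mode:
  fixes g0 g1 g2 :: "real^'d::finite \<Rightarrow> complex"
  assumes g: "g0 \<in> tensors \<delta>" "g1 \<in> tensors \<delta>" "g2 \<in> tensors \<delta>" and "smooth \<theta>"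
  shows "smooth (mode \<tau> \<alpha> \<beta> \<nu> s j \<theta> g0 g1 g2)"
proof -
  have G: "smooth (\<lambda>z::(real^'d) \<times> real. cis (\<tau> * s * fst z $ j) * g (fst z))" if "g \<in> tensors \<delta>" for g
    using tensors_smooth_comp[OF tensors_cis_mult[OF that] bounded_linear_fst] .
  have S: "smooth (\<lambda>z::(real^'d) \<times> real. f (snd z))" if "smooth f" for f :: "real \<Rightarrow> complex"
    using smooth_compose[OF that smooth_bounded_linear[OF bounded_linear_snd]] .
  have T: "smooth (\<lambda>t. complex_of_real (profile \<tau> \<alpha> \<beta> \<nu> t) * \<theta> t * complex_of_real t ^ p)" for p
    using smooth_mult[OF smooth_mult[OF smooth_profile assms(4)] smooth_power[OF smooth_of_real[OF smooth_ident]]] .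
  have P: "smooth (\<lambda>z::(real^'d) \<times> real. (cis (\<tau> * s * fst z $ j) * g (fst z)) *
      (complex_of_real (profile \<tau> \<alpha> \<beta> \<nu> (snd z)) * \<theta> (snd z) * complex_of_real (snd z) ^ p))"
    if "g \<in> tensors \<delta>" for g p
    using smooth_mult[OF G[OF that] S[OF T]] .
  have "mode \<tau> \<alpha> \<beta> \<nu> s j \<theta> g0 g1 g2 = (\<lambda>z.
      (cis (\<tau> * s * fst z $ j) * g0 (fst z)) *
        (complex_of_real (profile \<tau> \<alpha> \<beta> \<nu> (snd z)) * \<theta> (snd z) * complex_of_real (snd z) ^ 0) +
      (cis (\<tau> * s * fst z $ j) * g1 (fst z)) *
        (complex_of_real (profile \<tau> \<alpha> \<beta> \<nu> (snd z)) * \<theta> (snd z) * complex_of_real (snd z) ^ 1) +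
      (cis (\<tau> * s * fst z $ j) * g2 (fst z)) *
        (complex_of_real (profile \<tau> \<alpha> \<beta> \<nu> (snd z)) * \<theta> (snd z) * complex_of_real (snd z) ^ 2))"
    by (simp add: mode_def fun_eq_iff algebra_simps)
  then show ?thesis
    using smooth_add[OF smooth_add[OF P[OF g(1)] P[OF g(2)]] P[OF g(3)]] by (simp only:)
qed

lemma has_vector_derivative_amplitude:
  fixes \<theta> \<theta>' \<theta>'' :: "real \<Rightarrow> complex"
  assumes "\<And>t. (\<theta> has_vector_derivative \<theta>' t) (at t)" "\<And>t. (\<theta>' has_vector_derivative \<theta>'' t) (at t)"
  shows "((\<lambda>t. \<theta> t * (a + complex_of_real t * b + (complex_of_real t)\<^sup>2 * c)) has_vector_derivative
      (\<theta>' t * (a + t * b + (complex_of_real t)\<^sup>2 * c) + \<theta> t * (b + 2 * complex_of_real t * c))) (at t)" (is ?A)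
    and "((\<lambda>t. \<theta>' t * (a + complex_of_real t * b + (complex_of_real t)\<^sup>2 * c) + \<theta> t * (b + 2 * complex_of_real t * c))
      has_vector_derivative (\<theta>'' t * (a + complex_of_real t * b + (complex_of_real t)\<^sup>2 * c)
        + 2 * \<theta>' t * (b + 2 * complex_of_real t * c) + 2 * \<theta> t * c)) (at t)" (is ?B)
proof -
  have d: "((\<lambda>t. a + complex_of_real t * b + (complex_of_real t)\<^sup>2 * c) has_vector_derivative
      (b + 2 * complex_of_real t * c)) (at t)" for t
    by (rule has_vector_derivative_real_field[where f="\<lambda>z. a + z * b + z\<^sup>2 * c"])
       (auto intro!: derivative_eq_intros)
  have d': "((\<lambda>t. b + 2 * complex_of_real t * c) has_vector_derivative 2 * c) (at t)" for t
    by (rule has_vector_derivative_real_field[where f="\<lambda>z. b + 2 * z * c"])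
       (auto intro!: derivative_eq_intros)
  show ?A
    using has_vector_derivative_mult[OF assms(1) d] by (simp add: add.commute)
  show ?B
    using has_vector_derivative_add[OF has_vector_derivative_mult[OF assms(2) d] has_vector_derivative_mult[OF assms(1) d']]
    by (simp add: algebra_simps)
qed

lemma D_n_conj_mode:
  fixes \<theta> \<theta>' \<theta>'' :: "real \<Rightarrow> complex"
  assumes \<theta>: "\<And>t. (\<theta> has_vector_derivative \<theta>' t) (at t)" "\<And>t. (\<theta>' has_vector_derivative \<theta>'' t) (at t)"
  shows "D_n_conj \<tau> \<alpha> \<beta> (mode \<tau> \<alpha> \<beta> \<nu> s j \<theta> g0 g1 g2) =
      (\<lambda>(x, t). (- \<i> * cis (\<tau> * s * x $ j)) *
        (profile \<tau> \<alpha> \<beta> \<nu> t * ((\<theta>' t * (g0 x + t * g1 x + (complex_of_real t)\<^sup>2 * g2 x)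
            + \<theta> t * (g1 x + 2 * complex_of_real t * g2 x))
          + complex_of_real \<tau> * complex_of_real \<nu> * (\<theta> t * (g0 x + t * g1 x + (complex_of_real t)\<^sup>2 * g2 x)))))"
  unfolding mode_def
  by (rule D_n_conj_profile[OF has_vector_derivative_amplitude(1)[OF \<theta>]])

text \<open>The relation \<open>\<nu>\<^sup>2 = s\<^sup>2 c\<^sub>j / c\<^sub>n\<close> is the characteristic equation: it cancels the terms of order \<open>\<tau>\<^sup>2\<close>, leaving a
transport operator of order \<open>\<tau>\<close> and the second derivatives of the amplitude.\<close>

lemma L_tau_side_mode:
  fixes g0 g1 g2 :: "real^'d::finite \<Rightarrow> complex" and c :: "'d \<Rightarrow> real" and \<theta> \<theta>' \<theta>'' :: "real \<Rightarrow> complex"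
  assumes \<theta>: "\<And>t. (\<theta> has_vector_derivative \<theta>' t) (at t)" "\<And>t. (\<theta>' has_vector_derivative \<theta>'' t) (at t)"
    and c: "\<And>k. c k > 0" "cn > 0" and \<nu>: "\<nu>\<^sup>2 = s\<^sup>2 * (c j / cn)"
    and g: "g0 \<in> tensors \<delta>" "g1 \<in> tensors \<delta>" "g2 \<in> tensors \<delta>"
  defines "G \<equiv> \<lambda>x t. g0 x + complex_of_real t * g1 x + (complex_of_real t)\<^sup>2 * g2 x"
    and "G1 \<equiv> \<lambda>x t. g1 x + 2 * complex_of_real t * g2 x"
  shows "L_tau_side c cn \<alpha> \<beta> \<tau> (mode \<tau> \<alpha> \<beta> \<nu> s j \<theta> g0 g1 g2) (x, t) =
        cn * (cis (\<tau> * s * x $ j) * (profile \<tau> \<alpha> \<beta> \<nu> t *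
          (- (\<theta>'' t * G x t + 2 * \<theta>' t * G1 x t + 2 * \<theta> t * g2 x)
           - 2 * complex_of_real \<tau> * complex_of_real \<nu> * (\<theta>' t * G x t + \<theta> t * G1 x t)
           - \<theta> t * (tangential_op c cn g0 x + t * tangential_op c cn g1 x + (complex_of_real t)\<^sup>2 * tangential_op c cn g2 x)
           - 2 * \<i> * complex_of_real \<tau> * complex_of_real s * complex_of_real (c j / cn) * \<theta> t * (pd j g0 x + t * pd j g1 x + (complex_of_real t)\<^sup>2 * pd j g2 x))))"
proof -
  let ?\<kappa> = "\<lambda>x::real^'d. cis (\<tau> * s * x $ j)"
  have a: "((\<lambda>t. \<theta> t * G x t) has_vector_derivative (\<theta>' t * G x t + \<theta> t * G1 x t)) (at t)"
    "((\<lambda>t. \<theta>' t * G x t + \<theta> t * G1 x t) has_vector_derivative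
      (\<theta>'' t * G x t + 2 * \<theta>' t * G1 x t + 2 * \<theta> t * g2 x)) (at t)" for x t
    unfolding G_def G1_def by (rule has_vector_derivative_amplitude[OF \<theta>])+
  have m: "mode \<tau> \<alpha> \<beta> \<nu> s j \<theta> g0 g1 g2 = (\<lambda>(x, t). ?\<kappa> x * (profile \<tau> \<alpha> \<beta> \<nu> t * (\<theta> t * G x t)))"
    by (simp add: mode_def G_def)
  have D: "D_n_conj \<tau> \<alpha> \<beta> (mode \<tau> \<alpha> \<beta> \<nu> s j \<theta> g0 g1 g2) =
      (\<lambda>(x, t). (- \<i> * ?\<kappa> x) * (profile \<tau> \<alpha> \<beta> \<nu> t * ((\<theta>' t * G x t + \<theta> t * G1 x t) + complex_of_real \<tau> * complex_of_real \<nu> * (\<theta> t * G x t))))"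
    unfolding m
    by (rule D_n_conj_profile[where \<kappa>="?\<kappa>" and a="\<lambda>x t. \<theta> t * G x t" and a'="\<lambda>x t. \<theta>' t * G x t + \<theta> t * G1 x t"])
       (rule a(1))
  have DD: "D_n_conj \<tau> \<alpha> \<beta> (D_n_conj \<tau> \<alpha> \<beta> (mode \<tau> \<alpha> \<beta> \<nu> s j \<theta> g0 g1 g2)) =
    (\<lambda>(x, t). (- \<i> * (- \<i> * ?\<kappa> x)) * (profile \<tau> \<alpha> \<beta> \<nu> t *
      (((\<theta>'' t * G x t + 2 * \<theta>' t * G1 x t + 2 * \<theta> t * g2 x) + complex_of_real \<tau> * complex_of_real \<nu> * (\<theta>' t * G x t + \<theta> t * G1 x t))
       + complex_of_real \<tau> * complex_of_real \<nu> * ((\<theta>' t * G x t + \<theta> t * G1 x t) + complex_of_real \<tau> * complex_of_real \<nu> * (\<theta> t * G x t)))))"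
    unfolding D
    by (rule D_n_conj_profile) (intro has_vector_derivative_add has_vector_derivative_mult_right a)
  let ?E = "\<lambda>t. complex_of_real (profile \<tau> \<alpha> \<beta> \<nu> t) * \<theta> t"
  define u where "u t = (\<lambda>x. ?E t * (g0 x + complex_of_real t * g1 x + (complex_of_real t)\<^sup>2 * g2 x))" for t
  have m': "mode \<tau> \<alpha> \<beta> \<nu> s j \<theta> g0 g1 g2 = (\<lambda>(x, t). cis (\<tau> * s * x $ j) * u t x)"
    by (simp add: mode_def u_def mult.assoc)
  have u: "u t \<in> tensors \<delta>" for t
    unfolding u_def by (intro tensors.scale tensors.add g)
  have pu: "pd j (u t) x = ?E t * (pd j g0 x + t * pd j g1 x + (complex_of_real t)\<^sup>2 * pd j g2 x)" for t x
    unfolding u_def using g by (simp add: pd_scale[of _ \<delta>] pd_add[of _ \<delta>] tensors.scale tensors.add)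
  have Qu: "tangential_op c cn (u t) x = ?E t * (tangential_op c cn g0 x + t * tangential_op c cn g1 x + (complex_of_real t)\<^sup>2 * tangential_op c cn g2 x)" for t x
    unfolding u_def using g by (simp add: tangential_op_scale[of _ \<delta>] tangential_op_add[of _ \<delta>] tensors.scale tensors.add)
  have uG: "u t x = ?E t * G x t" for t x
    by (simp add: u_def G_def)
  have "(complex_of_real (c j / cn)) * (complex_of_real (\<tau> * s))\<^sup>2 = (complex_of_real (\<tau> * \<nu>))\<^sup>2"
    using \<nu> by (simp only: of_real_power[symmetric] of_real_mult[symmetric] power_mult_distrib mult_ac)
  then have sq: "(complex_of_real (c j / cn)) * ((complex_of_real (\<tau> * s))\<^sup>2 * z) = (complex_of_real \<tau> * complex_of_real \<nu>)\<^sup>2 * z" for z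
    by (simp only: mult.assoc[symmetric] of_real_mult)
  have T: "tangential_multiplier (\<lambda>\<xi>. (m_symbol c cn \<xi>)\<^sup>2) (mode \<tau> \<alpha> \<beta> \<nu> s j \<theta> g0 g1 g2) (x, t) =
    - cis (\<tau> * s * x $ j) * (tangential_op c cn (u t) x + (c j / cn) * (2 * \<i> * complex_of_real (\<tau> * s) * pd j (u t) x) -
       (complex_of_real \<tau> * complex_of_real \<nu>)\<^sup>2 * u t x)"
    unfolding m' tangential_multiplier_cis_mult[OF c u] right_diff_distrib[of "complex_of_real (c j / cn)"] sq
    by (simp only: add_diff_eq)
  \<comment> \<open>By the characteristic equation the tangential part contributes \<open>(T * N)\<^sup>2\<close>, which cancels the square from the normal part.\<close>
  have alg: "(- \<i> * (- \<i> * k)) * (P * ((X + T * N * Y) + T * N * (Y + T * N * (h * H)))) +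
      - k * (P * h * Q + C * (2 * \<i> * (T * S) * (P * h * p)) - (T * N)\<^sup>2 * (P * h * H)) =
      k * (P * (- X - 2 * T * N * Y - h * Q - 2 * \<i> * T * S * C * h * p))" for k P X T N Y h H Q C S p :: complex
    by (simp add: algebra_simps power2_eq_square)
  show ?thesis
    unfolding L_tau_side_def prod.case DD T Qu pu uG of_real_mult alg ..
qed

section \<open>Amplitude corrections and the residual\<close>

text \<open>The coefficients solve the transport equation order by order, with \<open>q = s (c\<^sub>j / c\<^sub>n) / \<nu>\<close>. The terms of order
\<open>\<tau>\<close> give the Taylor polynomial of \<open>\<psi>\<close> in direction \<open>- \<i> q t\<close> along the axis \<open>j\<close>; the terms of order one
are left with the second derivatives transversal to that axis, \<open>tangential_op \<psi> - q\<^sup>2 \<partial>\<^sub>j\<^sup>2 \<psi>\<close>, which the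
term of size \<open>t / \<tau>\<close> removes. The function \<open>\<rho>\<close>, of size \<open>\<tau>\<^sup>-\<^sup>2\<close>, is a free parameter for adjusting the
transmission conditions.\<close>

definition corrected_mode :: "('d::finite \<Rightarrow> real) \<Rightarrow> real \<Rightarrow> real \<Rightarrow> real \<Rightarrow> real \<Rightarrow> real \<Rightarrow> real \<Rightarrow> 'd \<Rightarrow>
    (real \<Rightarrow> complex) \<Rightarrow> (real^'d \<Rightarrow> complex) \<Rightarrow> (real^'d \<Rightarrow> complex) \<Rightarrow> (real^'d) \<times> real \<Rightarrow> complex" where
  "corrected_mode c cn \<tau> \<alpha> \<beta> \<nu> s j \<theta> \<psi> \<rho> =
    (let q = complex_of_real (s * (c j / cn) / \<nu>) in
     mode \<tau> \<alpha> \<beta> \<nu> s j \<theta>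
      (\<lambda>x. \<psi> x + inverse (complex_of_real \<tau>) ^ 2 * \<rho> x)
      (\<lambda>x. (- \<i> * q) * pd j \<psi> x + (- inverse (complex_of_real \<tau>) * inverse (complex_of_real \<nu>) / 2) *
         (tangential_op c cn \<psi> x + (- (q\<^sup>2)) * pd j (pd j \<psi>) x))
      (\<lambda>x. (- (q\<^sup>2) / 2) * pd j (pd j \<psi>) x))"

text \<open>The cancellations for \<open>corrected_mode\<close>, read off at one point. Here \<open>T\<close>, \<open>I\<close>, \<open>N\<close> and \<open>A\<close> stand for \<open>\<tau>\<close>, \<open>1 / \<tau>\<close>,
\<open>\<nu>\<close> and \<open>s c\<^sub>j / c\<^sub>n\<close>, the letters \<open>D\<close> and \<open>Q\<close> for iterated derivatives of \<open>\<psi>\<close> and \<open>\<rho>\<close>, and \<open>th\<close>, \<open>th1\<close>,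
\<open>th2\<close> for the cutoff and its derivatives. Every summand on the right contains one of the small factors
\<open>I\<close>, \<open>t\<close>, \<open>T t\<^sup>2\<close>, or a derivative of the cutoff.\<close>

lemma residual_identity:
  fixes T I N J q A t th th1 th2 G g1 g2 D1 D2 D3 QX QR QD1 QD2 QQ pR pQ :: complex
  assumes "T * I = 1" "N * J = 1" "A = N * q"
  defines "g1 \<equiv> (- \<i> * q) * D1 + (- I * J / 2) * (QX + (- (q\<^sup>2)) * D2)"
    and "g2 \<equiv> (- (q\<^sup>2) / 2) * D2"
  shows "- (th2 * G + 2 * th1 * (g1 + 2 * t * g2) + 2 * th * g2) - 2 * T * N * (th1 * G + th * (g1 + 2 * t * g2))
     - th * ((QX + I ^ 2 * QR) + t * ((- \<i> * q) * QD1 + (- I * J / 2) * (QQ + (- (q\<^sup>2)) * QD2)) + t\<^sup>2 * ((- (q\<^sup>2) / 2) * QD2))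
     - 2 * \<i> * T * A * th * ((D1 + I ^ 2 * pR) + t * ((- \<i> * q) * D2 + (- I * J / 2) * (pQ + (- (q\<^sup>2)) * D3)) + t\<^sup>2 * ((- (q\<^sup>2) / 2) * D3))
   = - (th2 * G) - 2 * (th1 * (g1 + 2 * t * g2)) - 2 * N * ((th1 * T) * G)
     + (- (I * (I * th * QR)) - 2 * \<i> * N * q * (I * (th * pR))
        + (t * (th * (\<i> * q * QD1 + \<i> * q * (pQ - q\<^sup>2 * D3)))
           + J / 2 * (t * (I * th * (QQ - q\<^sup>2 * QD2))))
        + (q\<^sup>2 / 2 * (t * (t * th * QD2)) + \<i> * N * q ^ 3 * ((T * t\<^sup>2) * (th * D3))))"
proof -
  have "T \<noteq> 0" "N \<noteq> 0" using assms(1,2) by auto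
  moreover from this have IJ: "I = 1 / T" "J = 1 / N"
    using assms(1,2) by (simp_all add: eq_divide_eq mult.commute)
  ultimately show ?thesis
    unfolding g1_def g2_def assms(3) IJ
    by (simp add: field_simps power2_eq_square power3_eq_cube)
qed

lemma tensors_bounded:
  assumes "u \<in> tensors \<delta>"
  obtains K where "K > 0" "\<And>x. cmod (u x) \<le> K"
proof (rule continuous_on_compact_support_bounded)
  show "continuous_on UNIV u" by (rule smooth_continuous_on[OF tensors_smooth[OF assms]])
  show "compact (cbox (vec (- \<delta>)) (vec \<delta>) :: (real^'a) set)" by simp
  show "u x = 0" if "x \<notin> cbox (vec (- \<delta>)) (vec \<delta>)" for x
  proof -
    have "\<exists>k. \<not> (- \<delta> \<le> x $ k \<and> x $ k \<le> \<delta>)" using that by (simp add: mem_box_cart)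
    then obtain k where "\<not> (- \<delta> \<le> x $ k \<and> x $ k \<le> \<delta>)" ..
    then show ?thesis using tensors_eq_0[OF assms, of x k] by linarith
  qed
qed (use that in blast)

text \<open>The derivatives of the cutoff vanish near \<open>0\<close>, hence are dominated by a multiple of any power of \<open>t\<close>. The power
\<open>t\<^sup>2\<close> puts them on the same footing as the other terms of the residual.\<close>

lemma plateau_derivatives:
  assumes "test_function \<delta> \<theta>" "0 < \<eta>" "\<And>t. \<bar>t\<bar> \<le> \<eta> \<Longrightarrow> \<theta> t = 1"
  obtains \<theta>' \<theta>'' K where "test_function \<delta> \<theta>'" "test_function \<delta> \<theta>''"
    "\<And>t. (\<theta> has_vector_derivative \<theta>' t) (at t)" "\<And>t. (\<theta>' has_vector_derivative \<theta>'' t) (at t)"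
    "K > 0" "\<And>t. cmod (\<theta> t) \<le> K" "\<And>t. cmod (\<theta>' t) \<le> K * t\<^sup>2" "\<And>t. cmod (\<theta>'' t) \<le> K * t\<^sup>2"
proof -
  obtain \<theta>' where \<theta>': "test_function \<delta> \<theta>'" "\<And>t. (\<theta> has_vector_derivative \<theta>' t) (at t)"
    using test_function_derivative[OF assms(1)] by blast
  obtain \<theta>'' where \<theta>'': "test_function \<delta> \<theta>''" "\<And>t. (\<theta>' has_vector_derivative \<theta>'' t) (at t)"
    using test_function_derivative[OF \<theta>'(1)] by blast
  have const: "g t = 0"
    if "\<And>t. \<bar>t\<bar> < \<eta> \<Longrightarrow> f t = e" "\<And>t. (f has_vector_derivative g t) (at t)" "\<bar>t\<bar> < \<eta>"
    for f g :: "real \<Rightarrow> complex" and e t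
  proof -
    have "open {y::real. \<bar>y\<bar> < \<eta>}" by (intro open_Collect_less continuous_intros)
    then have "((\<lambda>y. e) has_vector_derivative g t) (at t)"
      by (rule has_vector_derivative_transform_within_open[OF that(2)]) (use that in auto)
    then show ?thesis using vector_derivative_unique_at has_vector_derivative_const by blast
  qed
  have z1: "\<theta>' t = 0" if "\<bar>t\<bar> < \<eta>" for t
    by (rule const[where f=\<theta> and e=1]) (use \<theta>' assms(3) that in auto)
  have z2: "\<theta>'' t = 0" if "\<bar>t\<bar> < \<eta>" for t
    by (rule const[where f=\<theta>' and e=0]) (use \<theta>'' z1 that in auto)
  have bounded: "\<exists>K>0. \<forall>t. cmod (f t) \<le> K" if "test_function \<delta> f" for f
  proof -
    have f: "continuous_on UNIV f" "\<And>x. x \<notin> {-\<delta>..\<delta>} \<Longrightarrow> f x = 0"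
      using that unfolding test_function_def by (auto intro: smooth_continuous_on)
    from continuous_on_compact_support_bounded[OF f(1) compact_Icc f(2)] show ?thesis by metis
  qed
  obtain K0 K1 K2 where K: "K0 > 0" "\<And>t. cmod (\<theta> t) \<le> K0" "K1 > 0" "\<And>t. cmod (\<theta>' t) \<le> K1"
      "K2 > 0" "\<And>t. cmod (\<theta>'' t) \<le> K2"
    using bounded[OF assms(1)] bounded[OF \<theta>'(1)] bounded[OF \<theta>''(1)] by metis
  have quad: "cmod z \<le> k / \<eta>\<^sup>2 * t\<^sup>2" if "cmod z \<le> k" "\<bar>t\<bar> < \<eta> \<Longrightarrow> z = 0" for z t k
  proof (cases "\<bar>t\<bar> < \<eta>")
    case True
    have "0 \<le> k" using that(1) norm_ge_zero order_trans by blast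
    then show ?thesis using True that by simp
  next
    case False
    then have "1 \<le> t\<^sup>2 / \<eta>\<^sup>2"
      using power_mono[of \<eta> "\<bar>t\<bar>" 2] assms(2) by simp
    then have "k * 1 \<le> k * (t\<^sup>2 / \<eta>\<^sup>2)"
      using order_trans[OF norm_ge_zero that(1)] by (intro mult_left_mono)
    then show ?thesis using that(1) by simp
  qed
  define K where "K = K0 + K1 / \<eta>\<^sup>2 + K2 / \<eta>\<^sup>2"
  have nn: "0 \<le> K1 / \<eta>\<^sup>2" "0 \<le> K2 / \<eta>\<^sup>2" "0 < K0" using K by auto
  have mono: "k / \<eta>\<^sup>2 * t\<^sup>2 \<le> K * t\<^sup>2" if "k = K1 \<or> k = K2" for k t
    using that nn unfolding K_def by (intro mult_right_mono) auto
  show thesis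
  proof (rule that[OF \<theta>'(1) \<theta>''(1) \<theta>'(2) \<theta>''(2), of K])
    show "K > 0" using nn by (simp add: K_def add_pos_nonneg)
    show "cmod (\<theta> t) \<le> K" for t using K(2)[of t] nn by (simp add: K_def)
    show "cmod (\<theta>' t) \<le> K * t\<^sup>2" for t
      by (rule order_trans[OF quad mono[of K1]]) (use K(4) z1 in auto)
    show "cmod (\<theta>'' t) \<le> K * t\<^sup>2" for t
      by (rule order_trans[OF quad mono[of K2]]) (use K(6) z2 in auto)
  qed
qed

lemma tensors_corrected_mode:
  assumes "\<psi> \<in> tensors \<delta>" "\<rho> \<in> tensors \<delta>"
  shows "(\<lambda>x. corrected_mode c cn \<tau> \<alpha> \<beta> \<nu> s j \<theta> \<psi> \<rho> (x, t)) \<in> tensors \<delta>"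
  unfolding corrected_mode_def Let_def
  by (intro tensors_mode tensors.add tensors.scale tensors_tangential_op tensors_pd assms)

lemma smooth_corrected_mode:
  assumes "\<psi> \<in> tensors \<delta>" "\<rho> \<in> tensors \<delta>" "smooth \<theta>"
  shows "smooth (corrected_mode c cn \<tau> \<alpha> \<beta> \<nu> s j \<theta> \<psi> \<rho>)"
  unfolding corrected_mode_def Let_def
  by (rule smooth_mode[where \<delta>=\<delta>]) (intro tensors.add tensors.scale tensors_tangential_op tensors_pd assms)+

lemma bigo_principalI:
  "(\<And>p. p \<in> S \<Longrightarrow> norm (f p) \<le> K * norm (g p)) \<Longrightarrow> f \<in> O[principal S](g)"
  by (rule bigoI[where c=K]) (simp add: eventually_principal)

text \<open>The residual is a sum of products of bounded functions with one of \<open>1 / \<tau>\<close>, \<open>t\<close>, \<open>\<tau> t\<^sup>2\<close>. Landau symbols with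
respect to the principal filter of the parameter set express bounds that are uniform on that set, and
let the constants be handled by the calculus rules.\<close>

lemma corrected_mode_residual:
  fixes c :: "'d::finite \<Rightarrow> real"
  assumes c: "\<And>k. c k > 0" "cn > 0" and \<nu>: "\<nu> \<noteq> 0" "\<nu>\<^sup>2 = s\<^sup>2 * (c j / cn)"
    and tens: "\<psi> \<in> tensors \<delta>" "\<rho> \<in> tensors \<delta>"
    and \<theta>: "test_function \<delta> \<theta>" "0 < \<eta>" "\<And>t. \<bar>t\<bar> \<le> \<eta> \<Longrightarrow> \<theta> t = 1"
  obtains K where "K > 0"
    "\<And>\<tau> x t. 1 \<le> \<tau> \<Longrightarrow> \<bar>t\<bar> \<le> 1 \<Longrightarrow>
      cmod (L_tau_side c cn \<alpha> \<beta> \<tau> (corrected_mode c cn \<tau> \<alpha> \<beta> \<nu> s j \<theta> \<psi> \<rho>) (x, t))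
        \<le> K * (1 / \<tau> + \<bar>t\<bar> + \<tau> * t\<^sup>2) * profile \<tau> \<alpha> \<beta> \<nu> t"
proof -
  obtain \<theta>' \<theta>'' K\<theta> where \<theta>': "\<And>t. (\<theta> has_vector_derivative \<theta>' t) (at t)" "\<And>t. (\<theta>' has_vector_derivative \<theta>'' t) (at t)"
    and K\<theta>: "K\<theta> > 0" "\<And>t. cmod (\<theta> t) \<le> K\<theta>" "\<And>t. cmod (\<theta>' t) \<le> K\<theta> * t\<^sup>2" "\<And>t. cmod (\<theta>'' t) \<le> K\<theta> * t\<^sup>2"
    using plateau_derivatives[OF \<theta>] by metis
  define q where "q = complex_of_real (s * (c j / cn) / \<nu>)"
  define N where "N = complex_of_real \<nu>"
  define J where "J = inverse N"
  define Q where "Q = tangential_op c cn"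
  \<comment> \<open>The parameter set on which the bound has to be uniform, and the bound itself.\<close>
  define S :: "(real \<times> (real^'d) \<times> real) set" where "S = {(\<tau>, x, t). 1 \<le> \<tau> \<and> \<bar>t\<bar> \<le> 1}"
  define M where "M p = 1 / fst p + \<bar>snd (snd p)\<bar> + fst p * (snd (snd p))\<^sup>2" for p :: "real \<times> (real^'d) \<times> real"
  define T where "T p = complex_of_real (fst p)" for p :: "real \<times> (real^'d) \<times> real"
  define I where "I p = inverse (T p)" for p
  define X where "X p = fst (snd p)" for p :: "real \<times> (real^'d) \<times> real"
  define t where "t p = snd (snd p)" for p :: "real \<times> (real^'d) \<times> real"
  define r where "r p = complex_of_real (t p)" for p
  define g1 where "g1 p = (- \<i> * q) * pd j \<psi> (X p) + (- I p * J / 2) * (Q \<psi> (X p) + (- (q\<^sup>2)) * pd j (pd j \<psi>) (X p))" for p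
  define g2 where "g2 p = (- (q\<^sup>2) / 2) * pd j (pd j \<psi>) (X p)" for p
  define G where "G p = (\<psi> (X p) + I p ^ 2 * \<rho> (X p)) + r p * g1 p + (r p)\<^sup>2 * g2 p" for p
  define R where "R p = - (\<theta>'' (t p) * G p) - 2 * (\<theta>' (t p) * (g1 p + 2 * r p * g2 p)) - 2 * N * ((\<theta>' (t p) * T p) * G p)
     + (- (I p * (I p * \<theta> (t p) * Q \<rho> (X p))) - 2 * \<i> * N * q * (I p * (\<theta> (t p) * pd j \<rho> (X p)))
        + (r p * (\<theta> (t p) * (\<i> * q * Q (pd j \<psi>) (X p) + \<i> * q * (pd j (Q \<psi>) (X p) - q\<^sup>2 * pd j (pd j (pd j \<psi>)) (X p))))
           + J / 2 * (r p * (I p * \<theta> (t p) * (Q (Q \<psi>) (X p) - q\<^sup>2 * Q (pd j (pd j \<psi>)) (X p)))))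
        + (q\<^sup>2 / 2 * (r p * (r p * \<theta> (t p) * Q (pd j (pd j \<psi>)) (X p))) + \<i> * N * q ^ 3 * ((T p * (r p)\<^sup>2) * (\<theta> (t p) * pd j (pd j (pd j \<psi>)) (X p)))))" for p
  note tens' = tens tensors_pd tensors_tangential_op[of _ \<delta> c cn, folded Q_def]
  have L: "L_tau_side c cn \<alpha> \<beta> \<tau> (corrected_mode c cn \<tau> \<alpha> \<beta> \<nu> s j \<theta> \<psi> \<rho>) (x, u) =
      cn * (cis (\<tau> * s * x $ j) * (profile \<tau> \<alpha> \<beta> \<nu> u * R (\<tau>, x, u)))" if "1 \<le> \<tau>" for \<tau> x u
  proof -
    let ?p = "(\<tau>, x, u)"
    have TI: "T ?p * I ?p = 1" "N * J = 1"
      using that \<nu> by (simp_all add: T_def I_def N_def J_def)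
    have A: "complex_of_real s * complex_of_real (c j / cn) = N * q"
      using \<nu>(1) by (simp add: N_def q_def)
    note id = residual_identity[where T="T ?p" and I="I ?p" and N=N and J=J and q=q and t="r ?p"
        and th="\<theta> (t ?p)" and ?th1.0="\<theta>' (t ?p)" and ?th2.0="\<theta>'' (t ?p)" and G="G ?p"
        and ?D1.0="pd j \<psi> (X ?p)" and ?D2.0="pd j (pd j \<psi>) (X ?p)" and ?D3.0="pd j (pd j (pd j \<psi>)) (X ?p)"
        and QX="Q \<psi> (X ?p)" and QR="Q \<rho> (X ?p)" and ?QD1.0="Q (pd j \<psi>) (X ?p)" and ?QD2.0="Q (pd j (pd j \<psi>)) (X ?p)"
        and QQ="Q (Q \<psi>) (X ?p)" and pR="pd j \<rho> (X ?p)" and pQ="pd j (Q \<psi>) (X ?p)", OF TI A]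
    show ?thesis
      unfolding corrected_mode_def Let_def
      \<comment> \<open>Expand the coefficients of the corrected mode by linearity and apply the pointwise identity.\<close>
      apply (subst L_tau_side_mode[where \<theta>=\<theta> and \<theta>'=\<theta>' and \<theta>''=\<theta>'' and c=c and cn=cn and j=j and s=s and \<nu>=\<nu> and \<delta>=\<delta>, OF \<theta>' c \<nu>(2)])
         apply (intro tensors.add tensors.scale tensors_tangential_op tensors_pd tens)+
      apply (simp only: tangential_op_add[of _ \<delta>] tangential_op_scale[of _ \<delta>] pd_add[of _ \<delta>] pd_scale[of _ \<delta>] tens
          tensors_pd tensors_tangential_op tensors.add tensors.scale)
      apply (simp only: R_def g1_def g2_def id[symmetric])
      apply (simp only: G_def g1_def g2_def T_def I_def J_def N_def X_def t_def r_def Q_def q_def fst_conv snd_conv mult.assoc)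
      done
  qed
  let ?F = "principal S" and ?M = "\<lambda>p. complex_of_real (M p)"
  have S: "1 \<le> fst p" "\<bar>t p\<bar> \<le> 1" if "p \<in> S" for p
    using that by (auto simp: S_def t_def)
  have M: "1 / fst p \<le> M p" "\<bar>t p\<bar> \<le> M p" "fst p * (t p)\<^sup>2 \<le> M p" "0 \<le> M p" "(t p)\<^sup>2 \<le> M p" if "p \<in> S" for p
  proof -
    have "0 \<le> 1 / fst p" "0 \<le> \<bar>t p\<bar>" "0 \<le> fst p * (t p)\<^sup>2" using S[OF that] by simp_all
    then show "1 / fst p \<le> M p" "\<bar>t p\<bar> \<le> M p" "fst p * (t p)\<^sup>2 \<le> M p" "0 \<le> M p"
      unfolding M_def t_def by linarith+
    have "1 * (t p)\<^sup>2 \<le> fst p * (t p)\<^sup>2" using S[OF that] by (intro mult_right_mono) auto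
    then show "(t p)\<^sup>2 \<le> M p" using \<open>fst p * (t p)\<^sup>2 \<le> M p\<close> by linarith
  qed
  have tens_O: "(\<lambda>p. u (X p)) \<in> O[?F](\<lambda>_. 1)" if u: "u \<in> tensors \<delta>" for u
  proof -
    obtain K where "K > 0" "\<And>x. cmod (u x) \<le> K" by (rule tensors_bounded[OF u]) blast
    then show ?thesis by (intro bigo_principalI[where K=K]) simp
  qed
  have norms: "cmod (I p) = 1 / fst p" "cmod (r p) = \<bar>t p\<bar>" "cmod (T p * (r p)\<^sup>2) = fst p * (t p)\<^sup>2"
    "cmod (?M p) = M p" "1 / fst p \<le> 1" if "p \<in> S" for p
    using S[OF that] M(4)[OF that]
    by (simp_all add: I_def T_def r_def norm_divide norm_mult norm_power inverse_eq_divide)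
  have I_M: "I \<in> O[?F](?M)" and I_1: "I \<in> O[?F](\<lambda>_. 1)"
    by (rule bigo_principalI[where K=1], simp only: norms mult_1 M norm_one)+
  have r_M: "r \<in> O[?F](?M)" and r_1: "r \<in> O[?F](\<lambda>_. 1)"
    by (rule bigo_principalI[where K=1], simp only: norms mult_1 M S norm_one)+
  have Tr_M: "(\<lambda>p. T p * (r p)\<^sup>2) \<in> O[?F](?M)"
    by (rule bigo_principalI[where K=1], simp only: norms mult_1 M(3))
  have \<theta>_1: "(\<lambda>p. \<theta> (t p)) \<in> O[?F](\<lambda>_. 1)"
    by (rule bigo_principalI[where K="K\<theta>"]) (use K\<theta> in simp)
  have \<theta>'_M: "(\<lambda>p. \<theta>' (t p)) \<in> O[?F](?M)" and \<theta>''_M: "(\<lambda>p. \<theta>'' (t p)) \<in> O[?F](?M)"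
    and \<theta>'T_M: "(\<lambda>p. \<theta>' (t p) * T p) \<in> O[?F](?M)"
  proof -
    have le: "K\<theta> * (t p)\<^sup>2 \<le> K\<theta> * cmod (?M p)" "K\<theta> * (fst p * (t p)\<^sup>2) \<le> K\<theta> * cmod (?M p)" if "p \<in> S" for p
      using M[OF that] K\<theta>(1) by (auto intro!: mult_left_mono)
    show "(\<lambda>p. \<theta>' (t p)) \<in> O[?F](?M)" "(\<lambda>p. \<theta>'' (t p)) \<in> O[?F](?M)"
      by (rule bigo_principalI[where K="K\<theta>"], use le K\<theta> order_trans in blast)+
    show "(\<lambda>p. \<theta>' (t p) * T p) \<in> O[?F](?M)"
    proof (rule bigo_principalI[where K="K\<theta>"])
      fix p assume p: "p \<in> S"
      have "cmod (\<theta>' (t p) * T p) \<le> (K\<theta> * (t p)\<^sup>2) * fst p"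
        using K\<theta>(3)[of "t p"] S[OF p] by (auto simp: norm_mult T_def intro!: mult_right_mono)
      also have "\<dots> \<le> K\<theta> * cmod (?M p)" using le(2)[OF p] by (simp add: mult_ac)
      finally show "cmod (\<theta>' (t p) * T p) \<le> K\<theta> * cmod (?M p)" .
    qed
  qed
  have const: "(\<lambda>_. k) \<in> O[?F](\<lambda>_. 1)" for k :: complex
    by (rule bigo_principalI[where K="cmod k"]) simp
  note mult1 = landau_o.big.mult_in_1
  have left: "(\<lambda>p. f p * h p) \<in> O[?F](g)" if "f \<in> O[?F](\<lambda>_. 1)" "h \<in> O[?F](g)" for f h g
    using landau_o.big.mult[OF that] by simp
  have right: "(\<lambda>p. f p * h p) \<in> O[?F](g)" if "f \<in> O[?F](g)" "h \<in> O[?F](\<lambda>_. 1)" for f h g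
    using landau_o.big.mult[OF that] by simp
  have neg: "(\<lambda>p. - f p) \<in> O[?F](g)" if "f \<in> O[?F](g)" for f g
    using that by simp
  note add = sum_in_bigo(1) and diff = sum_in_bigo(2)
  have g2_1: "g2 \<in> O[?F](\<lambda>_. 1)"
    unfolding g2_def by (intro mult1 const tens_O tens')
  have g1_1: "g1 \<in> O[?F](\<lambda>_. 1)"
  proof -
    have "(\<lambda>p. (- \<i> * q) * pd j \<psi> (X p) + (- I p * (J / 2)) * (Q \<psi> (X p) + (- (q\<^sup>2)) * pd j (pd j \<psi>) (X p))) \<in> O[?F](\<lambda>_. 1)"
      by (intro add mult1 const neg I_1 tens_O tens')
    then show ?thesis by (simp add: g1_def[abs_def])
  qed
  have G_1: "G \<in> O[?F](\<lambda>_. 1)"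
    unfolding G_def power2_eq_square by (intro add mult1 const I_1 r_1 g1_1 g2_1 tens_O tens')
  have "R \<in> O[?F](?M)"
    unfolding R_def
  proof (intro add diff)
    show "(\<lambda>p. - (\<theta>'' (t p) * G p)) \<in> O[?F](?M)"
      by (intro neg right \<theta>''_M G_1)
    show "(\<lambda>p. 2 * (\<theta>' (t p) * (g1 p + 2 * r p * g2 p))) \<in> O[?F](?M)"
      by (intro left[OF const] right[OF \<theta>'_M] add mult1 const g1_1 g2_1 r_1)
    show "(\<lambda>p. 2 * N * ((\<theta>' (t p) * T p) * G p)) \<in> O[?F](?M)"
      by (intro left[OF const] right[OF \<theta>'T_M] G_1)
    show "(\<lambda>p. - (I p * (I p * \<theta> (t p) * Q \<rho> (X p)))) \<in> O[?F](?M)"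
      by (intro neg right[OF I_M] mult1 I_1 \<theta>_1 tens_O tens')
    show "(\<lambda>p. 2 * \<i> * N * q * (I p * (\<theta> (t p) * pd j \<rho> (X p)))) \<in> O[?F](?M)"
      by (intro left[OF const] right[OF I_M] mult1 \<theta>_1 tens_O tens')
    have O': "(\<lambda>p. pd j (Q \<psi>) (X p) - q\<^sup>2 * pd j (pd j (pd j \<psi>)) (X p)) \<in> O[?F](\<lambda>_. 1)"
      by (intro diff mult1 const tens_O tens')
    show "(\<lambda>p. r p * (\<theta> (t p) * (\<i> * q * Q (pd j \<psi>) (X p) + \<i> * q * (pd j (Q \<psi>) (X p) - q\<^sup>2 * pd j (pd j (pd j \<psi>)) (X p))))) \<in> O[?F](?M)"
      by (intro right[OF r_M] mult1[OF \<theta>_1] add left[OF const] O' tens_O tens')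
    show "(\<lambda>p. J / 2 * (r p * (I p * \<theta> (t p) * (Q (Q \<psi>) (X p) - q\<^sup>2 * Q (pd j (pd j \<psi>)) (X p))))) \<in> O[?F](?M)"
      by (intro left[OF const] right[OF r_M] mult1 diff const I_1 \<theta>_1 tens_O tens')
    show "(\<lambda>p. q\<^sup>2 / 2 * (r p * (r p * \<theta> (t p) * Q (pd j (pd j \<psi>)) (X p)))) \<in> O[?F](?M)"
      by (intro left[OF const] right[OF r_M] mult1 r_1 \<theta>_1 tens_O tens')
    show "(\<lambda>p. \<i> * N * q ^ 3 * (T p * (r p)\<^sup>2 * (\<theta> (t p) * pd j (pd j (pd j \<psi>)) (X p)))) \<in> O[?F](?M)"
      by (intro left[OF const] right[OF Tr_M] mult1 \<theta>_1 tens_O tens')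
  qed
  then obtain K where K: "K > 0" "\<And>p. p \<in> S \<Longrightarrow> cmod (R p) \<le> K * cmod (?M p)"
    by (auto simp: eventually_principal elim!: landau_o.bigE)
  show thesis
  proof (rule that[of "cn * K"])
    show "cn * K > 0" using c K by simp
    fix \<tau> u :: real and x :: "real^'d" assume "1 \<le> \<tau>" "\<bar>u\<bar> \<le> 1"
    then have p: "(\<tau>, x, u) \<in> S" by (simp add: S_def)
    have "cmod (R (\<tau>, x, u)) \<le> K * (1 / \<tau> + \<bar>u\<bar> + \<tau> * u\<^sup>2)"
      using K(2)[OF p] unfolding norms(4)[OF p] by (simp add: M_def)
    then have "cn * (profile \<tau> \<alpha> \<beta> \<nu> u * cmod (R (\<tau>, x, u))) \<le>
        cn * (profile \<tau> \<alpha> \<beta> \<nu> u * (K * (1 / \<tau> + \<bar>u\<bar> + \<tau> * u\<^sup>2)))"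
      using c(2) by (intro mult_left_mono) (auto simp: profile_def)
    then show "cmod (L_tau_side c cn \<alpha> \<beta> \<tau> (corrected_mode c cn \<tau> \<alpha> \<beta> \<nu> s j \<theta> \<psi> \<rho>) (x, u))
        \<le> cn * K * (1 / \<tau> + \<bar>u\<bar> + \<tau> * u\<^sup>2) * profile \<tau> \<alpha> \<beta> \<nu> u"
      using c(2) by (simp add: L[OF \<open>1 \<le> \<tau>\<close>] norm_mult mult_ac) (simp add: profile_def)
  qed
qed

section \<open>Norm estimates, locality and traces\<close>

lemma
  fixes f :: "'a::euclidean_space \<Rightarrow> real" and g :: "real \<Rightarrow> real"
  assumes f: "integrable lborel f" and g: "integrable lborel g"
  shows integrable_lborel_times: "integrable lborel (\<lambda>z. f (fst z) * g (snd z))"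
    and integral_lborel_times: "(LINT z|lborel. f (fst z) * g (snd z)) = (LINT x|lborel. f x) * (LINT t|lborel. g t)"
proof -
  have [measurable]: "f \<in> borel_measurable borel" "g \<in> borel_measurable borel"
    using f g by auto
  have "(\<lambda>(x, t). f x * g t) \<in> borel_measurable (lborel \<Otimes>\<^sub>M lborel)" by measurable
  then have int: "integrable (lborel \<Otimes>\<^sub>M lborel) (\<lambda>(x, t). f x * g t)"
    by (rule lborel_pair.Fubini_integrable) (use f g in \<open>auto simp: abs_mult\<close>)
  then show "integrable lborel (\<lambda>z. f (fst z) * g (snd z))"
    by (simp add: lborel_prod case_prod_beta')
  have "(LINT x|lborel. LINT t|lborel. f x * g t) = (LINT z|(lborel \<Otimes>\<^sub>M lborel). (case z of (x, t) \<Rightarrow> f x * g t))"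
    by (rule lborel_pair.integral_fst[OF int])
  then show "(LINT z|lborel. f (fst z) * g (snd z)) = (LINT x|lborel. f x) * (LINT t|lborel. g t)"
    by (simp add: lborel_prod case_prod_beta')
qed

lemma L2_norm_le:
  assumes "f \<in> borel_measurable borel" "integrable lborel F" "\<And>z. (cmod (f z))\<^sup>2 \<le> F z"
  shows "L2_norm f \<le> ennreal (sqrt (LINT z|lborel. F z))"
proof -
  have [measurable]: "f \<in> borel_measurable borel" by fact
  have F0: "0 \<le> F z" for z using assms(3)[of z] zero_le_power2 order_trans by blast
  have int: "integrable lborel (\<lambda>z. (cmod (f z))\<^sup>2)"
    by (rule Bochner_Integration.integrable_bound[OF assms(2)]) (use assms(3) F0 in auto)
  then have "(LINT z|lborel. (cmod (f z))\<^sup>2) \<le> (LINT z|lborel. F z)"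
    by (rule integral_mono[OF _ assms(2,3)])
  then show ?thesis using int by (simp add: L2_norm_def ennreal_leI)
qed

lemma L2_norm_ge:
  assumes "integrable lborel F" "\<And>z. F z \<le> (cmod (f z))\<^sup>2"
  shows "ennreal (sqrt (LINT z|lborel. F z)) \<le> L2_norm f"
proof (cases "integrable lborel (\<lambda>z. (cmod (f z))\<^sup>2)")
  case True
  then have "(LINT z|lborel. F z) \<le> (LINT z|lborel. (cmod (f z))\<^sup>2)"
    by (rule integral_mono[OF assms(1) _ assms(2)])
  then show ?thesis by (simp add: L2_norm_def ennreal_leI)
qed (simp add: L2_norm_def)

lemma profile_le:
  assumes "0 \<le> \<tau>" "\<bar>t\<bar> \<le> \<delta>" "0 \<le> \<beta>" "\<beta> * \<delta> \<le> 2 * d" "(\<alpha> + \<nu>) * t \<le> - (3 * d) * \<bar>t\<bar>"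
  shows "profile \<tau> \<alpha> \<beta> \<nu> t \<le> exp (- 2 * d * (\<tau> * \<bar>t\<bar>))"
proof -
  have "t\<^sup>2 = \<bar>t\<bar> * \<bar>t\<bar>" by (simp add: power2_eq_square)
  also have "\<dots> \<le> \<delta> * \<bar>t\<bar>" using assms(2) by (intro mult_right_mono) auto
  finally have "\<beta> * t\<^sup>2 \<le> \<beta> * (\<delta> * \<bar>t\<bar>)" using assms(3) by (intro mult_left_mono)
  also have "\<dots> \<le> 2 * d * \<bar>t\<bar>" using mult_right_mono[OF assms(4), of "\<bar>t\<bar>"] by (simp add: mult.assoc)
  finally have "weight \<alpha> \<beta> t + \<nu> * t \<le> - 2 * d * \<bar>t\<bar>"
    using assms(5) by (simp add: weight_def algebra_simps)
  then have "\<tau> * (weight \<alpha> \<beta> t + \<nu> * t) \<le> \<tau> * (- 2 * d * \<bar>t\<bar>)"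
    using assms(1) by (rule mult_left_mono)
  then show ?thesis by (simp add: profile_def mult_ac)
qed

text \<open>In the variable \<open>y = \<tau> \<bar>t\<bar>\<close> the residual bound is \<open>(1 + y + y\<^sup>2) / \<tau>\<close>: on the length scale \<open>1 / \<tau>\<close> on which the
profile lives, all three terms have size \<open>1 / \<tau>\<close>. The exponential is traded for a rational function,
whose integral scales explicitly with \<open>\<tau>\<close>.\<close>

lemma exp_dominates_residual:
  fixes d :: real
  assumes "d > 0"
  obtains K where "K > 0" "\<And>\<tau> t. 1 \<le> \<tau> \<Longrightarrow>
    (1 / \<tau> + \<bar>t\<bar> + \<tau> * t\<^sup>2) * exp (- 2 * d * (\<tau> * \<bar>t\<bar>)) \<le> K / \<tau> * inverse (1 + (\<tau> * t)\<^sup>2)"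
proof
  \<comment> \<open>This choice gives \<open>1 + y \<le> a (1 + d y / 2) \<le> a exp (d y / 2)\<close>, and the fourth power suffices.\<close>
  define a where "a = max 1 (2 / d)"
  have "2 / d * (d / 2) \<le> a * (d / 2)" using assms by (intro mult_right_mono) (simp_all add: a_def)
  then have a: "1 \<le> a" "1 \<le> a * (d / 2)" using assms by (simp_all add: a_def)
  show "a ^ 4 > 0" using a by simp
  fix \<tau> t :: real assume \<tau>: "1 \<le> \<tau>"
  define y where "y = \<tau> * \<bar>t\<bar>"
  have y: "0 \<le> y" using \<tau> by (simp add: y_def)
  have "1 + y \<le> a * (1 + d / 2 * y)"
    using a mult_right_mono[OF a(2) y] by (simp add: distrib_left mult.assoc)
  also have "\<dots> \<le> a * exp (d / 2 * y)"
    using a by (intro mult_left_mono exp_ge_add_one_self) auto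
  finally have "(1 + y) ^ 4 \<le> (a * exp (d / 2 * y)) ^ 4"
    using y by (intro power_mono) auto
  also have "\<dots> = a ^ 4 * exp (2 * d * y)"
    by (simp add: power_mult_distrib flip: exp_of_nat_mult)
  finally have 4: "(1 + y) ^ 4 \<le> a ^ 4 * exp (2 * d * y)" .
  have "(1 + y + y\<^sup>2) * (1 + y\<^sup>2) \<le> (1 + y)\<^sup>2 * (1 + y)\<^sup>2"
    using y by (intro mult_mono) (auto simp: power2_eq_square algebra_simps)
  also have "\<dots> = (1 + y) ^ 4" by (simp flip: power_add)
  finally have "(1 + y + y\<^sup>2) * (1 + y\<^sup>2) \<le> a ^ 4 * exp (2 * d * y)" using 4 by linarith
  moreover have "1 + y\<^sup>2 > 0" by (simp add: add_pos_nonneg)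
  ultimately have "(1 + y + y\<^sup>2) * exp (- 2 * d * y) \<le> a ^ 4 * inverse (1 + y\<^sup>2)"
    by (simp add: exp_minus field_simps)
  then have "(1 + y + y\<^sup>2) * exp (- 2 * d * y) / \<tau> \<le> a ^ 4 * inverse (1 + y\<^sup>2) / \<tau>"
    using \<tau> by (intro divide_right_mono) auto
  moreover have "(1 / \<tau> + \<bar>t\<bar> + \<tau> * t\<^sup>2) = (1 + y + y\<^sup>2) / \<tau>"
    using \<tau> by (simp add: y_def field_simps power2_eq_square)
  moreover have "(\<tau> * t)\<^sup>2 = y\<^sup>2" by (simp add: y_def power_mult_distrib)
  ultimately show "(1 / \<tau> + \<bar>t\<bar> + \<tau> * t\<^sup>2) * exp (- 2 * d * (\<tau> * \<bar>t\<bar>)) \<le> a ^ 4 / \<tau> * inverse (1 + (\<tau> * t)\<^sup>2)"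
    by (simp add: y_def)
qed

lemma pd_slice:
  fixes w :: "(real^'d::finite) \<times> real \<Rightarrow> complex"
  assumes "smooth w"
  shows "pd k (\<lambda>y. w (y, t)) x = frechet_derivative w (at (x, t)) (axis k 1, 0)"
proof -
  have "((\<lambda>y. (y, t)) has_derivative (\<lambda>h. (h, 0))) (at x)"
    by (intro has_derivative_Pair has_derivative_const has_derivative_ident)
  then show ?thesis
    by (rule pd_eqI[OF has_derivative_compose[OF _ smooth_has_derivative[OF assms]]])
qed

text \<open>Expressing the tangential derivatives by joint partial derivatives shows that \<open>L_tau_side\<close> acts on smooth
functions with tensor slices as a differential operator, from which continuity and locality are immediate.\<close>

lemma L_tau_side_smooth_eq:
  fixes w :: "(real^'d::finite) \<times> real \<Rightarrow> complex"
  assumes c: "\<And>k. c k > 0" "cn > 0" and w: "smooth w" "\<And>t. (\<lambda>x. w (x, t)) \<in> tensors \<delta>"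
  defines "P \<equiv> \<lambda>k v z. frechet_derivative v (at z) (axis k 1, 0)"
  shows "L_tau_side c cn \<alpha> \<beta> \<tau> w = (\<lambda>z. cn * (D_n_conj \<tau> \<alpha> \<beta> (D_n_conj \<tau> \<alpha> \<beta> w) z
     - (\<Sum>k\<in>UNIV. complex_of_real (c k / cn) * P k (P k w) z)))"
    and "\<And>k v. smooth v \<Longrightarrow> smooth (P k v :: (real^'d) \<times> real \<Rightarrow> complex)"
proof -
  show P: "smooth (P k v :: (real^'d) \<times> real \<Rightarrow> complex)" if "smooth v" for k v
    unfolding P_def by (rule smooth_partial[OF that]) (auto simp: Basis_prod_def Basis_vec_def)
  have "pd k (pd k (\<lambda>y. w (y, t))) x = P k (P k w) (x, t)" for k x t
  proof -
    have "pd k (\<lambda>y. w (y, t)) = (\<lambda>y. P k w (y, t))"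
      by (simp add: P_def pd_slice[OF w(1)] fun_eq_iff)
    then show ?thesis by (simp add: pd_slice[OF P[OF w(1)]]) (simp add: P_def)
  qed
  then show "L_tau_side c cn \<alpha> \<beta> \<tau> w = (\<lambda>z. cn * (D_n_conj \<tau> \<alpha> \<beta> (D_n_conj \<tau> \<alpha> \<beta> w) z
     - (\<Sum>k\<in>UNIV. complex_of_real (c k / cn) * P k (P k w) z)))"
    using tangential_multiplier_m_symbol[where c=c and cn=cn and w=w and \<delta>=\<delta>]
    by (simp add: L_tau_side_def c w(2) fun_eq_iff)
qed

lemma continuous_on_L_tau_side:
  fixes w :: "(real^'d::finite) \<times> real \<Rightarrow> complex"
  assumes c: "\<And>k. c k > 0" "cn > 0" and w: "smooth w" "\<And>t. (\<lambda>x. w (x, t)) \<in> tensors \<delta>"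
  shows "continuous_on UNIV (L_tau_side c cn \<alpha> \<beta> \<tau> w)"
  unfolding L_tau_side_smooth_eq(1)[OF c w]
  by (intro continuous_intros smooth_continuous_on smooth_D_n_conj L_tau_side_smooth_eq(2)[OF c w] w(1))

lemma frechet_derivative_eq_0_on_open:
  assumes "open U" "\<And>z. z \<in> U \<Longrightarrow> v z = e" "z \<in> U"
  shows "frechet_derivative v (at z) = (\<lambda>_. 0)"
proof -
  have "(v has_derivative (\<lambda>_. 0)) (at z)"
    by (rule has_derivative_transform_within_open[OF has_derivative_const[of e] assms(1,3)])
       (simp add: assms(2))
  then show ?thesis using frechet_derivative_at by metis
qed

lemma L_tau_side_local:
  fixes w :: "(real^'d::finite) \<times> real \<Rightarrow> complex"
  assumes c: "\<And>k. c k > 0" "cn > 0" and w: "smooth w" "\<And>t. (\<lambda>x. w (x, t)) \<in> tensors \<delta>"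
    and U: "open U" "\<And>z. z \<in> U \<Longrightarrow> w z = 0" "z \<in> U"
  shows "L_tau_side c cn \<alpha> \<beta> \<tau> w z = 0"
proof -
  have P: "frechet_derivative v (at z) = (\<lambda>_. 0)" if "\<And>z. z \<in> U \<Longrightarrow> v z = 0" "z \<in> U"
    for v :: "(real^'d) \<times> real \<Rightarrow> complex" and z
    using frechet_derivative_eq_0_on_open[OF U(1) that] .
  have D: "D_n_conj \<tau> \<alpha> \<beta> v z = 0" if "smooth v" "\<And>z. z \<in> U \<Longrightarrow> v z = 0" "z \<in> U" for v z
    using that P by (auto simp: D_n_conj_def D_n_smooth_eq[OF that(1)] case_prod_beta')
  have 1: "D_n_conj \<tau> \<alpha> \<beta> (D_n_conj \<tau> \<alpha> \<beta> w) z = 0"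
    by (intro D smooth_D_n_conj w U)
  have 2: "frechet_derivative (\<lambda>z. frechet_derivative w (at z) h) (at z) = (\<lambda>_. 0)" for h
    by (intro P U) (simp add: P U)
  show ?thesis
    unfolding L_tau_side_smooth_eq(1)[OF c w] by (simp add: 1 2)
qed

lemma D_n_conj_corrected_mode_0:
  fixes c :: "'d::finite \<Rightarrow> real" and cn s \<nu> :: real and j :: 'd and q :: complex
  assumes \<theta>: "test_function \<delta> \<theta>" "0 < \<eta>" "\<forall>t. \<bar>t\<bar> \<le> \<eta> \<longrightarrow> \<theta> t = 1"
  defines "q \<equiv> complex_of_real (s * (c j / cn) / \<nu>)"
  shows "D_n_conj \<tau> \<alpha> \<beta> (corrected_mode c cn \<tau> \<alpha> \<beta> \<nu> s j \<theta> \<psi> \<rho>) (x, 0) =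
    (- \<i> * cis (\<tau> * s * x $ j)) * ((- \<i> * q) * pd j \<psi> x + (- inverse (complex_of_real \<tau>) * inverse (complex_of_real \<nu>) / 2) *
         (tangential_op c cn \<psi> x + (- (q\<^sup>2)) * pd j (pd j \<psi>) x)
      + complex_of_real \<tau> * complex_of_real \<nu> * (\<psi> x + inverse (complex_of_real \<tau>) ^ 2 * \<rho> x))"
proof -
  obtain \<theta>' \<theta>'' K where \<theta>': "\<And>t. (\<theta> has_vector_derivative \<theta>' t) (at t)" "\<And>t. (\<theta>' has_vector_derivative \<theta>'' t) (at t)"
    and "\<And>t. cmod (\<theta>' t) \<le> K * t\<^sup>2"
    using plateau_derivatives[OF \<theta>(1,2)] \<theta>(3) by metis
  from this(3)[of 0] have "\<theta>' 0 = 0" by simp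
  moreover have "\<theta> 0 = 1" using \<theta> by simp
  ultimately show ?thesis
    unfolding corrected_mode_def Let_def
      D_n_conj_mode[where \<theta>=\<theta> and \<theta>'=\<theta>' and \<theta>''=\<theta>'', OF \<theta>']
    by (simp add: profile_def weight_def q_def)
qed

lemma corrected_mode_0:
  assumes "\<theta> 0 = 1"
  shows "corrected_mode c cn \<tau> \<alpha> \<beta> \<nu> s j \<theta> \<psi> \<rho> (x, 0) =
    cis (\<tau> * s * x $ j) * (\<psi> x + inverse (complex_of_real \<tau>) ^ 2 * \<rho> x)"
  using assms by (simp add: corrected_mode_def Let_def mode_def profile_def weight_def)

lemma corrected_mode_eq_0:
  assumes "\<psi> \<in> tensors \<delta>" "\<rho> \<in> tensors \<delta>" "test_function \<delta> \<theta>" "\<delta> < \<bar>x $ k\<bar> \<or> \<delta> < \<bar>t\<bar>"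
  shows "corrected_mode c cn \<tau> \<alpha> \<beta> \<nu> s j \<theta> \<psi> \<rho> (x, t) = 0"
  using assms(4)
proof
  assume "\<delta> < \<bar>x $ k\<bar>"
  then show ?thesis using tensors_eq_0[OF tensors_corrected_mode[OF assms(1,2)]] by blast
next
  assume "\<delta> < \<bar>t\<bar>"
  then have "\<theta> t = 0" using assms(3) by (simp add: test_function_def)
  then show ?thesis by (simp add: corrected_mode_def Let_def mode_def)
qed

lemma corrected_mode_on_plateau:
  assumes U: "open U" "\<And>x. x \<in> U \<Longrightarrow> \<psi> x = 1" "x \<in> U" and "\<theta> t = 1"
  shows "cmod (corrected_mode c cn \<tau> \<alpha> \<beta> \<nu> s j \<theta> \<psi> (\<lambda>_. 0) (x, t)) = profile \<tau> \<alpha> \<beta> \<nu> t"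
proof -
  have 1: "pd k \<psi> x = 0" if "x \<in> U" for k x
    unfolding pd_def using frechet_derivative_eq_0_on_open[OF U(1,2) that] by simp
  have 2: "pd k (pd k \<psi>) x = 0" for k
    unfolding pd_def[of k "pd k \<psi>"] using frechet_derivative_eq_0_on_open[of U "pd k \<psi>" 0 x] U 1 by simp
  show ?thesis
    using U assms(4) 1[OF U(3)] 2
    by (simp add: corrected_mode_def Let_def mode_def tangential_op_def norm_mult) (simp add: profile_def)
qed

section \<open>The quasimode\<close>

text \<open>A mediant inequality: \<open>m\<^sub>+\<^sup>2\<close> and \<open>m\<^sub>-\<^sup>2\<close> are diagonal quadratic forms, so if \<open>m\<^sub>+ \<le> r m\<^sub>-\<close> held on every
coordinate axis, it would hold everywhere.\<close>

lemma exists_favourable_axis: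
  fixes cp cm :: "'d::finite \<Rightarrow> real"
  assumes cp: "\<And>k. cp k > 0" "cnp > 0" and cm: "\<And>k. cm k > 0" "cnm > 0" and "0 < r"
    and \<xi>: "r < m_symbol cp cnp \<xi> / m_symbol cm cnm \<xi>"
  obtains j where "r * sqrt (cm j / cnm) < sqrt (cp j / cnp)"
proof (rule ccontr)
  assume "\<not> thesis"
  then have le: "sqrt (cp j / cnp) \<le> r * sqrt (cm j / cnm)" for j using that not_le by blast
  have "cp j / cnp \<le> r\<^sup>2 * (cm j / cnm)" for j
  proof -
    have "(sqrt (cp j / cnp))\<^sup>2 \<le> (r * sqrt (cm j / cnm))\<^sup>2"
      using le cp by (intro power_mono) (auto intro: less_imp_le)
    then show ?thesis using cp(1)[of j] cp(2) cm(1)[of j] cm(2) by (simp add: power_mult_distrib)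
  qed
  then have "(\<Sum>j\<in>UNIV. cp j / cnp * (\<xi> $ j)\<^sup>2) \<le> (\<Sum>j\<in>UNIV. r\<^sup>2 * (cm j / cnm) * (\<xi> $ j)\<^sup>2)"
    by (intro sum_mono mult_right_mono) auto
  then have "(m_symbol cp cnp \<xi>)\<^sup>2 \<le> (r * m_symbol cm cnm \<xi>)\<^sup>2"
    by (simp add: m_symbol_squared cp cm power_mult_distrib sum_distrib_left mult.assoc)
  moreover have nn: "0 \<le> m_symbol cm cnm \<xi>" by (simp add: m_symbol_def)
  ultimately have "m_symbol cp cnp \<xi> \<le> r * m_symbol cm cnm \<xi>"
    using \<open>0 < r\<close> power2_le_imp_le by (metis less_imp_le mult_nonneg_nonneg)
  moreover have "m_symbol cm cnm \<xi> \<noteq> 0" using \<xi> \<open>0 < r\<close> by auto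
  ultimately show False
    using \<xi> nn by (simp add: less_divide_eq)
qed

lemma exists_plateau:
  assumes "0 < \<eta>" "\<eta> < \<delta>"
  obtains \<theta> :: "real \<Rightarrow> complex" and \<psi> :: "real^'d::finite \<Rightarrow> complex"
  where "test_function \<delta> \<theta>" "\<And>t. \<bar>t\<bar> \<le> \<eta> \<Longrightarrow> \<theta> t = 1"
    "\<psi> \<in> tensors \<delta>" "\<And>x. (\<And>k. \<bar>x $ k\<bar> \<le> \<eta>) \<Longrightarrow> \<psi> x = 1"
proof -
  obtain \<theta> where \<theta>: "smooth \<theta>" "\<And>t. \<bar>t\<bar> \<le> \<eta> \<Longrightarrow> \<theta> t = (1::real)" "\<And>t. \<delta> \<le> \<bar>t\<bar> \<Longrightarrow> \<theta> t = 0"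
    using plateau_exists[OF assms] by blast
  have t: "test_function \<delta> (\<lambda>t. complex_of_real (\<theta> t))"
    using \<theta> smooth_of_real[OF \<theta>(1)] by (simp add: test_function_def)
  show thesis
    by (rule that[OF t _ tensors.product[OF t]]) (simp_all add: \<theta>)
qed

text \<open>On the half-line where \<open>(\<alpha> + \<nu>) t\<close> is negative, the weight \<open>\<beta> t\<^sup>2 / 2\<close> is dominated as soon as the support is
small. The profile then decays at a rate proportional to \<open>\<tau>\<close>, and the residual bound becomes \<open>1 / \<tau>\<close> times an
integrable function of \<open>\<tau> t\<close>.\<close>

lemma corrected_mode_decay:
  fixes c :: "'d::finite \<Rightarrow> real"
  assumes c: "\<And>k. c k > 0" "cn > 0" and \<nu>: "\<nu> \<noteq> 0" "\<nu>\<^sup>2 = s\<^sup>2 * (c j / cn)"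
    and tens: "\<psi> \<in> tensors \<delta>" "\<rho> \<in> tensors \<delta>"
    and \<theta>: "test_function \<delta> \<theta>" "0 < \<eta>" "\<And>t. \<bar>t\<bar> \<le> \<eta> \<Longrightarrow> \<theta> t = 1"
    and \<delta>: "0 < \<delta>" "\<delta> \<le> 1" and d: "0 < d" "0 \<le> \<beta>" "\<beta> * \<delta> \<le> 2 * d"
  obtains K where "K > 0"
    "\<And>\<tau> x t. 1 \<le> \<tau> \<Longrightarrow> (\<alpha> + \<nu>) * t \<le> - (3 * d) * \<bar>t\<bar> \<Longrightarrow>
      cmod (L_tau_side c cn \<alpha> \<beta> \<tau> (corrected_mode c cn \<tau> \<alpha> \<beta> \<nu> s j \<theta> \<psi> \<rho>) (x, t))
        \<le> K / \<tau> * (indicator (cbox (vec (- \<delta>)) (vec \<delta>)) x * inverse (1 + (\<tau> * t)\<^sup>2))"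
proof -
  let ?w = "\<lambda>\<tau>. corrected_mode c cn \<tau> \<alpha> \<beta> \<nu> s j \<theta> \<psi> \<rho>"
  obtain K where K: "K > 0" "\<And>\<tau> x t. 1 \<le> \<tau> \<Longrightarrow> \<bar>t\<bar> \<le> 1 \<Longrightarrow>
      cmod (L_tau_side c cn \<alpha> \<beta> \<tau> (?w \<tau>) (x, t)) \<le> K * (1 / \<tau> + \<bar>t\<bar> + \<tau> * t\<^sup>2) * profile \<tau> \<alpha> \<beta> \<nu> t"
    by (rule corrected_mode_residual[where c=c and j=j and s=s and \<nu>=\<nu> and \<alpha>=\<alpha> and \<beta>=\<beta>, OF c \<nu> tens \<theta>]) (assumption, rule that)
  obtain K' where K': "K' > 0" "\<And>\<tau> t. 1 \<le> \<tau> \<Longrightarrow>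
      (1 / \<tau> + \<bar>t\<bar> + \<tau> * t\<^sup>2) * exp (- 2 * d * (\<tau> * \<bar>t\<bar>)) \<le> K' / \<tau> * inverse (1 + (\<tau> * t)\<^sup>2)"
    by (rule exp_dominates_residual[OF d(1)]) (rule that)
  show thesis
  proof (rule that[of "K * K'"])
    show "K * K' > 0" using K K' by simp
    fix \<tau> t :: real and x :: "real^'d"
    assume \<tau>: "1 \<le> \<tau>" and t: "(\<alpha> + \<nu>) * t \<le> - (3 * d) * \<bar>t\<bar>"
    have nn: "0 \<le> K * K' / \<tau> * inverse (1 + (\<tau> * t)\<^sup>2)"
      using K K' \<tau> by simp
    show "cmod (L_tau_side c cn \<alpha> \<beta> \<tau> (?w \<tau>) (x, t))
        \<le> K * K' / \<tau> * (indicator (cbox (vec (- \<delta>)) (vec \<delta>)) x * inverse (1 + (\<tau> * t)\<^sup>2))"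
    proof (cases "(\<forall>k. \<bar>x $ k\<bar> \<le> \<delta>) \<and> \<bar>t\<bar> \<le> \<delta>")
      case False
      \<comment> \<open>Off the closed cube the mode vanishes on an open set, so locality applies.\<close>
      define U where "U = (\<Union>k. {z::(real^'d) \<times> real. \<delta> < \<bar>fst z $ k\<bar>}) \<union> {z. \<delta> < \<bar>snd z\<bar>}"
      have "open U"
        unfolding U_def by (intro open_Un open_UN ballI open_Collect_less continuous_intros)
      moreover have "?w \<tau> z = 0" if "z \<in> U" for z
      proof -
        obtain y u where z: "z = (y, u)" by (cases z)
        with that obtain k where "\<delta> < \<bar>y $ k\<bar> \<or> \<delta> < \<bar>u\<bar>" by (auto simp: U_def)
        then show ?thesis unfolding z by (rule corrected_mode_eq_0[OF tens \<theta>(1)])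
      qed
      moreover have "(x, t) \<in> U" using False by (auto simp: U_def not_le)
      ultimately have "L_tau_side c cn \<alpha> \<beta> \<tau> (?w \<tau>) (x, t) = 0"
        using \<theta>(1)
        by (intro L_tau_side_local[where U=U and \<delta>=\<delta>] c smooth_corrected_mode[where \<delta>=\<delta>]
            tensors_corrected_mode tens) (auto simp: test_function_def)
      then show ?thesis using nn by (simp add: indicator_def)
    next
      case True
      have "cmod (L_tau_side c cn \<alpha> \<beta> \<tau> (?w \<tau>) (x, t)) \<le> K * (1 / \<tau> + \<bar>t\<bar> + \<tau> * t\<^sup>2) * profile \<tau> \<alpha> \<beta> \<nu> t"
        using K \<tau> True \<delta> by auto
      also have "\<dots> \<le> K * (1 / \<tau> + \<bar>t\<bar> + \<tau> * t\<^sup>2) * exp (- 2 * d * (\<tau> * \<bar>t\<bar>))"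
        using K \<tau> True d t by (intro mult_left_mono profile_le[where \<delta>=\<delta>]) auto
      also have "\<dots> \<le> K * (K' / \<tau> * inverse (1 + (\<tau> * t)\<^sup>2))"
        unfolding mult.assoc[of K] by (rule mult_left_mono[OF K'(2)[OF \<tau>] less_imp_le[OF K(1)]])
      also have "\<dots> = K * K' / \<tau> * (indicator (cbox (vec (- \<delta>)) (vec \<delta>)) x * inverse (1 + (\<tau> * t)\<^sup>2))"
        using True by (simp add: mem_box_cart abs_le_iff minus_le_iff)
      finally show ?thesis .
    qed
  qed
qed

text \<open>The equality of fluxes at the interface. The left side is the flux of the single mode above, the right
side that of the two modes below with coefficients \<open>a\<close> and \<open>b\<close>. Terms in \<open>P\<close> and \<open>D\<close> match by the choice of
\<open>b - a = r\<close>, simultaneously because \<open>- \<i> q\<close> and \<open>\<nu>\<close> both change sign with the branch and scale with \<open>\<gamma>\<close>.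
The transversal terms \<open>Sp\<close> and \<open>Sm\<close> come from different operators and do not match; they are compensated
by \<open>R\<close>, which enters the two modes below with opposite signs and so leaves the trace unchanged.\<close>

lemma transmission_identity:
  fixes cp cm gp gm s T r a b P D Sp Sm R e :: complex
  assumes nz: "cm \<noteq> 0" "gp \<noteq> 0" "gm \<noteq> 0" "s \<noteq> 0" "T \<noteq> 0"
    and r: "cm * gm * r = cp * gp" and ab: "a = (1 - r) / 2" "b = (1 + r) / 2"
    and R: "R = (cp / (2 * s * gp) * Sp - cp * gp / (2 * s * gm\<^sup>2) * Sm) / (2 * cm * s * gm)"
  shows "cp * (e * ((- \<i> * (- gp)) * D + (- inverse T * inverse (- (s * gp)) / 2) * Sp + T * (- (s * gp)) * P)) =
    cm * (e * ((- \<i> * gm) * (a * D) + (- inverse T * inverse (s * gm) / 2) * (a * Sm)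
        + T * (s * gm) * (a * P + inverse T ^ 2 * R))
     + e * ((- \<i> * (- gm)) * (b * D) + (- inverse T * inverse (- (s * gm)) / 2) * (b * Sm)
        + T * (- (s * gm)) * (b * P + inverse T ^ 2 * (- 1 * R))))"
proof -
  have "cm * (e * ((- \<i> * gm) * (a * D) + (- inverse T * inverse (s * gm) / 2) * (a * Sm)
        + T * (s * gm) * (a * P + inverse T ^ 2 * R))
     + e * ((- \<i> * (- gm)) * (b * D) + (- inverse T * inverse (- (s * gm)) / 2) * (b * Sm)
        + T * (- (s * gm)) * (b * P + inverse T ^ 2 * (- 1 * R))))
    = e * ((cm * gm * (b - a)) * (\<i> * D + Sm / (2 * s * gm\<^sup>2 * T) - T * s * P) + 2 * cm * s * gm * R / T)"
    using nz by (simp add: field_simps power2_eq_square)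
  also have "b - a = r" by (simp add: ab field_simps)
  also have "2 * cm * s * gm * R = cp / (2 * s * gp) * Sp - cp * gp / (2 * s * gm\<^sup>2) * Sm"
    using nz by (simp add: R)
  also have "e * ((cm * gm * r) * (\<i> * D + Sm / (2 * s * gm\<^sup>2 * T) - T * s * P) +
      (cp / (2 * s * gp) * Sp - cp * gp / (2 * s * gm\<^sup>2) * Sm) / T)
    = cp * (e * ((- \<i> * (- gp)) * D + (- inverse T * inverse (- (s * gp)) / 2) * Sp + T * (- (s * gp)) * P))"
    unfolding r using nz by (simp add: field_simps power2_eq_square)
  finally show ?thesis by simp
qed

lemma integral_inverse_scaled:
  assumes "\<tau> > 0"
  shows "integrable lborel (\<lambda>t::real. inverse (1 + (\<tau> * t)\<^sup>2))"
    "(LINT t|lborel. inverse (1 + (\<tau> * t)\<^sup>2)) = (LINT t|lborel. inverse (1 + t\<^sup>2)) / \<tau>"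
proof -
  have i: "integrable lborel (\<lambda>t::real. inverse (1 + t\<^sup>2))"
    using integrable_inverse_1_plus_square by (simp add: set_integrable_def)
  show "integrable lborel (\<lambda>t::real. inverse (1 + (\<tau> * t)\<^sup>2))"
    using lborel_integrable_real_affine[OF i, of \<tau> 0] assms by simp
  have "(LINT t|lborel. inverse (1 + t\<^sup>2)) = \<bar>\<tau>\<bar> *\<^sub>R (LINT t|lborel. inverse (1 + (0 + \<tau> * t)\<^sup>2))"
    using assms by (intro lborel_integral_real_affine) simp
  then show "(LINT t|lborel. inverse (1 + (\<tau> * t)\<^sup>2)) = (LINT t|lborel. inverse (1 + t\<^sup>2)) / \<tau>"
    using assms by simp
qed

lemma L2_norm_concentrated_le:
  fixes f :: "(real^'d::finite) \<times> real \<Rightarrow> complex"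
  assumes "f \<in> borel_measurable borel" "\<tau> > 0" "K > 0"
    and "\<And>x t. cmod (f (x, t)) \<le> K / \<tau> * (indicator (cbox a b) x * inverse (1 + (\<tau> * t)\<^sup>2))"
  shows "L2_norm f \<le> ennreal (sqrt (K\<^sup>2 * measure lborel (cbox a b) * (LINT t|lborel. inverse (1 + t\<^sup>2)) / \<tau> ^ 3))"
proof -
  let ?F = "\<lambda>z::(real^'d) \<times> real. (K / \<tau>)\<^sup>2 * (indicator (cbox a b) (fst z) * inverse (1 + (\<tau> * snd z)\<^sup>2))"
  have i: "integrable lborel (indicator (cbox a b) :: real^'d \<Rightarrow> real)"
    by (rule integrable_real_indicator[OF _ emeasure_lborel_cbox_finite]) simp
  note F = integrable_lborel_times[OF i integral_inverse_scaled(1)[OF assms(2)]]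
    integral_lborel_times[OF i integral_inverse_scaled(1)[OF assms(2)]]
  have "L2_norm f \<le> ennreal (sqrt (LINT z|lborel. ?F z))"
  proof (rule L2_norm_le[OF assms(1) integrable_mult_right[OF F(1)]])
    fix z :: "(real^'d) \<times> real"
    obtain x t where z: "z = (x, t)" by (cases z)
    let ?u = "inverse (1 + (\<tau> * t)\<^sup>2)" and ?i = "indicator (cbox a b) x :: real"
    have u: "0 \<le> ?u" "?u \<le> 1" by (simp_all add: field_simps add_pos_nonneg)
    have "(cmod (f z))\<^sup>2 \<le> (K / \<tau> * (?i * ?u))\<^sup>2"
      unfolding z by (rule power_mono[OF assms(4)]) simp
    also have "\<dots> = (K / \<tau>)\<^sup>2 * (?i * (?u * ?u))"
      by (simp add: power2_eq_square indicator_def)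
    also have "\<dots> \<le> (K / \<tau>)\<^sup>2 * (?i * (?u * 1))"
      using u by (intro mult_left_mono) auto
    finally show "(cmod (f z))\<^sup>2 \<le> ?F z" by (simp add: z)
  qed
  also have "(LINT z|lborel. ?F z) = K\<^sup>2 * measure lborel (cbox a b) * (LINT t|lborel. inverse (1 + t\<^sup>2)) / \<tau> ^ 3"
    unfolding integral_mult_right_zero F(2) integral_inverse_scaled(2)[OF assms(2)]
    by (simp add: power_divide power2_eq_square power3_eq_cube)
  finally show ?thesis .
qed

lemma L2_norm_concentrated_ge:
  fixes f :: "(real^'d::finite) \<times> real \<Rightarrow> complex"
  assumes "\<tau> > 0" "k > 0" and "\<And>x t. x \<in> cbox a b \<Longrightarrow> 0 < t \<Longrightarrow> t \<le> 1 / \<tau> \<Longrightarrow> k \<le> cmod (f (x, t))"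
  shows "ennreal (sqrt (k\<^sup>2 * measure lborel (cbox a b) / \<tau>)) \<le> L2_norm f"
proof -
  let ?F = "\<lambda>z::(real^'d) \<times> real. k\<^sup>2 * (indicator (cbox a b) (fst z) * indicator {0<..1 / \<tau>} (snd z))"
  have i: "integrable lborel (indicator (cbox a b) :: real^'d \<Rightarrow> real)"
    by (rule integrable_real_indicator[OF _ emeasure_lborel_cbox_finite]) simp
  have j: "integrable lborel (indicator {0<..1 / \<tau>} :: real \<Rightarrow> real)"
    using assms(1) by (intro integrable_real_indicator) auto
  have "ennreal (sqrt (LINT z|lborel. ?F z)) \<le> L2_norm f"
  proof (rule L2_norm_ge[OF integrable_mult_right[OF integrable_lborel_times[OF i j]]])
    fix z :: "(real^'d) \<times> real"
    show "?F z \<le> (cmod (f z))\<^sup>2"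
      using assms by (cases z) (auto simp: indicator_def intro!: power_mono)
  qed
  also have "(LINT z|lborel. ?F z) = k\<^sup>2 * measure lborel (cbox a b) / \<tau>"
    using assms(1) by (simp add: integral_lborel_times[OF i j])
  finally show ?thesis .
qed

lemma supp_subset:
  assumes "closed S" "\<And>z. z \<notin> S \<Longrightarrow> f z = 0"
  shows "supp f \<subseteq> S"
  unfolding supp_def using assms by (intro closure_minimal) auto

lemma glue_measurable:
  fixes wp wm :: "(real^'d::finite) \<times> real \<Rightarrow> complex"
  assumes "continuous_on UNIV wp" "continuous_on UNIV wm"
  shows "glue wp wm \<in> borel_measurable borel"
proof -
  have [measurable]: "wp \<in> borel_measurable borel" "wm \<in> borel_measurable borel"
    using assms by (auto intro: borel_measurable_continuous_onI)
  have [measurable]: "{z :: (real^'d) \<times> real. 0 < snd z} \<in> sets borel" "{z :: (real^'d) \<times> real. snd z < 0} \<in> sets borel"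
    by (intro borel_open open_Collect_less continuous_intros)+
  show ?thesis unfolding glue_def by measurable
qed

theorem theorem5p1:
  fixes cp cm :: "'d::finite \<Rightarrow> real" and cnp cnm \<alpha>p \<alpha>m \<beta> :: real
  assumes "\<And>j. cp j > 0" and "\<And>j. cm j > 0" and "cnp > 0" and "cnm > 0"
    and "\<alpha>p > 0" and "\<alpha>m > 0" and "\<beta> > 0"
    and "\<exists>\<xi>0::real^'d. \<xi>0 \<noteq> 0 \<and> \<alpha>p / \<alpha>m < m_symbol cp cnp \<xi>0 / m_symbol cm cnm \<xi>0"
  shows "\<forall>(V :: ((real^'d) \<times> real) set) (C :: real) (\<tau>0 :: real).
    0 \<in> interior V \<longrightarrow> C > 0 \<longrightarrow> \<tau>0 > 0 \<longrightarrow>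
    (\<exists>\<tau>\<ge>\<tau>0. \<exists>vp\<in>Cc_infinity. \<exists>vm\<in>Cc_infinity.
       glue vp vm \<noteq> (\<lambda>x. 0) \<and>
       transmission cnp cnm \<alpha>p \<alpha>m \<tau> vp vm \<and>
       supp (glue vp vm) \<subseteq> V \<and>
       ennreal C * L2_norm (L_tau cp cm cnp cnm \<alpha>p \<alpha>m \<beta> \<tau> vp vm) \<le> L2_norm (glue vp vm))"
proof (intro allI impI)
  fix V :: "((real^'d) \<times> real) set" and C \<tau>0 :: real
  assume V: "0 \<in> interior V" and C: "C > 0" and \<tau>0: "\<tau>0 > 0"
  note cp = assms(1,3) and cm = assms(2,4) and pos = assms(3-7)

  obtain j where j: "\<alpha>p / \<alpha>m * sqrt (cm j / cnm) < sqrt (cp j / cnp)"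
  proof -
    obtain \<xi> where "\<alpha>p / \<alpha>m < m_symbol cp cnp \<xi> / m_symbol cm cnm \<xi>" using assms(8) by blast
    then show thesis
      by (rule exists_favourable_axis[OF cp cm, rotated]) (use pos that in auto)
  qed
  define \<gamma>p \<gamma>m where "\<gamma>p = sqrt (cp j / cnp)" and "\<gamma>m = sqrt (cm j / cnm)"
  have \<gamma>: "\<gamma>p > 0" "\<gamma>m > 0" "\<gamma>p\<^sup>2 = cp j / cnp" "\<gamma>m\<^sup>2 = cm j / cnm"
    using cp(1)[of j] cp(2) cm(1)[of j] cm(2) by (simp_all add: \<gamma>p_def \<gamma>m_def)
  have "\<alpha>p / \<gamma>p < \<alpha>m / \<gamma>m"
    using j \<gamma> pos unfolding \<gamma>p_def[symmetric] \<gamma>m_def[symmetric] by (simp add: field_simps)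
  \<comment> \<open>The amplitude of the frequency: the profile with exponent \<open>- s \<gamma>\<^sub>+\<close> decays above the interface, and both profiles with exponent \<open>\<plusminus> s \<gamma>\<^sub>-\<close> decay below it.\<close>
  then obtain s where s: "\<alpha>p / \<gamma>p < s" "s < \<alpha>m / \<gamma>m" using dense by blast
  then have s': "\<alpha>p < s * \<gamma>p" "s * \<gamma>m < \<alpha>m" using \<gamma> by (simp_all add: field_simps)
  have s0: "s > 0" using s(1) \<gamma> pos by (meson divide_pos_pos less_trans)
  define d where "d = min (s * \<gamma>p - \<alpha>p) (\<alpha>m - s * \<gamma>m) / 3"
  have d: "d > 0" "3 * d \<le> s * \<gamma>p - \<alpha>p" "3 * d \<le> \<alpha>m - s * \<gamma>m" "3 * d \<le> \<alpha>m + s * \<gamma>m"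
    using s' mult_pos_pos[OF s0 \<gamma>(2)] by (auto simp: d_def)

  obtain e where e: "e > 0" "ball 0 e \<subseteq> V" using V mem_interior by blast
  \<comment> \<open>Small enough for the quadratic part of the weight to be dominated by the decay rate, and for the cube to lie in \<open>V\<close>.\<close>
  define \<delta> where "\<delta> = min (min 1 (2 * d / \<beta>)) (e / (2 * (real CARD('d) + 1)))"
  have \<delta>: "\<delta> > 0" "\<delta> \<le> 1" "\<beta> * \<delta> \<le> 2 * d" "(real CARD('d) + 1) * \<delta> < e"
  proof -
    show "\<delta> > 0" "\<delta> \<le> 1" using d(1) e(1) pos by (simp_all add: \<delta>_def add_pos_nonneg)
    have "\<delta> \<le> 2 * d / \<beta>" by (simp add: \<delta>_def)
    then show "\<beta> * \<delta> \<le> 2 * d" using pos by (simp add: field_simps)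
    have "(real CARD('d) + 1) * \<delta> \<le> (real CARD('d) + 1) * (e / (2 * (real CARD('d) + 1)))"
      by (intro mult_left_mono) (simp_all add: \<delta>_def)
    also have "\<dots> = e / 2" by (simp add: field_simps add_pos_nonneg)
    finally show "(real CARD('d) + 1) * \<delta> < e" using e(1) by simp
  qed
  define B :: "((real^'d) \<times> real) set" where "B = cbox (vec (- \<delta>)) (vec \<delta>) \<times> {- \<delta>..\<delta>}"
  have "compact B" by (simp add: B_def compact_Times)
  then have B: "compact B" "closed B" by (simp_all add: compact_imp_closed)
  have "B \<subseteq> V"
  proof
    fix z :: "(real^'d) \<times> real" assume "z \<in> B"
    then have z: "\<bar>fst z $ k\<bar> \<le> \<delta>" "\<bar>snd z\<bar> \<le> \<delta>" for k
      by (auto simp: B_def mem_box_cart abs_le_iff minus_le_iff)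
    have "norm z \<le> norm (fst z) + norm (snd z)"
      by (metis norm_Pair_le prod.collapse)
    also have "norm (fst z) \<le> (\<Sum>k\<in>UNIV. \<bar>fst z $ k\<bar>)" by (rule norm_le_l1_cart)
    also have "\<dots> \<le> (\<Sum>k\<in>(UNIV::'d set). \<delta>)" by (intro sum_mono z)
    finally have "norm z \<le> (real CARD('d) + 1) * \<delta>" using z(2) by (simp add: algebra_simps)
    then show "z \<in> V" using \<delta>(4) e(2) by auto
  qed

  define \<eta> where "\<eta> = \<delta> / 2"
  have \<eta>: "0 < \<eta>" "\<eta> < \<delta>" using \<delta> by (auto simp: \<eta>_def)
  obtain \<theta> and \<psi> :: "real^'d \<Rightarrow> complex" where \<theta>: "test_function \<delta> \<theta>" "\<And>t. \<bar>t\<bar> \<le> \<eta> \<Longrightarrow> \<theta> t = 1"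
    and \<psi>: "\<psi> \<in> tensors \<delta>" "\<And>x. (\<And>k. \<bar>x $ k\<bar> \<le> \<eta>) \<Longrightarrow> \<psi> x = 1"
    by (rule exists_plateau[OF \<eta>]) blast
  have \<theta>s: "smooth \<theta>" and \<theta>0: "\<theta> 0 = 1" using \<theta> \<eta> by (auto simp: test_function_def)

  \<comment> \<open>The coefficients \<open>a\<close> and \<open>b\<close> solve \<open>a + b = 1\<close> (continuity) and \<open>b - a = r\<close> (equal fluxes at leading order).\<close>
  define r where "r = cnp * \<gamma>p / (cnm * \<gamma>m)"
  define a b where "a = complex_of_real ((1 - r) / 2)" and "b = complex_of_real ((1 + r) / 2)"
  have ab: "a + b = 1" by (simp add: a_def b_def field_simps)
  \<comment> \<open>The second derivatives transversal to the axis \<open>j\<close> on the two sides; \<open>\<rho>\<close> compensates their contributions to the flux.\<close>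
  define Sp Sm where "Sp x = tangential_op cp cnp \<psi> x + (- ((complex_of_real \<gamma>p)\<^sup>2)) * pd j (pd j \<psi>) x"
    and "Sm x = tangential_op cm cnm \<psi> x + (- ((complex_of_real \<gamma>m)\<^sup>2)) * pd j (pd j \<psi>) x" for x
  define kp km where "kp = cnp / (2 * s * \<gamma>p) / (2 * cnm * s * \<gamma>m)"
    and "km = cnp * \<gamma>p / (2 * s * \<gamma>m\<^sup>2) / (2 * cnm * s * \<gamma>m)"
  define \<rho> where "\<rho> x = complex_of_real kp * Sp x + complex_of_real (- km) * Sm x" for x
  have \<rho>: "\<rho> \<in> tensors \<delta>"
    unfolding \<rho>_def[abs_def] Sp_def Sm_def
    by (intro tensors.add tensors.scale tensors_tangential_op tensors_pd \<psi>(1))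
  have zero: "(\<lambda>_::real^'d. 0) \<in> tensors \<delta>" using tensors.scale[OF \<psi>(1), of 0] by simp
  note minus_tens = tensors.scale[OF \<psi>(1), of a] tensors.scale[OF \<psi>(1), of b] \<rho> tensors.scale[OF \<rho>, of "- 1"]

  define vp where "vp \<tau> = corrected_mode cp cnp \<tau> \<alpha>p \<beta> (- (s * \<gamma>p)) s j \<theta> \<psi> (\<lambda>_. 0)" for \<tau>
  define v1 where "v1 \<tau> = corrected_mode cm cnm \<tau> \<alpha>m \<beta> (s * \<gamma>m) s j \<theta> (\<lambda>x. a * \<psi> x) \<rho>" for \<tau>
  define v2 where "v2 \<tau> = corrected_mode cm cnm \<tau> \<alpha>m \<beta> (- (s * \<gamma>m)) s j \<theta> (\<lambda>x. b * \<psi> x) (\<lambda>x. - 1 * \<rho> x)" for \<tau>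
  define vm where "vm \<tau> = (\<lambda>z. v1 \<tau> z + v2 \<tau> z)" for \<tau>
  have smooth: "smooth (vp \<tau>)" "smooth (v1 \<tau>)" "smooth (v2 \<tau>)" for \<tau>
    unfolding vp_def v1_def v2_def
    by (rule smooth_corrected_mode[where \<delta>=\<delta>], (intro minus_tens \<psi>(1) zero \<theta>s)+)+
  have slices: "(\<lambda>x. vp \<tau> (x, t)) \<in> tensors \<delta>" "(\<lambda>x. v1 \<tau> (x, t)) \<in> tensors \<delta>" "(\<lambda>x. v2 \<tau> (x, t)) \<in> tensors \<delta>" for \<tau> t
    unfolding vp_def v1_def v2_def by (intro tensors_corrected_mode minus_tens \<psi>(1) zero)+
  have smooth_vm: "smooth (vm \<tau>)" and slices_vm: "(\<lambda>x. vm \<tau> (x, t)) \<in> tensors \<delta>" for \<tau> t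
    unfolding vm_def by (intro smooth_add smooth tensors.add slices)+
  have vanish: "vp \<tau> z = 0" "vm \<tau> z = 0" if "z \<notin> B" for \<tau> z
  proof -
    obtain x t where z: "z = (x, t)" by (cases z)
    have "(\<exists>k. \<not> (- \<delta> \<le> x $ k \<and> x $ k \<le> \<delta>)) \<or> \<not> (- \<delta> \<le> t \<and> t \<le> \<delta>)"
      using that by (auto simp: B_def z mem_box_cart)
    then have "\<exists>k. \<delta> < \<bar>x $ k\<bar> \<or> \<delta> < \<bar>t\<bar>" by (metis abs_le_iff minus_le_iff not_le)
    then obtain k where k: "\<delta> < \<bar>x $ k\<bar> \<or> \<delta> < \<bar>t\<bar>" ..
    show "vp \<tau> z = 0" "vm \<tau> z = 0"
      unfolding z vm_def vp_def v1_def v2_def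
      by (simp_all only: corrected_mode_eq_0[OF _ _ \<theta>(1) k] minus_tens \<psi>(1) zero add_0)
  qed
  have Cc: "vp \<tau> \<in> Cc_infinity" "vm \<tau> \<in> Cc_infinity" for \<tau>
  proof -
    have "compact (supp v)" if "\<And>z. z \<notin> B \<Longrightarrow> v z = 0" for v :: "(real^'d) \<times> real \<Rightarrow> complex"
      using compact_Int_closed[OF B(1), of "supp v"] supp_subset[OF B(2), of v] that
      by (simp add: supp_def Int_absorb1)
    then show "vp \<tau> \<in> Cc_infinity" "vm \<tau> \<in> Cc_infinity"
      using vanish smooth(1) smooth_vm by (simp_all add: Cc_infinity_def smooth_def)
  qed
  have supp: "supp (glue (vp \<tau>) (vm \<tau>)) \<subseteq> V" for \<tau>
  proof -
    have "supp (glue (vp \<tau>) (vm \<tau>)) \<subseteq> B"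
      by (rule supp_subset[OF B(2)]) (simp add: glue_def vanish)
    then show ?thesis using \<open>B \<subseteq> V\<close> by blast
  qed

  have q: "complex_of_real (s * (cp j / cnp) / (- (s * \<gamma>p))) = - complex_of_real \<gamma>p"
    "complex_of_real (s * (cm j / cnm) / (s * \<gamma>m)) = complex_of_real \<gamma>m"
    "complex_of_real (s * (cm j / cnm) / (- (s * \<gamma>m))) = - complex_of_real \<gamma>m"
    unfolding \<gamma>(3,4)[symmetric] using s0 \<gamma>(1,2) by (simp_all add: power2_eq_square)
  have trans: "transmission cnp cnm \<alpha>p \<alpha>m \<tau> (vp \<tau>) (vm \<tau>)" if \<tau>: "\<tau> > 0" for \<tau>
    unfolding transmission_def
  proof
    fix x :: "real^'d"
    \<comment> \<open>At the interface the derivative of the weight is \<open>\<alpha>\<close>, so the flux is \<open>D_n_conj\<close>.\<close>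
    have D: "D_n w (x, 0) + \<i> * complex_of_real (\<tau> * \<alpha>) * w (x, 0) = D_n_conj \<tau> \<alpha> \<beta> w (x, 0)" for w \<alpha>
      by (simp add: D_n_conj_def deriv_weight)
    have "vp \<tau> (x, 0) = vm \<tau> (x, 0)"
    proof -
      have "vm \<tau> (x, 0) = cis (\<tau> * s * x $ j) * ((a + b) * \<psi> x)"
        unfolding vm_def v1_def v2_def corrected_mode_0[where \<theta>=\<theta>, OF \<theta>0] by (simp add: algebra_simps)
      then show ?thesis
        unfolding vp_def corrected_mode_0[where \<theta>=\<theta>, OF \<theta>0] ab by simp
    qed
    moreover have "complex_of_real cnp * D_n_conj \<tau> \<alpha>p \<beta> (vp \<tau>) (x, 0) = complex_of_real cnm * D_n_conj \<tau> \<alpha>m \<beta> (vm \<tau>) (x, 0)"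
    proof -
      have vm: "D_n_conj \<tau> \<alpha>m \<beta> (vm \<tau>) (x, 0) = D_n_conj \<tau> \<alpha>m \<beta> (v1 \<tau>) (x, 0) + D_n_conj \<tau> \<alpha>m \<beta> (v2 \<tau>) (x, 0)"
        unfolding vm_def D_n_conj_add[OF smooth(2,3)] ..
      have "\<forall>t. \<bar>t\<bar> \<le> \<eta> \<longrightarrow> \<theta> t = 1" using \<theta>(2) by blast
      note Dn = D_n_conj_corrected_mode_0[where \<theta>=\<theta>, OF \<theta>(1) \<eta>(1) this]
      have Q: "tangential_op cm cnm (\<lambda>x. u * \<psi> x) x + (- z) * pd j (pd j (\<lambda>x. u * \<psi> x)) x = u * (tangential_op cm cnm \<psi> x + (- z) * pd j (pd j \<psi>) x)"
         "pd j (\<lambda>x. u * \<psi> x) x = u * pd j \<psi> x" for u z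
        by (simp_all add: tangential_op_scale[OF \<psi>(1)] pd_scale_fun[OF \<psi>(1)] pd_scale_fun[OF tensors_pd[OF \<psi>(1)]] algebra_simps)
      show ?thesis
        unfolding vm
        unfolding vp_def v1_def v2_def Dn q Q power2_minus
          Sp_def[symmetric] Sm_def[symmetric] of_real_minus of_real_mult mult_zero_right add_0_right
        by (rule transmission_identity[where r="complex_of_real r"])
           (use \<tau> s0 \<gamma>(1,2) pos in \<open>simp_all add: a_def b_def r_def \<rho>_def kp_def km_def field_simps\<close>)
    qed
    ultimately show "vp \<tau> (x, 0) = vm \<tau> (x, 0) \<and>
        complex_of_real cnp * (D_n (vp \<tau>) (x, 0) + \<i> * complex_of_real (\<tau> * \<alpha>p) * vp \<tau> (x, 0)) =
        complex_of_real cnm * (D_n (vm \<tau>) (x, 0) + \<i> * complex_of_real (\<tau> * \<alpha>m) * vm \<tau> (x, 0))"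
      unfolding D by blast
  qed

  have \<nu>: "- (s * \<gamma>p) \<noteq> 0" "(- (s * \<gamma>p))\<^sup>2 = s\<^sup>2 * (cp j / cnp)" "s * \<gamma>m \<noteq> 0" "(s * \<gamma>m)\<^sup>2 = s\<^sup>2 * (cm j / cnm)"
    "- (s * \<gamma>m) \<noteq> 0" "(- (s * \<gamma>m))\<^sup>2 = s\<^sup>2 * (cm j / cnm)"
    using s0 \<gamma> by (simp_all add: power_mult_distrib)
  let ?\<Phi> = "\<lambda>\<tau> (x::real^'d) t. indicator (cbox (vec (- \<delta>)) (vec \<delta>)) x * inverse (1 + (\<tau> * t)\<^sup>2) :: real"
  obtain Kp where Kp: "Kp > 0" "\<And>\<tau> x t. 1 \<le> \<tau> \<Longrightarrow> (\<alpha>p + - (s * \<gamma>p)) * t \<le> - (3 * d) * \<bar>t\<bar> \<Longrightarrow>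
      cmod (L_tau_side cp cnp \<alpha>p \<beta> \<tau> (vp \<tau>) (x, t)) \<le> Kp / \<tau> * ?\<Phi> \<tau> x t"
    by (rule corrected_mode_decay[where c=cp and cn=cnp and j=j and s=s and \<alpha>="\<alpha>p" and \<beta>=\<beta> and \<nu>="- (s * \<gamma>p)" and d=d
        and \<psi>="\<psi>" and \<rho>="\<lambda>_. 0" and \<theta>=\<theta> and \<delta>=\<delta> and \<eta>=\<eta>,
        OF cp \<nu>(1,2) \<psi>(1) zero \<theta>(1) \<eta>(1) \<theta>(2) \<delta>(1,2) d(1) less_imp_le[OF pos(5)] \<delta>(3), folded vp_def]) (assumption, rule that)
  obtain K1 where K1: "K1 > 0" "\<And>\<tau> x t. 1 \<le> \<tau> \<Longrightarrow> (\<alpha>m + s * \<gamma>m) * t \<le> - (3 * d) * \<bar>t\<bar> \<Longrightarrow>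
      cmod (L_tau_side cm cnm \<alpha>m \<beta> \<tau> (v1 \<tau>) (x, t)) \<le> K1 / \<tau> * ?\<Phi> \<tau> x t"
    by (rule corrected_mode_decay[where c=cm and cn=cnm and j=j and s=s and \<alpha>="\<alpha>m" and \<beta>=\<beta> and \<nu>="s * \<gamma>m" and d=d
        and \<psi>="\<lambda>x. a * \<psi> x" and \<rho>="\<rho>" and \<theta>=\<theta> and \<delta>=\<delta> and \<eta>=\<eta>,
        OF cm \<nu>(3,4) minus_tens(1,3) \<theta>(1) \<eta>(1) \<theta>(2) \<delta>(1,2) d(1) less_imp_le[OF pos(5)] \<delta>(3), folded v1_def]) (assumption, rule that)
  obtain K2 where K2: "K2 > 0" "\<And>\<tau> x t. 1 \<le> \<tau> \<Longrightarrow> (\<alpha>m + - (s * \<gamma>m)) * t \<le> - (3 * d) * \<bar>t\<bar> \<Longrightarrow>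
      cmod (L_tau_side cm cnm \<alpha>m \<beta> \<tau> (v2 \<tau>) (x, t)) \<le> K2 / \<tau> * ?\<Phi> \<tau> x t"
    by (rule corrected_mode_decay[where c=cm and cn=cnm and j=j and s=s and \<alpha>="\<alpha>m" and \<beta>=\<beta> and \<nu>="- (s * \<gamma>m)" and d=d
        and \<psi>="\<lambda>x. b * \<psi> x" and \<rho>="\<lambda>x. - 1 * \<rho> x" and \<theta>=\<theta> and \<delta>=\<delta> and \<eta>=\<eta>,
        OF cm \<nu>(5,6) minus_tens(2,4) \<theta>(1) \<eta>(1) \<theta>(2) \<delta>(1,2) d(1) less_imp_le[OF pos(5)] \<delta>(3), folded v2_def]) (assumption, rule that)
  define K where "K = Kp + K1 + K2"
  have "K > 0" using Kp K1 K2 by (simp add: K_def)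
  let ?L = "\<lambda>\<tau>. L_tau cp cm cnp cnm \<alpha>p \<alpha>m \<beta> \<tau> (vp \<tau>) (vm \<tau>)"
  have upper: "cmod (?L \<tau> (x, t)) \<le> K / \<tau> * ?\<Phi> \<tau> x t" if \<tau>: "1 \<le> \<tau>" for \<tau> x t
  proof -
    have \<Phi>: "0 \<le> ?\<Phi> \<tau> x t" by simp
    have mono: "k / \<tau> * ?\<Phi> \<tau> x t \<le> K / \<tau> * ?\<Phi> \<tau> x t" if "k \<le> K" for k
      using that \<tau> \<Phi> by (intro mult_right_mono divide_right_mono) auto
    have neg: "z * t \<le> - (3 * d) * \<bar>t\<bar>" if "3 * d \<le> z" "t < 0" for z
      using that mult_right_mono[of "3 * d" z "- t"] by simp
    consider "t > 0" | "t = 0" | "t < 0" by linarith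
    then show ?thesis
    proof cases
      case 1
      then have "(\<alpha>p + - (s * \<gamma>p)) * t \<le> - (3 * d) * \<bar>t\<bar>"
        using d(2) mult_right_mono[of "3 * d" "s * \<gamma>p - \<alpha>p" t] by (simp add: algebra_simps)
      from Kp(2)[OF \<tau> this, of x] show ?thesis
        using 1 mono[of Kp] K1 K2 by (simp add: L_tau_def glue_def K_def)
    next
      case 2
      then show ?thesis using \<Phi> \<open>K > 0\<close> \<tau> by (simp add: L_tau_def glue_def)
    next
      case 3
      have "cmod (L_tau_side cm cnm \<alpha>m \<beta> \<tau> (vm \<tau>) (x, t)) \<le> K1 / \<tau> * ?\<Phi> \<tau> x t + K2 / \<tau> * ?\<Phi> \<tau> x t"
        unfolding vm_def L_tau_side_add[OF cm smooth(2) slices(2) smooth(3) slices(3)]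
        by (intro norm_triangle_mono K1(2) K2(2) \<tau> neg 3) (use d in auto)
      also have "\<dots> = (K1 + K2) / \<tau> * ?\<Phi> \<tau> x t" by (simp add: add_divide_distrib distrib_right)
      also have "\<dots> \<le> K / \<tau> * ?\<Phi> \<tau> x t" by (rule mono) (use Kp in \<open>simp add: K_def\<close>)
      finally show ?thesis using 3 by (simp add: L_tau_def glue_def)
    qed
  qed

  \<comment> \<open>For \<open>0 < t \<le> 1 / \<tau>\<close> the profile stays above this constant, and where \<open>\<psi> = 1\<close> all corrections vanish.\<close>
  define k where "k = exp (- \<bar>\<alpha>p + - (s * \<gamma>p)\<bar>)"
  have lower: "k \<le> cmod (glue (vp \<tau>) (vm \<tau>) (x, t))"
    if \<tau>: "1 \<le> \<tau>" "1 / \<eta> \<le> \<tau>" and x: "x \<in> cbox (vec (- \<eta> / 2)) (vec (\<eta> / 2))" and t: "0 < t" "t \<le> 1 / \<tau>" for \<tau> x t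
  proof -
    define U where "U = (\<Inter>k. {x::real^'d. \<bar>x $ k\<bar> < \<eta>})"
    have U: "open U" unfolding U_def
      by (intro open_INT ballI open_Collect_less continuous_intros) auto
    have "\<bar>x $ k\<bar> < \<eta>" for k
    proof -
      have "- \<eta> / 2 \<le> x $ k \<and> x $ k \<le> \<eta> / 2" using x by (simp add: mem_box_cart)
      then show ?thesis using \<eta>(1) by linarith
    qed
    then have "x \<in> U" by (simp add: U_def)
    have \<psi>U: "\<psi> y = 1" if "y \<in> U" for y using \<psi>(2) that by (auto simp: U_def intro: less_imp_le)
    have "1 / \<tau> \<le> \<eta>" using \<tau> \<eta> by (simp add: field_simps)
    then have "\<theta> t = 1" using t \<eta> by (intro \<theta>(2)) auto
    have "\<tau> * t \<le> 1" using t \<tau> by (simp add: field_simps)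
    then have "\<bar>\<alpha>p + - (s * \<gamma>p)\<bar> * (\<tau> * t) \<le> \<bar>\<alpha>p + - (s * \<gamma>p)\<bar>" using t \<tau> by (intro mult_left_le) auto
    moreover have "- (\<bar>\<alpha>p + - (s * \<gamma>p)\<bar> * (\<tau> * t)) \<le> (\<alpha>p + - (s * \<gamma>p)) * (\<tau> * t)"
      using t \<tau> mult_right_mono[of "- \<bar>\<alpha>p + - (s * \<gamma>p)\<bar>" "\<alpha>p + - (s * \<gamma>p)" "\<tau> * t"] by simp
    moreover have "\<tau> * (weight \<alpha>p \<beta> t + - (s * \<gamma>p) * t) = (\<alpha>p + - (s * \<gamma>p)) * (\<tau> * t) + \<tau> * (\<beta> * t\<^sup>2 / 2)"
      by (simp add: weight_def algebra_simps)
    moreover have "0 \<le> \<tau> * (\<beta> * t\<^sup>2 / 2)" using \<tau> pos by simp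
    ultimately have "k \<le> profile \<tau> \<alpha>p \<beta> (- (s * \<gamma>p)) t"
      unfolding k_def profile_def exp_le_cancel_iff by linarith
    also have "\<dots> = cmod (vp \<tau> (x, t))"
      unfolding vp_def
      by (intro corrected_mode_on_plateau[where U=U, symmetric] U \<psi>U \<open>x \<in> U\<close> \<open>\<theta> t = 1\<close>)
    finally show ?thesis using t by (simp add: glue_def)
  qed

  let ?V = "measure lborel (cbox (vec (- \<delta>)) (vec \<delta>) :: (real^'d) set)"
    and ?V' = "measure lborel (cbox (vec (- \<eta> / 2)) (vec (\<eta> / 2)) :: (real^'d) set)"
    and ?J = "LINT t|lborel. inverse (1 + t\<^sup>2) :: real"
  have "?V' > 0"
  proof -
    have "(0 :: real^'d) \<in> cbox (vec (- \<eta> / 2)) (vec (\<eta> / 2))"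
      using \<eta> by (simp add: mem_box_cart)
    then have "cbox (vec (- \<eta> / 2)) (vec (\<eta> / 2)) \<noteq> ({} :: (real^'d) set)" by blast
    then show ?thesis using \<eta> by (subst content_cbox_cart) (auto intro!: prod_pos)
  qed
  have "k > 0" by (simp add: k_def)
  \<comment> \<open>The squared norm of the image is at most a constant times \<open>1 / \<tau>\<^sup>3\<close>, that of the quasimode at least a constant times \<open>1 / \<tau>\<close>.\<close>
  define \<tau> where "\<tau> = Max {\<tau>0, 1, 1 / \<eta>, C\<^sup>2 * K\<^sup>2 * ?V * ?J / (k\<^sup>2 * ?V')}"
  have \<tau>: "\<tau>0 \<le> \<tau>" "1 \<le> \<tau>" "1 / \<eta> \<le> \<tau>" "C\<^sup>2 * K\<^sup>2 * ?V * ?J / (k\<^sup>2 * ?V') \<le> \<tau>"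
    by (auto simp: \<tau>_def)
  have "ennreal C * L2_norm (?L \<tau>) \<le> L2_norm (glue (vp \<tau>) (vm \<tau>))"
  proof -
    have "?L \<tau> \<in> borel_measurable borel"
      unfolding L_tau_def
      by (intro glue_measurable continuous_on_L_tau_side[OF cp smooth(1) slices(1)]
          continuous_on_L_tau_side[OF cm smooth_vm slices_vm])
    then have "L2_norm (?L \<tau>) \<le> ennreal (sqrt (K\<^sup>2 * ?V * ?J / \<tau> ^ 3))"
      using \<tau>(2) \<open>K > 0\<close> by (intro L2_norm_concentrated_le upper) auto
    then have "ennreal C * L2_norm (?L \<tau>) \<le> ennreal C * ennreal (sqrt (K\<^sup>2 * ?V * ?J / \<tau> ^ 3))"
      by (rule mult_left_mono) simp
    also have "\<dots> = ennreal (sqrt (C\<^sup>2 * K\<^sup>2 * ?V * ?J / \<tau> ^ 3))"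
      using C by (simp add: real_sqrt_mult real_sqrt_divide mult.assoc flip: ennreal_mult')
    also have "\<dots> \<le> ennreal (sqrt (k\<^sup>2 * ?V' / \<tau>))"
    proof (intro ennreal_leI real_sqrt_le_mono)
      have "C\<^sup>2 * K\<^sup>2 * ?V * ?J \<le> k\<^sup>2 * ?V' * \<tau>"
        using \<tau>(4) \<open>k > 0\<close> \<open>?V' > 0\<close> by (simp add: divide_le_eq mult_ac)
      also have "\<dots> \<le> k\<^sup>2 * ?V' * \<tau>\<^sup>2"
        using \<tau>(2) \<open>?V' > 0\<close> by (intro mult_left_mono) (auto simp: power2_eq_square)
      finally have "C\<^sup>2 * K\<^sup>2 * ?V * ?J / \<tau> ^ 3 \<le> k\<^sup>2 * ?V' * \<tau>\<^sup>2 / \<tau> ^ 3"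
        using \<tau>(2) by (intro divide_right_mono) auto
      also have "\<dots> = k\<^sup>2 * ?V' / \<tau>" using \<tau>(2) by (simp add: power2_eq_square power3_eq_cube)
      finally show "C\<^sup>2 * K\<^sup>2 * ?V * ?J / \<tau> ^ 3 \<le> k\<^sup>2 * ?V' / \<tau>" .
    qed
    also have "\<dots> \<le> L2_norm (glue (vp \<tau>) (vm \<tau>))"
      using \<tau> \<open>k > 0\<close> by (intro L2_norm_concentrated_ge lower) auto
    finally show ?thesis .
  qed
  moreover have "glue (vp \<tau>) (vm \<tau>) \<noteq> (\<lambda>x. 0)"
  proof
    assume "glue (vp \<tau>) (vm \<tau>) = (\<lambda>x. 0)"
    moreover have "(0::real^'d) \<in> cbox (vec (- \<eta> / 2)) (vec (\<eta> / 2))" using \<eta> by (simp add: mem_box_cart)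
    ultimately show False using lower[OF \<tau>(2,3), of 0 "1 / \<tau>"] \<tau>(2) \<open>k > 0\<close> by simp
  qed
  moreover have "transmission cnp cnm \<alpha>p \<alpha>m \<tau> (vp \<tau>) (vm \<tau>)" using \<tau>(2) by (intro trans) simp
  ultimately show "\<exists>\<tau>\<ge>\<tau>0. \<exists>vp\<in>Cc_infinity. \<exists>vm\<in>Cc_infinity.
       glue vp vm \<noteq> (\<lambda>x. 0) \<and>
       transmission cnp cnm \<alpha>p \<alpha>m \<tau> vp vm \<and>
       supp (glue vp vm) \<subseteq> V \<and>
       ennreal C * L2_norm (L_tau cp cm cnp cnm \<alpha>p \<alpha>m \<beta> \<tau> vp vm) \<le> L2_norm (glue vp vm)"
    using \<tau>(1) Cc supp by (intro exI[of _ \<tau>] conjI bexI[of _ "vp \<tau>"] bexI[of _ "vm \<tau>"])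
qed

end
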